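(* Let $n\ge 2$ and let $B,H,F$ satisfy the standing assumptions listed in the context. Assume that one of the following conditions is valid: (i) Assumption (A) holds and $u\in L^\infty(\mathbb{R}^n)\cap W^{1,p}_{\rm loc}(\mathbb{R}^n)$ (with $p$ the exponent in (A)) is a weak solution in $\mathbb{R}^n$ of $\partial_{x_i}\big(B'(H(\nabla u))H_i(\nabla u)\big)+F'(u)=0$; (ii) Assumption (B) holds and $u\in W^{1,\infty}(\mathbb{R}^n)$ is a weak solution of the same equation in $\mathbb{R}^n$. Assume that $$B'(H(\nabla u(x)))\,H(\nabla u(x))-B(H(\nabla u(x)))=c_u-F(u(x))\qquad\text{for all }x\in\mathbb{R}^n.$$ Then there exist $u_0:\mathbb{R}\to\mathbb{R}$ and $\omega\in S^{n-1}$ such that $u(x)=u_0(\omega\cdot x)$ for any $x\in\mathbb{R}^n$.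
   Context: Standing assumptions, for some $\beta\in(0,1)$. $B\in C^{3,\beta}_{\rm loc}((0,+\infty))\cap C^1([0,+\infty))$ with $B(0)=B'(0)=0$ and $B(t),B'(t),B''(t)>0$ for all $t>0$. $H:\mathbb{R}^n\to\mathbb{R}$ is positive homogeneous of degree $1$ (i.e. $H(t\xi)=tH(\xi)$ for $t>0$; not necessarily even), of class $C^{3,\beta}_{\rm loc}(\mathbb{R}^n\setminus\{0\})$, with $H(\xi)>0$ for $\xi\ne0$ and $H(0)=0$. $F\in C^{2,\beta}_{\rm loc}(\mathbb{R})$. Subscripts denote partial derivatives, e.g. $H_i=\partial_{\xi_i}H$; repeated indices are summed from $1$ to $n$. Assumption (A): there exist $p>1$, $\kappa\in[0,1)$ and $\gamma,\Gamma>0$ such that for all $\xi\in\mathbb{R}^n\setminus\{0\}$, $\zeta\in\mathbb{R}^n$, $$[\mathrm{Hess}(B\circ H)(\xi)]_{ij}\zeta_i\zeta_j\ge\gamma(\kappa+|\xi|)^{p-2}|\zeta|^2,\qquad \sum_{i,j=1}^n\big|[\mathrm{Hess}(B\circ H)(\xi)]_{ij}\big|\le\Gamma(\kappa+|\xi|)^{p-2}.$$ Assumption (B): $B\circ H\in C^{3,\beta}_{\rm loc}(\mathbb{R}^n)$ and for every $K>0$ there exists $\gamma>0$ such that $[\mathrm{Hess}(B\circ H)(\xi)]_{ij}\zeta_i\zeta_j\ge\gamma|\zeta|^2$ for all $\xi,\zeta\in\mathbb{R}^n$ with $|\xi|\le K$. Weak solution: $\int_{\mathbb{R}^n}\big(B'(H(\nabla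 u))H_i(\nabla u)\,\partial_i\varphi-F'(u)\varphi\big)\,dx=0$ for all $\varphi\in C^\infty_c(\mathbb{R}^n)$, where $B'(H(\xi))H_i(\xi)$ is understood as $0$ (its continuous extension) at $\xi=0$. Such weak solutions are of class $C^{1}(\mathbb{R}^n)$, and $u$ denotes the $C^1$ representative. $c_u:=\sup\{F(r): r\in[\inf_{\mathbb{R}^n}u,\sup_{\mathbb{R}^n}u]\}$. *)

theory Defs
  imports "HOL-Analysis.Analysis"
begin

definition dir_deriv :: "'a::euclidean_space \<Rightarrow> ('a \<Rightarrow> real) \<Rightarrow> 'a \<Rightarrow> real" where
  "dir_deriv v f x = frechet_derivative f (at x) v"

definition partial :: "'n::finite \<Rightarrow> (real ^ 'n \<Rightarrow> real) \<Rightarrow> real ^ 'n \<Rightarrow> real" where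
  "partial i f = dir_deriv (axis i 1) f"

definition grad :: "(real ^ 'n \<Rightarrow> real) \<Rightarrow> real ^ 'n::finite \<Rightarrow> real ^ 'n" where
  "grad f x = (\<chi> i. partial i f x)"

definition hess :: "(real ^ 'n \<Rightarrow> real) \<Rightarrow> real ^ 'n::finite \<Rightarrow> real ^ 'n ^ 'n" where
  "hess f x = (\<chi> i j. partial i (partial j f) x)"

text \<open>The two families below are used with an open set \<open>S\<close>; on the real line the only basis
  vector is \<open>1\<close>, so that \<open>dir_deriv 1\<close> is the ordinary derivative.\<close>

primrec C_k :: "nat \<Rightarrow> 'a set \<Rightarrow> ('a::euclidean_space \<Rightarrow> real) \<Rightarrow> bool" where
  "C_k 0 S f \<longleftrightarrow> continuous_on S f"
| "C_k (Suc k) S f \<longleftrightarrow>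
     (\<forall>x\<in>S. f differentiable (at x)) \<and> (\<forall>b\<in>Basis. C_k k S (dir_deriv b f))"

definition Holder_loc :: "real \<Rightarrow> 'a set \<Rightarrow> ('a::euclidean_space \<Rightarrow> real) \<Rightarrow> bool" where
  "Holder_loc \<beta> S f \<longleftrightarrow>
     (\<forall>K. compact K \<and> K \<subseteq> S \<longrightarrow>
        (\<exists>C. \<forall>x\<in>K. \<forall>y\<in>K. \<bar>f x - f y\<bar> \<le> C * norm (x - y) powr \<beta>))"

primrec C_k_Holder_loc ::
    "nat \<Rightarrow> real \<Rightarrow> 'a set \<Rightarrow> ('a::euclidean_space \<Rightarrow> real) \<Rightarrow> bool" where
  "C_k_Holder_loc 0 \<beta> S f \<longleftrightarrow> Holder_loc \<beta> S f"
| "C_k_Holder_loc (Suc k) \<beta> S f \<longleftrightarrow>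
     (\<forall>x\<in>S. f differentiable (at x)) \<and> (\<forall>b\<in>Basis. C_k_Holder_loc k \<beta> S (dir_deriv b f))"

definition test_function :: "('a::euclidean_space \<Rightarrow> real) \<Rightarrow> bool" where
  "test_function \<phi> \<longleftrightarrow> (\<forall>k. C_k k UNIV \<phi>) \<and> compact (closure {x. \<phi> x \<noteq> 0})"

definition L_inf :: "('a::euclidean_space \<Rightarrow> 'b::euclidean_space) \<Rightarrow> bool" where
  "L_inf f \<longleftrightarrow> f \<in> borel_measurable lebesgue \<and> (\<exists>C. AE x in lebesgue. norm (f x) \<le> C)"

definition L_p_loc :: "real \<Rightarrow> ('a::euclidean_space \<Rightarrow> 'b::euclidean_space) \<Rightarrow> bool" where
  "L_p_loc p f \<longleftrightarrow> f \<in> borel_measurable lebesgue \<and>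
     (\<forall>K. compact K \<longrightarrow> set_integrable lebesgue K (\<lambda>x. norm (f x) powr p))"

definition weak_gradient :: "(real ^ 'n \<Rightarrow> real) \<Rightarrow> (real ^ 'n::finite \<Rightarrow> real ^ 'n) \<Rightarrow> bool" where
  "weak_gradient u g \<longleftrightarrow> L_p_loc 1 u \<and> L_p_loc 1 g \<and>
     (\<forall>\<phi> i. test_function \<phi> \<longrightarrow>
        (LINT x|lebesgue. u x * partial i \<phi> x) = - (LINT x|lebesgue. g x $ i * \<phi> x))"

definition W1p_loc :: "real \<Rightarrow> (real ^ 'n::finite \<Rightarrow> real) \<Rightarrow> bool" where
  "W1p_loc p u \<longleftrightarrow> L_p_loc p u \<and> (\<exists>g. weak_gradient u g \<and> L_p_loc p g)"

definition W1_inf :: "(real ^ 'n::finite \<Rightarrow> real) \<Rightarrow> bool" where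
  "W1_inf u \<longleftrightarrow> L_inf u \<and> (\<exists>g. weak_gradient u g \<and> L_inf g)"

text \<open>Functions on the closed half line are represented by functions on \<open>real\<close> whose values at
  negative arguments are irrelevant. The derivative of \<open>B\<close> is therefore taken within \<open>{0..}\<close>:
  it is one-sided at \<open>0\<close> and the ordinary derivative at every positive argument.\<close>

definition half_deriv :: "(real \<Rightarrow> real) \<Rightarrow> real \<Rightarrow> real" where
  "half_deriv B t = vector_derivative B (at t within {0..})"

definition standing_B :: "real \<Rightarrow> (real \<Rightarrow> real) \<Rightarrow> bool" where
  "standing_B \<beta> B \<longleftrightarrow>
     C_k_Holder_loc 3 \<beta> {0<..} B \<and>
     B differentiable_on {0..} \<and> continuous_on {0..} (half_deriv B) \<and>
     B 0 = 0 \<and> half_deriv B 0 = 0 \<and>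
     (\<forall>t>0. B t > 0 \<and> half_deriv B t > 0 \<and> deriv (half_deriv B) t > 0)"

definition standing_H :: "real \<Rightarrow> (real ^ 'n::finite \<Rightarrow> real) \<Rightarrow> bool" where
  "standing_H \<beta> H \<longleftrightarrow>
     (\<forall>t>0. \<forall>\<xi>. H (t *\<^sub>R \<xi>) = t * H \<xi>) \<and>
     C_k_Holder_loc 3 \<beta> (- {0}) H \<and>
     (\<forall>\<xi>. \<xi> \<noteq> 0 \<longrightarrow> H \<xi> > 0) \<and> H 0 = 0"

definition assumption_A :: "real \<Rightarrow> (real \<Rightarrow> real) \<Rightarrow> (real ^ 'n::finite \<Rightarrow> real) \<Rightarrow> bool" where
  "assumption_A p B H \<longleftrightarrow> p > 1 \<and>
     (\<exists>\<kappa> \<gamma> \<Gamma>. 0 \<le> \<kappa> \<and> \<kappa> < 1 \<and> \<gamma> > 0 \<and> \<Gamma> > 0 \<and>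
        (\<forall>\<xi> \<zeta>. \<xi> \<noteq> 0 \<longrightarrow>
           (\<Sum>i\<in>UNIV. \<Sum>j\<in>UNIV. hess (B \<circ> H) \<xi> $ i $ j * \<zeta> $ i * \<zeta> $ j)
             \<ge> \<gamma> * (\<kappa> + norm \<xi>) powr (p - 2) * (norm \<zeta>)\<^sup>2 \<and>
           (\<Sum>i\<in>UNIV. \<Sum>j\<in>UNIV. \<bar>hess (B \<circ> H) \<xi> $ i $ j\<bar>)
             \<le> \<Gamma> * (\<kappa> + norm \<xi>) powr (p - 2)))"

definition assumption_B :: "real \<Rightarrow> (real \<Rightarrow> real) \<Rightarrow> (real ^ 'n::finite \<Rightarrow> real) \<Rightarrow> bool" where
  "assumption_B \<beta> B H \<longleftrightarrow>
     C_k_Holder_loc 3 \<beta> UNIV (B \<circ> H) \<and>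
     (\<forall>K>0. \<exists>\<gamma>>0. \<forall>\<xi> \<zeta>. norm \<xi> \<le> K \<longrightarrow>
        (\<Sum>i\<in>UNIV. \<Sum>j\<in>UNIV. hess (B \<circ> H) \<xi> $ i $ j * \<zeta> $ i * \<zeta> $ j) \<ge> \<gamma> * (norm \<zeta>)\<^sup>2)"

definition flux :: "(real \<Rightarrow> real) \<Rightarrow> (real ^ 'n \<Rightarrow> real) \<Rightarrow> real ^ 'n::finite \<Rightarrow> real ^ 'n" where
  "flux B H \<xi> = (if \<xi> = 0 then 0 else half_deriv B (H \<xi>) *\<^sub>R grad H \<xi>)"

text \<open>To be used for \<open>u\<close> of class \<open>C\<^sup>1\<close> only: \<open>grad u\<close> is the classical gradient, which for such
  \<open>u\<close> is a continuous representative of the weak one. The integrand is then continuous with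
  compact support, so the Bochner integral carries no default value.\<close>

definition weak_solution ::
    "(real \<Rightarrow> real) \<Rightarrow> (real ^ 'n::finite \<Rightarrow> real) \<Rightarrow> (real \<Rightarrow> real) \<Rightarrow> (real ^ 'n \<Rightarrow> real) \<Rightarrow> bool" where
  "weak_solution B H F u \<longleftrightarrow>
     (\<forall>\<phi>. test_function \<phi> \<longrightarrow>
        (LINT x|lebesgue.
           (\<Sum>i\<in>UNIV. flux B H (grad u x) $ i * partial i \<phi> x) - deriv F (u x) * \<phi> x) = 0)"

definition c_const :: "(real \<Rightarrow> real) \<Rightarrow> ('a \<Rightarrow> real) \<Rightarrow> real" where
  "c_const F u = (SUP r\<in>{(INF x. u x)..(SUP x. u x)}. F r)"

end

theory Submission
  imports Defs
begin

text \<open>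
  Where \<open>\<nabla>u \<noteq> 0\<close>, the energy identity reads \<open>H(\<nabla>u) = h(u)\<close>, because \<open>t \<mapsto> t B'(t) - B(t)\<close> is strictly
  increasing. Put \<open>v = G(u)\<close> with \<open>G' = 1/h\<close>, \<open>a = \<nabla>v\<close>, \<open>E = B \<circ> H\<close> and \<open>Y = \<nabla>E(a)\<close>. Then \<open>H(a) = 1\<close>, so
  \<open>E(a)\<close> is constant, and the equation for \<open>u\<close> becomes \<open>div Y = 0\<close>.

  Formally, differentiating \<open>E(a) = const\<close> gives \<open>D\<^sup>2v Y = 0\<close>, hence \<open>DY Y = D\<^sup>2E(a) D\<^sup>2v Y = 0\<close>, and the
  divergence of this field is \<open>0 = tr (DY DY) + Y \<bullet> \<nabla>(div Y) = tr (DY DY)\<close>. As \<open>DY\<close> is the product of a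
  positive definite matrix and the symmetric matrix \<open>D\<^sup>2v\<close>, this trace dominates \<open>|D\<^sup>2v|\<^sup>2\<close>, so \<open>a\<close> is
  locally constant. For \<open>v\<close> of class \<open>C\<^sup>1\<close> the computation is carried out for mollifications; the error
  terms tend to 0 because of the Caccioppoli estimate \<open>\<integral>|a(x - z) - a(x)|\<^sup>2 \<le> C|z|\<^sup>2\<close>.

  Globally, \<open>u\<close> is constant along the hyperplane through \<open>x\<close> orthogonal to \<open>\<nabla>u(x) \<noteq> 0\<close> as long as
  \<open>\<nabla>u \<noteq> 0\<close> there; then so is \<open>H(\<nabla>u)\<close>, and the gradient never vanishes on it. Two hyperplanes of this
  kind that are not parallel would meet, so the gradients of \<open>u\<close> at all points are parallel.
\<close>


section \<open>Smooth functions and mollifiers\<close>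

text \<open>The obstacle is regularity: \<open>u\<close> is only of class C^1, so no second
  derivative is at hand, and the equation may degenerate where the gradient vanishes. All analysis
  is therefore local near points with nonzero gradient. The equation for v comes from testing with
  \<phi> / B'(h(u)): differentiating the energy identity gives (B'(h))' = - F'/h, and by Euler's
  relation for H this cancels the F' term exactly.

  The mollified a and Y satisfy neither Y = \<nabla>E(a) nor E(a) = const, and continuity alone
  bounds their derivatives only by o(1)/\<epsilon>. The errors in both relations are therefore
  measured against increments of a rather than against \<epsilon>: Taylor expansion bounds them by
  \<delta> |a(x - w) - a(x)|, and the averages of |a(x - w) - a(x)|/\<epsilon> over small w are
  bounded in L^2 uniformly in \<epsilon>. This is just enough, the trace being quadratic in the
  derivatives.\<close>

lemma dir_deriv_eq: "(f has_derivative f') (at x) \<Longrightarrow> dir_deriv v f x = f' v"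
  unfolding dir_deriv_def by (metis frechet_derivative_at)

lemma C_k_cong:
  assumes "\<And>x. f x = g x" shows "C_k k S f = C_k k S g"
proof -
  have "f = g" using assms by auto
  then show ?thesis by simp
qed

lemma C_k_mono: "C_k (Suc k) S f \<Longrightarrow> C_k k S f"
proof (induction k arbitrary: f)
  case 0
  then show ?case
    by (auto intro!: continuous_at_imp_continuous_on differentiable_imp_continuous_within)
next
  case (Suc k)
  then show ?case by simp
qed

lemma C_k_le: "C_k m S f \<Longrightarrow> k \<le> m \<Longrightarrow> C_k k S f"
  by (induction m) (use C_k_mono le_Suc_eq in blast)+

lemma C_k_continuous: "C_k k S f \<Longrightarrow> continuous_on S f"
  using C_k_le[of k S f 0] by simp

lemma C_k_const: "C_k k UNIV (\<lambda>x::'a::euclidean_space. c)"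
proof (induction k arbitrary: c)
  case (Suc k)
  have "dir_deriv b (\<lambda>x::'a. c) = (\<lambda>x. 0)" for b
    by (rule ext, rule dir_deriv_eq[where f'="\<lambda>h. 0"]) auto
  then show ?case using Suc by simp
qed simp

lemma C_k_add:
  assumes "C_k k UNIV f" "C_k k UNIV g"
  shows "C_k k UNIV (\<lambda>x::'a::euclidean_space. f x + g x)"
  using assms
proof (induction k arbitrary: f g)
  case 0
  then show ?case by (auto intro: continuous_intros)
next
  case (Suc k)
  have "dir_deriv b (\<lambda>x. f x + g x) x = dir_deriv b f x + dir_deriv b g x" for b x
    unfolding dir_deriv_def using Suc.prems
    by (subst frechet_derivative_at[symmetric, OF has_derivative_add[OF frechet_derivative_works[THEN iffD1] frechet_derivative_works[THEN iffD1]]]) auto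
  then have "dir_deriv b (\<lambda>x. f x + g x) = (\<lambda>x. dir_deriv b f x + dir_deriv b g x)" for b by auto
  then show ?case using Suc by auto
qed

lemma C_k_mult:
  assumes "C_k k UNIV f" "C_k k UNIV g"
  shows "C_k k UNIV (\<lambda>x::'a::euclidean_space. f x * g x)"
  using assms
proof (induction k arbitrary: f g)
  case 0
  then show ?case by (auto intro: continuous_intros)
next
  case (Suc k)
  have "dir_deriv b (\<lambda>x. f x * g x) x = f x * dir_deriv b g x + dir_deriv b f x * g x" for b x
    unfolding dir_deriv_def using Suc.prems
    by (subst frechet_derivative_at[symmetric, OF has_derivative_mult[OF frechet_derivative_works[THEN iffD1] frechet_derivative_works[THEN iffD1]]]) auto
  then have "dir_deriv b (\<lambda>x. f x * g x) = (\<lambda>x. f x * dir_deriv b g x + dir_deriv b f x * g x)" for b by auto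
  then show ?case using Suc.prems
    by (auto intro!: C_k_add Suc.IH intro: C_k_mono C_k.simps(2)[THEN iffD2])
qed

lemma C_k_compose_affine:
  assumes "C_k k UNIV f"
  shows "C_k k UNIV (\<lambda>x::'a::euclidean_space. f (s *\<^sub>R x + a))"
  using assms
proof (induction k arbitrary: f)
  case 0
  then have "continuous_on UNIV (\<lambda>x. f (s *\<^sub>R x + a))"
    by (auto intro!: continuous_intros continuous_on_compose2[of UNIV f])
  then show ?case by simp
next
  case (Suc k)
  have d: "((\<lambda>x. f (s *\<^sub>R x + a)) has_derivative (\<lambda>h. frechet_derivative f (at (s *\<^sub>R x + a)) (s *\<^sub>R h))) (at x)" for x
    using Suc.prems
    by (intro has_derivative_compose[of "\<lambda>x. s *\<^sub>R x + a" _ _ _ f])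
      (auto intro!: derivative_eq_intros frechet_derivative_works[THEN iffD1])
  have "dir_deriv b (\<lambda>x. f (s *\<^sub>R x + a)) x = s * dir_deriv b f (s *\<^sub>R x + a)" for b x
    unfolding dir_deriv_eq[OF d] dir_deriv_def using Suc.prems
    by (simp add: linear_cmul[OF linear_frechet_derivative])
  then have "dir_deriv b (\<lambda>x. f (s *\<^sub>R x + a)) = (\<lambda>x. s * dir_deriv b f (s *\<^sub>R x + a))" for b by auto
  then show ?case using Suc d
    by (auto intro!: C_k_mult C_k_const simp: differentiable_def)
qed

lemma C_k_compose_inner:
  fixes \<psi> :: "real \<Rightarrow> real" and c :: "'a::euclidean_space"
  assumes "C_k k UNIV \<psi>"
  shows "C_k k UNIV (\<lambda>x. \<psi> (x \<bullet> c))"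
  using assms
proof (induction k arbitrary: \<psi>)
  case 0
  then have "continuous_on UNIV (\<lambda>x. \<psi> (x \<bullet> c))"
    by (auto intro!: continuous_intros continuous_on_compose2[of UNIV \<psi>])
  then show ?case by simp
next
  case (Suc k)
  have d: "((\<lambda>x. \<psi> (x \<bullet> c)) has_derivative (\<lambda>h. frechet_derivative \<psi> (at (x \<bullet> c)) (h \<bullet> c))) (at x)" for x
    using Suc.prems
    by (intro has_derivative_compose[of "\<lambda>x. x \<bullet> c" _ _ _ \<psi>])
      (auto intro!: derivative_eq_intros frechet_derivative_works[THEN iffD1])
  have "frechet_derivative \<psi> (at y) t = t * frechet_derivative \<psi> (at y) 1" for y t
    using linear_cmul[OF linear_frechet_derivative, of \<psi> "at y" t 1] Suc.prems by simp
  then have "dir_deriv b (\<lambda>x. \<psi> (x \<bullet> c)) x = (b \<bullet> c) * dir_deriv 1 \<psi> (x \<bullet> c)" for b x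
    unfolding dir_deriv_eq[OF d] dir_deriv_def by metis
  then have "dir_deriv b (\<lambda>x. \<psi> (x \<bullet> c)) = (\<lambda>x. (b \<bullet> c) * dir_deriv 1 \<psi> (x \<bullet> c))" for b by auto
  then show ?case using Suc d
    by (auto intro!: C_k_mult C_k_const simp: differentiable_def)
qed

lemma C_k_prod:
  assumes "finite I" "\<And>i. i \<in> I \<Longrightarrow> C_k k UNIV (f i)"
  shows "C_k k UNIV (\<lambda>x::'a::euclidean_space. \<Prod>i\<in>I. f i x)"
  using assms by (induction I) (auto intro: C_k_mult C_k_const)

text \<open>Indexing by the polynomial makes the family closed under differentiation, so that
  smoothness is a plain induction in \<open>C_k_flat\<close>. The bump functions use only
  \<open>flat 1\<close>, that is, exp(-1/t) extended by 0.\<close>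

definition flat :: "real poly \<Rightarrow> real \<Rightarrow> real" where
  "flat p t = (if t \<le> 0 then 0 else poly p (1/t) * exp (- 1/t))"

lemma poly_mult_exp_tendsto: "((\<lambda>y. poly p y * exp (- y)) \<longlongrightarrow> (0::real)) at_top"
proof -
  have "((\<lambda>y::real. \<Sum>i\<le>degree p. coeff p i * (y ^ i / exp y)) \<longlongrightarrow> (\<Sum>i\<le>degree p. coeff p i * 0)) at_top"
    by (intro tendsto_intros tendsto_power_div_exp_0)
  moreover have "(\<Sum>i\<le>degree p. coeff p i * (y ^ i / exp y)) = poly p y * exp (- y)" for y :: real
    by (simp add: poly_altdef sum_distrib_right sum_distrib_left exp_minus divide_inverse mult.assoc)
  ultimately show ?thesis by simp
qed

lemma flat_tendsto_right: "(flat p \<longlongrightarrow> 0) (at_right 0)"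
proof -
  have "((\<lambda>t. poly p (inverse t) * exp (- inverse t)) \<longlongrightarrow> 0) (at_right 0)"
    using poly_mult_exp_tendsto filterlim_inverse_at_top_right by (rule filterlim_compose)
  then show ?thesis
    by (rule Lim_transform_eventually)
      (auto simp: eventually_at_filter flat_def divide_inverse)
qed

lemma flat_tendsto_0: "(flat p \<longlongrightarrow> 0) (at 0)"
  using flat_tendsto_right unfolding filterlim_at_split
  by (auto intro!: tendsto_eventually simp: eventually_at_filter flat_def)

text \<open>With y = 1/t the derivative of p(y) exp(-y) in t is y^2 (p(y) - p'(y)) exp(-y), whence
  the polynomial on the right.\<close>

lemma flat_has_derivative:
  "(flat p has_real_derivative flat ([:0,0,1:] * (p - pderiv p)) t) (at t)"
proof -
  consider "t < 0" | "t = 0" | "t > 0" by linarith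
  then show ?thesis
  proof cases
    case 1
    have "((\<lambda>t. 0) has_real_derivative 0) (at t)" by simp
    then have "(flat p has_real_derivative 0) (at t)"
      by (rule DERIV_cong_ev[THEN iffD1, rotated 3])
        (use 1 in \<open>auto simp: flat_def intro!: eventually_mono[OF order_tendstoD(2)[OF tendsto_ident_at]] 
          eventually_nhds_in_open[of "{..<0}" t, THEN eventually_mono]\<close>)
    then show ?thesis using 1 by (simp add: flat_def)
  next
    case 2
    \<comment> \<open>Multiplying p(y) by y = 1/h absorbs the division by h: away from 0 this
      function is the difference quotient of \<open>flat p\<close> at 0.\<close>
    have "((\<lambda>h. flat ([:0,1:] * p) h) \<longlongrightarrow> 0) (at 0)" by (rule flat_tendsto_0)
    then have "((\<lambda>h. (flat p (0 + h) - flat p 0) / h) \<longlongrightarrow> 0) (at 0)"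
      by (rule Lim_transform_eventually) (auto simp: eventually_at_filter flat_def)
    then show ?thesis using 2 by (simp add: DERIV_def flat_def)
  next
    case 3
    have "((\<lambda>t. poly p (1/t) * exp (- 1/t)) has_real_derivative flat ([:0,0,1:] * (p - pderiv p)) t) (at t)"
      using 3
      by (auto intro!: derivative_eq_intros DERIV_chain2[OF poly_DERIV]
        simp: flat_def power2_eq_square field_simps)
    then show ?thesis
      by (rule DERIV_cong_ev[THEN iffD1, rotated 3])
        (use 3 in \<open>auto simp: flat_def intro!: eventually_nhds_in_open[of "{0<..}" t, THEN eventually_mono]\<close>)
  qed
qed

lemma C_k_flat: "C_k k UNIV (flat p)"
proof (induction k arbitrary: p)
  case 0
  show ?case
    using flat_has_derivative by (auto intro!: continuous_at_imp_continuous_on DERIV_isCont)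
next
  case (Suc k)
  have d: "(flat p has_derivative (\<lambda>h. flat ([:0,0,1:] * (p - pderiv p)) t * h)) (at t)" for t
    using flat_has_derivative[of p t] by (simp add: has_field_derivative_def)
  have "dir_deriv 1 (flat p) = flat ([:0,0,1:] * (p - pderiv p))"
    using dir_deriv_eq[OF d] by auto
  then show ?case using Suc d by (auto simp: differentiable_def)
qed


section \<open>Bump functions supported in cubes\<close>

definition bump1 :: "real \<Rightarrow> real" where
  "bump1 t = flat 1 (t + 1) * flat 1 (1 - t)"

lemma C_k_bump1: "C_k k UNIV bump1"
proof -
  have "C_k k UNIV (\<lambda>t. flat 1 (1 *\<^sub>R t + 1) * flat 1 ((-1) *\<^sub>R t + 1))"
    by (intro C_k_mult C_k_compose_affine C_k_flat)
  then show ?thesis by (simp add: bump1_def[abs_def] algebra_simps cong: C_k_cong)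
qed

lemma bump1_nonneg: "0 \<le> bump1 t"
  by (simp add: bump1_def flat_def)

lemma bump1_pos: "\<bar>t\<bar> < 1 \<Longrightarrow> 0 < bump1 t"
  by (simp add: bump1_def flat_def)

lemma bump1_eq_0: "1 \<le> \<bar>t\<bar> \<Longrightarrow> bump1 t = 0"
  by (auto simp: bump1_def flat_def)

definition bump :: "'a::euclidean_space \<Rightarrow> real" where
  "bump x = (\<Prod>b\<in>Basis. bump1 (x \<bullet> b))"

text \<open>Balls of the maximum norm serve as the standard neighbourhoods: they are boxes, to which
  the gauge integral applies directly, they fit the support of a product of one-dimensional bumps,
  and their radii add up under sums and differences of points.\<close>

definition cube :: "'a::euclidean_space \<Rightarrow> real \<Rightarrow> 'a set" where
  "cube x r = cbox (x - r *\<^sub>R One) (x + r *\<^sub>R One)"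

lemma mem_cube: "y \<in> cube x r \<longleftrightarrow> (\<forall>b\<in>Basis. \<bar>(y - x) \<bullet> b\<bar> \<le> r)"
  by (auto simp: cube_def mem_box inner_diff_left inner_add_left abs_le_iff algebra_simps)

lemma C_k_bump: "C_k k UNIV bump"
  unfolding bump_def[abs_def] by (intro C_k_prod C_k_compose_inner C_k_bump1) auto

lemma bump_nonneg: "0 \<le> bump x"
  by (simp add: bump_def bump1_nonneg prod_nonneg)

lemma bump_pos: "(\<And>b. b \<in> Basis \<Longrightarrow> \<bar>x \<bullet> b\<bar> < 1) \<Longrightarrow> 0 < bump x"
  by (simp add: bump_def bump1_pos prod_pos)

lemma bump_eq_0: "x \<notin> cube 0 1 \<Longrightarrow> bump x = 0"
  by (force simp: bump_def mem_cube intro!: prod_zero bump1_eq_0)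

lemma compact_cube: "compact (cube x r)"
  and closed_cube: "closed (cube x r)"
  and convex_cube: "convex (cube x r)"
  by (simp_all add: cube_def compact_cbox closed_cbox)

lemma cube_mono: "r \<le> s \<Longrightarrow> cube x r \<subseteq> cube x s"
  by (force simp: mem_cube)

lemma center_in_cube: "0 \<le> r \<Longrightarrow> x \<in> cube x r"
  by (auto simp: mem_cube)

lemma cube_add: "y \<in> cube x r \<Longrightarrow> z \<in> cube 0 s \<Longrightarrow> y + z \<in> cube x (r + s)"
  unfolding mem_cube
proof
  fix b :: 'a assume a: "\<forall>b\<in>Basis. \<bar>(y - x) \<bullet> b\<bar> \<le> r" "\<forall>b\<in>Basis. \<bar>(z - 0) \<bullet> b\<bar> \<le> s" and b: "b \<in> Basis"
  have "\<bar>(y - x) \<bullet> b\<bar> \<le> r" "\<bar>z \<bullet> b\<bar> \<le> s" using a b by auto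
  then show "\<bar>(y + z - x) \<bullet> b\<bar> \<le> r + s" by (simp add: inner_diff_left inner_add_left)
qed

lemma cube_uminus: "- z \<in> cube 0 s \<longleftrightarrow> z \<in> cube 0 s"
  by (auto simp: mem_cube)

lemma cube_diff: "y \<in> cube x r \<Longrightarrow> z \<in> cube 0 s \<Longrightarrow> y - z \<in> cube x (r + s)"
  using cube_add[of y x r "- z" s] by (simp add: cube_uminus)

lemma cube_0_diff: "y - x \<in> cube 0 s \<longleftrightarrow> y \<in> cube x s"
  by (auto simp: mem_cube)

lemma cube_subset_cball: "cube x r \<subseteq> cball x (real DIM('a) * r)" for x :: "'a::euclidean_space"
proof
  fix y assume "y \<in> cube x r"
  then have "(\<Sum>b\<in>Basis. \<bar>(y - x) \<bullet> b\<bar>) \<le> (\<Sum>b\<in>(Basis::'a set). r)"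
    by (intro sum_mono) (auto simp: mem_cube)
  then show "y \<in> cball x (real DIM('a) * r)"
    using norm_le_l1[of "y - x"] by (simp add: dist_norm norm_minus_commute)
qed

lemma cball_subset_cube: "cball x r \<subseteq> cube x r" for x :: "'a::euclidean_space"
  by (auto simp: mem_cube dist_norm norm_minus_commute intro: order_trans[OF Basis_le_norm])

lemma open_contains_cube:
  fixes x :: "'a::euclidean_space"
  assumes "open S" "x \<in> S"
  shows "\<exists>r>0. cube x r \<subseteq> S"
proof -
  obtain e where e: "e > 0" "cball x e \<subseteq> S" using assms open_contains_cball by blast
  have "cube x (e / real DIM('a)) \<subseteq> S"
    using cube_subset_cball[of x "e / real DIM('a)"] e by auto
  then show ?thesis using e(1) by (intro exI[of _ "e / real DIM('a)"]) auto
qed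

text \<open>The gradient is carried along as explicit data, so that for products, translates and
  mollifications it is given by a formula instead of being extracted from
  \<open>frechet_derivative\<close>.\<close>

definition C1_grad :: "('a::euclidean_space \<Rightarrow> real) \<Rightarrow> ('a \<Rightarrow> 'a) \<Rightarrow> bool" where
  "C1_grad f g \<longleftrightarrow> continuous_on UNIV g \<and> (\<forall>x. (f has_derivative (\<lambda>h. g x \<bullet> h)) (at x))"

definition vgrad :: "('a::euclidean_space \<Rightarrow> real) \<Rightarrow> 'a \<Rightarrow> 'a" where
  "vgrad f x = (\<Sum>b\<in>Basis. dir_deriv b f x *\<^sub>R b)"

lemma vgrad_inner_Basis: "b \<in> Basis \<Longrightarrow> vgrad f x \<bullet> b = dir_deriv b f x"
  by (simp add: vgrad_def inner_sum_left inner_Basis if_distrib[where f="\<lambda>c. _ * c"] sum.delta cong: if_cong)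

lemma vgrad_has_derivative:
  assumes "f differentiable (at x)"
  shows "(f has_derivative (\<lambda>h. vgrad f x \<bullet> h)) (at x)"
proof -
  have d: "(f has_derivative frechet_derivative f (at x)) (at x)"
    using assms by (simp add: frechet_derivative_works)
  have "frechet_derivative f (at x) h = vgrad f x \<bullet> h" for h
  proof -
    have "frechet_derivative f (at x) h = frechet_derivative f (at x) (\<Sum>b\<in>Basis. (h \<bullet> b) *\<^sub>R b)"
      by (simp add: euclidean_representation)
    also have "\<dots> = (\<Sum>b\<in>Basis. (h \<bullet> b) * dir_deriv b f x)"
      using linear_frechet_derivative[OF assms] by (simp add: linear_sum linear_cmul dir_deriv_def)
    also have "\<dots> = vgrad f x \<bullet> h"
      by (simp add: vgrad_def inner_sum_left inner_commute[of h] mult.commute)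
    finally show ?thesis .
  qed
  then show ?thesis using d by (metis (no_types, lifting) ext)
qed

lemma C1_grad_vgrad: "C_k (Suc 0) UNIV f \<Longrightarrow> C1_grad f (vgrad f)"
  unfolding C1_grad_def
  by (intro conjI allI vgrad_has_derivative)
    (auto simp: vgrad_def[abs_def] intro!: continuous_intros)

lemma C1_grad_D:
  assumes "C1_grad f g"
  shows "(f has_derivative (\<lambda>h. g x \<bullet> h)) (at x)" "continuous_on UNIV g" "continuous_on UNIV f"
    "dir_deriv b f x = g x \<bullet> b"
  using assms unfolding C1_grad_def
  by (auto intro!: has_derivative_continuous_on[of _ f "\<lambda>x h. g x \<bullet> h"] dir_deriv_eq)

lemma C1_grad_imp_vgrad: "C1_grad f g \<Longrightarrow> vgrad f = g"
  by (rule ext) (simp add: vgrad_def C1_grad_D(4) euclidean_representation)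

lemma grad_eq_0_outside:
  assumes "(f has_derivative (\<lambda>h. g \<bullet> h)) (at x)" "\<And>y. y \<notin> S \<Longrightarrow> f y = 0" "closed S" "x \<notin> S"
  shows "g = 0"
proof -
  have "((\<lambda>y. 0) has_derivative (\<lambda>h. g \<bullet> h)) (at x)"
    by (rule has_derivative_transform_within_open[OF assms(1), of "- S"]) (use assms in auto)
  then have "(\<lambda>h. g \<bullet> h) = (\<lambda>h. 0)"
    by (rule has_derivative_unique) auto
  then show ?thesis by (metis inner_eq_zero_iff)
qed

lemma C1_grad_eq_0_outside:
  assumes "C1_grad f g" "\<And>y. y \<notin> cube z r \<Longrightarrow> f y = 0" "x \<notin> cube z r"
  shows "g x = 0"
  using grad_eq_0_outside[OF C1_grad_D(1)[OF assms(1)] assms(2) closed_cube assms(3)] by blast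

text \<open>The gradient bound scales like \<epsilon>^-(n+1) with a constant \<open>M\<close> that
  can be fixed before \<epsilon>, as in \<open>mollifier_exists\<close>; estimates in terms of
  \<open>M\<close> are then uniform in \<epsilon>.\<close>

locale mollifier =
  fixes \<rho> :: "'a::euclidean_space \<Rightarrow> real" and \<epsilon> M :: real
  assumes \<rho>_smooth: "C_k k UNIV \<rho>" and \<rho>_nonneg: "0 \<le> \<rho> z" and \<rho>_supp: "z \<notin> cube 0 \<epsilon> \<Longrightarrow> \<rho> z = 0"
    and \<rho>_integral: "integral (cube 0 \<epsilon>) \<rho> = 1"
    and \<rho>_grad: "norm (vgrad \<rho> z) \<le> M / \<epsilon> ^ (DIM('a) + 1)"
    and \<epsilon>_pos: "0 < \<epsilon>" and M: "0 < M"

lemma mollifier_exists: "\<exists>M. \<forall>\<epsilon>>0. \<exists>\<rho>::'a::euclidean_space \<Rightarrow> real. mollifier \<rho> \<epsilon> M"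
proof -
  let ?n = "DIM('a)"
  define g where "g = vgrad (bump :: 'a \<Rightarrow> real)"
  have g: "C1_grad bump g" unfolding g_def by (rule C1_grad_vgrad[OF C_k_bump])
  have "compact (g ` cube 0 1)"
    by (intro compact_continuous_image continuous_on_subset[OF C1_grad_D(2)[OF g]] compact_cube) auto
  then obtain M0 where M0: "\<And>x. x \<in> cube 0 1 \<Longrightarrow> norm (g x) \<le> M0"
    by (force dest!: compact_imp_bounded simp: bounded_iff)
  have M1: "norm (g x) \<le> \<bar>M0\<bar>" for x
  proof (cases "x \<in> cube 0 1")
    case False
    then show ?thesis using C1_grad_eq_0_outside[OF g bump_eq_0 False] by simp
  qed (use M0[of x] in auto)
  define Z where "Z = integral (cube 0 1) (bump :: 'a \<Rightarrow> real)"
  have cb: "continuous_on S (bump :: 'a \<Rightarrow> real)" for S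
    using C1_grad_D(3)[OF g] continuous_on_subset by blast
  have "Z \<noteq> 0"
  proof
    assume "Z = 0"
    moreover have "box (0 - 1 *\<^sub>R One) (0 + 1 *\<^sub>R One :: 'a) \<noteq> {}" by (simp add: box_ne_empty)
    ultimately have "\<forall>x\<in>cube 0 1. bump (x::'a) = 0"
      unfolding Z_def cube_def by (metis integral_cbox_eq_0_iff cb bump_nonneg)
    moreover have "0 < bump (0::'a)" by (rule bump_pos) auto
    ultimately show False using center_in_cube[of 1 "0::'a"] by auto
  qed
  moreover have "Z \<ge> 0" unfolding Z_def by (intro integral_nonneg) (auto simp: bump_nonneg cube_def intro!: integrable_continuous cb)
  ultimately have Z: "Z > 0" by simp
  have hZ: "(bump has_integral Z) (cbox (- One) (One :: 'a))"
    using integrable_integral[OF integrable_continuous[OF cb]] by (simp add: Z_def cube_def)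
  \<comment> \<open>For \<rho>(x) = bump(x/\<epsilon>) / (Z \<epsilon>^n) the gradient is at most
    sup |g| / (Z \<epsilon>^(n+1)). The added 1 makes \<open>M\<close> positive.\<close>
  define M where "M = (\<bar>M0\<bar> + 1) / Z"
  have M_pos: "M > 0" using Z by (simp add: M_def add_nonneg_pos)
  have "\<exists>\<rho>::'a \<Rightarrow> real. mollifier \<rho> \<epsilon> M" if e: "\<epsilon> > 0" for \<epsilon> :: real
  proof -
    define c where "c = 1 / (Z * \<epsilon> ^ ?n)"
    have c: "c > 0" using Z e by (simp add: c_def)
    define \<rho> :: "'a \<Rightarrow> real" where "\<rho> x = c * bump ((1/\<epsilon>) *\<^sub>R x)" for x
    have "C_k k UNIV \<rho>" for k
      using C_k_mult[OF C_k_const[of k c] C_k_compose_affine[OF C_k_bump, of k "1/\<epsilon>" 0]]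
      by (simp add: \<rho>_def[abs_def])
    moreover have "0 \<le> \<rho> x" for x using c by (simp add: \<rho>_def bump_nonneg)
    moreover have "\<rho> x = 0" if "x \<notin> cube 0 \<epsilon>" for x
    proof -
      have "(1/\<epsilon>) *\<^sub>R x \<notin> cube 0 1" using that e by (auto simp: mem_cube field_simps)
      then show ?thesis by (simp add: \<rho>_def bump_eq_0)
    qed
    moreover have "integral (cube 0 \<epsilon>) \<rho> = 1"
    proof -
      have "((\<lambda>x. bump ((1/\<epsilon>) *\<^sub>R x + 0)) has_integral Z /\<^sub>R (1/\<epsilon>) ^ ?n) (cbox ((- One - 0) /\<^sub>R (1/\<epsilon>)) ((One - 0 :: 'a) /\<^sub>R (1/\<epsilon>)))"
        by (rule has_integral_affinity'[OF hZ]) (use e in auto)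
      then have "((\<lambda>x. c * bump ((1/\<epsilon>) *\<^sub>R x)) has_integral c * (Z /\<^sub>R (1/\<epsilon>) ^ ?n)) (cube (0::'a) \<epsilon>)"
        by (intro has_integral_mult_right) (simp add: cube_def)
      moreover have "c * (Z /\<^sub>R (1/\<epsilon>) ^ ?n) = 1" using Z e by (simp add: c_def power_divide)
      ultimately show ?thesis unfolding \<rho>_def[abs_def] by (metis integral_unique)
    qed
    moreover have "norm (vgrad \<rho> x) \<le> M / \<epsilon> ^ (?n + 1)" for x
    proof -
      have "C1_grad \<rho> (\<lambda>x. (c / \<epsilon>) *\<^sub>R g ((1/\<epsilon>) *\<^sub>R x))"
        unfolding C1_grad_def \<rho>_def[abs_def]
      proof safe
        show "continuous_on UNIV (\<lambda>x. (c / \<epsilon>) *\<^sub>R g ((1/\<epsilon>) *\<^sub>R x))"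
          by (intro continuous_intros continuous_on_compose2[OF C1_grad_D(2)[OF g]]) auto
        have "((\<lambda>x. bump ((1/\<epsilon>) *\<^sub>R x)) has_derivative (\<lambda>h. g ((1/\<epsilon>) *\<^sub>R x) \<bullet> ((1/\<epsilon>) *\<^sub>R h))) (at x)" for x
          by (rule has_derivative_compose[of "\<lambda>x. (1/\<epsilon>) *\<^sub>R x" _ _ _ bump])
            (auto intro!: derivative_eq_intros C1_grad_D(1)[OF g])
        then show "((\<lambda>x. c * bump ((1/\<epsilon>) *\<^sub>R x)) has_derivative (\<lambda>h. (c / \<epsilon>) *\<^sub>R g ((1/\<epsilon>) *\<^sub>R x) \<bullet> h)) (at x)" for x
          by (auto intro!: derivative_eq_intros simp: divide_inverse)
      qed
      then have "norm (vgrad \<rho> x) = (c / \<epsilon>) * norm (g ((1/\<epsilon>) *\<^sub>R x))"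
        using c e by (simp add: C1_grad_imp_vgrad)
      also have "\<dots> \<le> (c / \<epsilon>) * (\<bar>M0\<bar> + 1)"
        using c e M1 by (intro mult_left_mono) (auto intro: order_trans[OF M1])
      also have "\<dots> = M / \<epsilon> ^ (?n + 1)" by (simp add: c_def M_def field_simps)
      finally show ?thesis .
    qed
    ultimately have "mollifier \<rho> \<epsilon> M"
      using e M_pos by (intro mollifier.intro)
    then show ?thesis by blast
  qed
  then show ?thesis by blast
qed

section \<open>Convolution and integration by parts\<close>

text \<open>The second difference over the parallelogram spanned by s b and s c is symmetric in b
  and c. Two applications of the mean value theorem turn it into s^2 times a second derivative at an
  intermediate point, in either order of differentiation; divide by s^2 and let s tend to 0. It
  serves both for the Hessian of \<open>B \<circ> H\<close> and for that of the mollified v.\<close>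

lemma second_derivative_symmetric:
  fixes f :: "'a::euclidean_space \<Rightarrow> real"
  assumes "open S" "x \<in> S"
    and f: "\<And>y. y \<in> S \<Longrightarrow> (f has_derivative (\<lambda>h. N y \<bullet> h)) (at y)"
    and N: "\<And>y. y \<in> S \<Longrightarrow> (N has_derivative A y) (at y)"
    and A: "\<And>h. continuous_on S (\<lambda>y. A y h)"
  shows "A x b \<bullet> c = A x c \<bullet> b"
proof -
  obtain e where e: "e > 0" "ball x e \<subseteq> S" using assms(1,2) open_contains_ball by blast
  define \<Delta> where "\<Delta> s = f (x + s *\<^sub>R b + s *\<^sub>R c) - f (x + s *\<^sub>R b) - f (x + s *\<^sub>R c) + f x" for s
  have key: "\<exists>y. dist y x \<le> s * (norm b + norm c) \<and> \<Delta>' = s * s * (A y c \<bullet> b)"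
    if s: "0 < s" "s * (norm b + norm c) < e"
      and D: "\<Delta>' = f (x + s *\<^sub>R b + s *\<^sub>R c) - f (x + s *\<^sub>R b) - f (x + s *\<^sub>R c) + f x" for s b c \<Delta>'
  proof -
    have bd: "norm (r *\<^sub>R b + t *\<^sub>R c) \<le> s * (norm b + norm c)" if "0 \<le> r" "r \<le> s" "0 \<le> t" "t \<le> s" for r t
    proof -
      have "norm (r *\<^sub>R b + t *\<^sub>R c) \<le> r * norm b + t * norm c"
        using norm_triangle_ineq[of "r *\<^sub>R b" "t *\<^sub>R c"] that by simp
      also have "\<dots> \<le> s * norm b + s * norm c" using that by (intro add_mono mult_right_mono) auto
      finally show ?thesis by (simp add: algebra_simps)
    qed
    have inS: "x + r *\<^sub>R b + t *\<^sub>R c \<in> S" if "0 \<le> r" "r \<le> s" "0 \<le> t" "t \<le> s" for r t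
    proof -
      have "dist x (x + r *\<^sub>R b + t *\<^sub>R c) = norm (r *\<^sub>R b + t *\<^sub>R c)"
        by (metis add.assoc add_diff_cancel_left' dist_commute dist_norm)
      then show ?thesis using bd[OF that] s by (intro subsetD[OF e(2)]) simp
    qed
    have d1: "((\<lambda>r. f (x + r *\<^sub>R b + t *\<^sub>R c)) has_real_derivative N (x + r *\<^sub>R b + t *\<^sub>R c) \<bullet> b) (at r)"
      if "0 \<le> r" "r \<le> s" "0 \<le> t" "t \<le> s" for r t
    proof -
      have "((\<lambda>r. f (x + r *\<^sub>R b + t *\<^sub>R c)) has_derivative (\<lambda>h. N (x + r *\<^sub>R b + t *\<^sub>R c) \<bullet> (h *\<^sub>R b))) (at r)"
        by (rule has_derivative_compose[where g=f and f="\<lambda>r. x + r *\<^sub>R b + t *\<^sub>R c" and x=r, OF _ f[OF inS[OF that]]]) (auto intro!: derivative_eq_intros)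
      then show ?thesis unfolding has_field_derivative_def
        by (rule has_derivative_eq_rhs) (auto simp: mult.commute)
    qed
    have "((\<lambda>r. f (x + r *\<^sub>R b + s *\<^sub>R c) - f (x + r *\<^sub>R b + 0 *\<^sub>R c)) has_real_derivative
        N (x + r *\<^sub>R b + s *\<^sub>R c) \<bullet> b - N (x + r *\<^sub>R b + 0 *\<^sub>R c) \<bullet> b) (at r)" if "0 \<le> r" "r \<le> s" for r
      by (rule DERIV_diff[OF d1 d1]) (use that s in auto)
    note MVT2[OF s(1) this]
    then obtain \<xi> where \<xi>: "0 < \<xi>" "\<xi> < s"
      "(f (x + s *\<^sub>R b + s *\<^sub>R c) - f (x + s *\<^sub>R b + 0 *\<^sub>R c)) - (f (x + 0 *\<^sub>R b + s *\<^sub>R c) - f (x + 0 *\<^sub>R b + 0 *\<^sub>R c))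
        = (s - 0) * (N (x + \<xi> *\<^sub>R b + s *\<^sub>R c) \<bullet> b - N (x + \<xi> *\<^sub>R b + 0 *\<^sub>R c) \<bullet> b)"
      by blast
    have d2: "((\<lambda>t. N (x + \<xi> *\<^sub>R b + t *\<^sub>R c) \<bullet> b) has_real_derivative A (x + \<xi> *\<^sub>R b + t *\<^sub>R c) c \<bullet> b) (at t)"
      if "0 \<le> t" "t \<le> s" for t
    proof -
      have "\<xi> \<ge> 0" "\<xi> \<le> s" using \<xi> by auto
      note * = N[OF inS[OF this that]]
      have "((\<lambda>t. N (x + \<xi> *\<^sub>R b + t *\<^sub>R c)) has_derivative (\<lambda>r. A (x + \<xi> *\<^sub>R b + t *\<^sub>R c) (r *\<^sub>R c))) (at t)"
        by (rule has_derivative_compose[where g=N and f="\<lambda>t. x + \<xi> *\<^sub>R b + t *\<^sub>R c" and x=t, OF _ *]) (auto intro!: derivative_eq_intros)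
      then have "((\<lambda>t. N (x + \<xi> *\<^sub>R b + t *\<^sub>R c) \<bullet> b) has_derivative (\<lambda>r. A (x + \<xi> *\<^sub>R b + t *\<^sub>R c) (r *\<^sub>R c) \<bullet> b)) (at t)"
        by (rule has_derivative_inner_left)
      then show ?thesis unfolding has_field_derivative_def
        by (rule has_derivative_eq_rhs) (auto simp: linear_cmul[OF has_derivative_linear[OF *]] mult.commute)
    qed
    obtain \<eta> where \<eta>: "0 < \<eta>" "\<eta> < s" "N (x + \<xi> *\<^sub>R b + s *\<^sub>R c) \<bullet> b - N (x + \<xi> *\<^sub>R b + 0 *\<^sub>R c) \<bullet> b
        = (s - 0) * (A (x + \<xi> *\<^sub>R b + \<eta> *\<^sub>R c) c \<bullet> b)"
      using MVT2[OF s(1), of "\<lambda>t. N (x + \<xi> *\<^sub>R b + t *\<^sub>R c) \<bullet> b" "\<lambda>t. A (x + \<xi> *\<^sub>R b + t *\<^sub>R c) c \<bullet> b"] s d2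
      by blast
    have "\<Delta>' = s * s * (A (x + \<xi> *\<^sub>R b + \<eta> *\<^sub>R c) c \<bullet> b)"
      using \<xi>(3) \<eta>(3) by (simp add: D)
    moreover have "dist (x + \<xi> *\<^sub>R b + \<eta> *\<^sub>R c) x \<le> s * (norm b + norm c)"
      using bd[of \<xi> \<eta>] \<xi> \<eta> by (simp add: dist_norm add.assoc)
    ultimately show ?thesis by blast
  qed
  \<comment> \<open>The 1 keeps the denominator of \<open>s\<close> positive when b = c = 0. With k
    + 2 in place of k + 1 the parallelogram stays strictly inside the ball already for k =
    0.\<close>
  define m where "m = norm b + norm c + 1"
  have m: "m > 0" "norm b + norm c \<le> m" by (auto simp: m_def add_nonneg_pos)
  define s where "s k = e / (m * real (k + 2))" for k
  have s: "0 < s k" "s k * (norm b + norm c) < e" for k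
  proof -
    show 0: "0 < s k" using e m by (simp add: s_def)
    have "s k * (norm b + norm c) \<le> s k * m" using 0 m by (intro mult_left_mono) auto
    also have "\<dots> = e / real (k + 2)" using m by (simp add: s_def)
    also have "\<dots> < e" using e by (simp add: divide_simps)
    finally show "s k * (norm b + norm c) < e" .
  qed
  have s0: "s \<longlonglongrightarrow> 0"
  proof -
    have "(\<lambda>k. e / m * (1 / real (k + 2))) \<longlonglongrightarrow> e / m * 0"
      by (intro tendsto_intros LIMSEQ_ignore_initial_segment[OF lim_1_over_n])
    then show ?thesis by (simp add: s_def[abs_def])
  qed
  have "\<forall>k. \<exists>y. dist y x \<le> s k * (norm b + norm c) \<and> \<Delta> (s k) = s k * s k * (A y c \<bullet> b)"
    using key[OF s] \<Delta>_def by blast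
  then obtain y where y: "\<And>k. dist (y k) x \<le> s k * (norm b + norm c)" "\<And>k. \<Delta> (s k) = s k * s k * (A (y k) c \<bullet> b)"
    by metis
  have "\<forall>k. \<exists>y. dist y x \<le> s k * (norm c + norm b) \<and> \<Delta> (s k) = s k * s k * (A y b \<bullet> c)"
  proof
    fix k
    show "\<exists>y. dist y x \<le> s k * (norm c + norm b) \<and> \<Delta> (s k) = s k * s k * (A y b \<bullet> c)"
      using s[of k] by (intro key) (simp_all add: \<Delta>_def add.commute add.left_commute)
  qed
  then obtain z where z: "\<And>k. dist (z k) x \<le> s k * (norm b + norm c)" "\<And>k. \<Delta> (s k) = s k * s k * (A (z k) b \<bullet> c)"
    by (metis add.commute)
  have lim: "(\<lambda>k. w k) \<longlonglongrightarrow> x" if "\<And>k. dist (w k) x \<le> s k * (norm b + norm c)" for w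
  proof -
    have "(\<lambda>k. s k * (norm b + norm c)) \<longlonglongrightarrow> 0" using tendsto_mult_right[OF s0, of "norm b + norm c"] by simp
    then show ?thesis unfolding tendsto_dist_iff[of w]
      by (rule tendsto_sandwich[rotated 3, where f="\<lambda>k. 0"]) (auto simp: that)
  qed
  have limA: "(\<lambda>k. A (w k) h) \<longlonglongrightarrow> A x h" if "\<And>k. dist (w k) x \<le> s k * (norm b + norm c)" for w h
  proof -
    have "w k \<in> S" for k
      using le_less_trans[OF that[of k] s(2)[of k]] e(2) by (auto simp: subset_iff dist_commute)
    then show ?thesis
      by (intro continuous_on_tendsto_compose[OF A lim[OF that] assms(2)]) auto
  qed
  have "A (y k) c \<bullet> b = A (z k) b \<bullet> c" for k using y(2)[of k] z(2)[of k] s(1)[of k] by auto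
  then have "(\<lambda>k. A (y k) c \<bullet> b) \<longlonglongrightarrow> A x b \<bullet> c"
    using tendsto_inner[OF limA[OF z(1)] tendsto_const] by simp
  then show ?thesis
    using LIMSEQ_unique tendsto_inner[OF limA[OF y(1)] tendsto_const] by blast
qed

section \<open>Integrals and convolutions of compactly supported functions\<close>

lemma integral_UNIV_eq:
  fixes f :: "'a::euclidean_space \<Rightarrow> 'b::banach"
  assumes "\<And>x. x \<notin> S \<Longrightarrow> f x = 0"
  shows "integral UNIV f = integral S f"
proof -
  have "f = (\<lambda>x. if x \<in> S then f x else 0)" using assms by auto
  then show ?thesis using integral_restrict_UNIV[of S f] by simp
qed

lemma integrable_on_cube: "continuous_on UNIV f \<Longrightarrow> f integrable_on cube x r"
  for f :: "'a::euclidean_space \<Rightarrow> 'b::banach"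
  unfolding cube_def by (intro integrable_continuous) (auto intro: continuous_on_subset)

lemma integrable_on_UNIV:
  fixes f :: "'a::euclidean_space \<Rightarrow> 'b::banach"
  assumes "\<And>x. x \<notin> cube c r \<Longrightarrow> f x = 0" "continuous_on UNIV f"
  shows "f integrable_on UNIV"
proof -
  have "f = (\<lambda>x. if x \<in> cube c r then f x else 0)" using assms by auto
  then show ?thesis using integrable_restrict_UNIV[of "cube c r" f] integrable_on_cube[OF assms(2)] by simp
qed

text \<open>A common form for translation (s = 1) and reflection (s = -1).\<close>

lemma integral_UNIV_affinity:
  fixes f :: "'a::euclidean_space \<Rightarrow> 'b::banach"
  assumes supp: "\<And>x. x \<notin> cube c r \<Longrightarrow> f x = 0" and f: "continuous_on UNIV f" and s: "\<bar>s\<bar> = 1"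
  shows "integral UNIV (\<lambda>x. f (s *\<^sub>R x + z)) = integral UNIV f"
proof -
  have ss: "s * s = 1" "s \<noteq> 0" using s by (auto simp: abs_if split: if_splits)
  let ?T = "(\<lambda>x. (1 / s) *\<^sub>R x + - ((1 / s) *\<^sub>R z)) ` cube c r"
  have "((\<lambda>x. f (s *\<^sub>R x + z)) has_integral (1 / \<bar>s\<bar> ^ DIM('a)) *\<^sub>R integral (cube c r) f) ?T"
    unfolding cube_def
    by (rule has_integral_affinity[OF integrable_integral])
      (use integrable_on_cube[OF f, of c r] ss in \<open>auto simp: cube_def\<close>)
  then have "integral ?T (\<lambda>x. f (s *\<^sub>R x + z)) = integral (cube c r) f" using s by (simp add: integral_unique)
  moreover have "f (s *\<^sub>R x + z) = 0" if "x \<notin> ?T" for x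
  proof (rule supp, rule notI)
    assume "s *\<^sub>R x + z \<in> cube c r"
    then have "(1 / s) *\<^sub>R (s *\<^sub>R x + z) + - ((1 / s) *\<^sub>R z) \<in> ?T" by (rule imageI)
    moreover have "(1 / s) *\<^sub>R (s *\<^sub>R x + z) + - ((1 / s) *\<^sub>R z) = x" using ss by (simp add: algebra_simps)
    ultimately show False using that by simp
  qed
  ultimately show ?thesis using integral_UNIV_eq[of ?T "\<lambda>x. f (s *\<^sub>R x + z)"] integral_UNIV_eq[of "cube c r" f] supp by simp
qed

lemma integral_UNIV_shift:
  fixes f :: "'a::euclidean_space \<Rightarrow> 'b::banach"
  assumes "\<And>x. x \<notin> cube c r \<Longrightarrow> f x = 0" "continuous_on UNIV f"
  shows "integral UNIV (\<lambda>x. f (x + z)) = integral UNIV f"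
  using integral_UNIV_affinity[OF assms, where s=1 and z=z] by simp

lemma integral_UNIV_reflect:
  fixes f :: "'a::euclidean_space \<Rightarrow> 'b::banach"
  assumes "\<And>x. x \<notin> cube c r \<Longrightarrow> f x = 0" "continuous_on UNIV f"
  shows "integral UNIV (\<lambda>x. f (z - x)) = integral UNIV f"
  using integral_UNIV_affinity[OF assms, where s="-1" and z=z] by simp

text \<open>A scalar kernel acting on scalar or vector-valued functions: v, a and Y are mollified by
  one operator, and directional derivatives of a kernel are again kernels.\<close>

definition conv :: "('a::euclidean_space \<Rightarrow> real) \<Rightarrow> ('a \<Rightarrow> 'b::euclidean_space) \<Rightarrow> 'a \<Rightarrow> 'b" where
  "conv k f x = integral UNIV (\<lambda>y. k (x - y) *\<^sub>R f y)"

lemma conv_eq_integral_cube: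
  assumes k: "\<And>x. x \<notin> cube c r \<Longrightarrow> k x = 0" "continuous_on UNIV k" "continuous_on UNIV f"
  shows "conv k f x = integral (cube c r) (\<lambda>w. k w *\<^sub>R f (x - w))"
proof -
  have "integral UNIV (\<lambda>w. k w *\<^sub>R f (x - w)) = integral UNIV (\<lambda>y. k (x - y) *\<^sub>R f (x - (x - y)))"
    by (rule integral_UNIV_reflect[symmetric, where f="\<lambda>w. k w *\<^sub>R f (x - w)" and c=c and r=r])
      (auto simp: k(1) intro!: continuous_intros continuous_on_compose2[OF k(3)] k(2))
  then show ?thesis using integral_UNIV_eq[of "cube c r" "\<lambda>w. k w *\<^sub>R f (x - w)"] k(1) by (simp add: conv_def)
qed

lemma continuous_conv:
  assumes k: "\<And>x. x \<notin> cube c r \<Longrightarrow> k x = 0" "continuous_on UNIV k" "continuous_on UNIV f"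
  shows "continuous_on UNIV (conv k f)"
proof -
  have "continuous_on UNIV (\<lambda>x. integral (cbox (c - r *\<^sub>R One) (c + r *\<^sub>R One)) (\<lambda>w. k w *\<^sub>R f (x - w)))"
    by (rule integral_continuous_on_param)
      (auto simp: split_beta intro!: continuous_intros continuous_on_compose2[OF k(3)] continuous_on_compose2[OF k(2)])
  then show ?thesis using conv_eq_integral_cube[OF k] by (simp add: cube_def cong: continuous_on_cong)
qed

lemma conv_has_derivative:
  fixes f :: "'a::euclidean_space \<Rightarrow> 'b::euclidean_space"
  assumes kg: "C1_grad k g" and supp: "\<And>x. x \<notin> cube c r \<Longrightarrow> k x = 0" and f: "continuous_on UNIV f"
  shows "(conv k f has_derivative (\<lambda>h. conv (\<lambda>z. g z \<bullet> h) f x)) (at x)"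
proof -
  \<comment> \<open>For every x' in the unit ball around x the function y \<mapsto> k(x' - y) is
    supported in this box, whence r + 1. Differentiation under the integral needs such a fixed
    domain.\<close>
  let ?a = "x - c - (r+1) *\<^sub>R One" and ?b = "x - c + (r+1) *\<^sub>R One"
  have gs: "g z = 0" if "z \<notin> cube c r" for z using C1_grad_eq_0_outside[OF kg supp that] .
  have supp': "x' - y \<notin> cube c r" if "x' \<in> ball x 1" "y \<notin> cbox ?a ?b" for x' y
  proof
    assume a: "x' - y \<in> cube c r"
    have 1: "x' - x \<in> cube 0 1" using that(1) cball_subset_cube[of 0 1] by (auto simp: dist_norm norm_minus_commute)
    have "y - (x - c) = (x' - x) - ((x' - y) - c)" by simp
    moreover have "(x' - x) - ((x' - y) - c) \<in> cube 0 (1 + r)"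
      by (rule cube_diff[OF 1]) (use a in \<open>simp add: cube_0_diff\<close>)
    ultimately have "y - (x - c) \<in> cube 0 (r + 1)" by (metis add.commute)
    then have "y \<in> cube (x - c) (r + 1)" by (simp only: cube_0_diff)
    then show False using that(2) by (simp add: cube_def algebra_simps)
  qed
  have c1: "conv k f x' = integral (cbox ?a ?b) (\<lambda>y. k (x' - y) *\<^sub>R f y)" if "x' \<in> ball x 1" for x'
    unfolding conv_def by (rule integral_UNIV_eq) (simp add: supp[OF supp'[OF that]])
  have c2: "conv (\<lambda>z. g z \<bullet> h) f x = integral (cbox ?a ?b) (\<lambda>y. (g (x - y) \<bullet> h) *\<^sub>R f y)" for h
    unfolding conv_def by (rule integral_UNIV_eq) (simp add: gs[OF supp'[of x]])
  define fx where "fx x y = blinfun_compose (blinfun_scaleR_left (f y)) (blinfun_inner_left (g (x - y)))" for x y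
  have fx: "blinfun_apply (fx x y) = (\<lambda>h. (g (x - y) \<bullet> h) *\<^sub>R f y)" for x y
    by (rule ext) (simp add: fx_def inner_commute)
  have cfx: "continuous_on (T \<times> T') (\<lambda>(x, y). fx x y)" for T T'
    unfolding fx_def split_beta
    by (intro continuous_intros continuous_on_compose2[OF C1_grad_D(2)[OF kg]] continuous_on_compose2[OF f]) auto
  have "((\<lambda>x. integral (cbox ?a ?b) (\<lambda>y. k (x - y) *\<^sub>R f y)) has_derivative
      blinfun_apply (integral (cbox ?a ?b) (fx x))) (at x within ball x 1)"
  proof (rule leibniz_rule)
    fix x' y
    have "((\<lambda>x. k (x - y)) has_derivative (\<lambda>h. g (x' - y) \<bullet> h)) (at x')"
      by (rule has_derivative_compose[where g=k and f="\<lambda>x. x - y" and x=x', OF _ C1_grad_D(1)[OF kg]]) (auto intro!: derivative_eq_intros)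
    then have "((\<lambda>x. k (x - y) *\<^sub>R f y) has_derivative (\<lambda>h. (g (x' - y) \<bullet> h) *\<^sub>R f y)) (at x')"
      by (rule has_derivative_scaleR_left)
    then show "((\<lambda>x. k (x - y) *\<^sub>R f y) has_derivative blinfun_apply (fx x' y)) (at x' within ball x 1)"
      by (simp add: fx has_derivative_at_withinI)
    show "(\<lambda>y. k (x' - y) *\<^sub>R f y) integrable_on cbox ?a ?b"
      by (intro integrable_continuous continuous_intros continuous_on_compose2[OF C1_grad_D(3)[OF kg]]
          continuous_on_subset[OF f]) auto
  qed (auto intro: cfx)
  then have "((\<lambda>x. integral (cbox ?a ?b) (\<lambda>y. k (x - y) *\<^sub>R f y)) has_derivative
      blinfun_apply (integral (cbox ?a ?b) (fx x))) (at x)"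
    by (simp add: at_within_open[of x "ball x 1"])
  moreover have "blinfun_apply (integral (cbox ?a ?b) (fx x)) = (\<lambda>h. conv (\<lambda>z. g z \<bullet> h) f x)"
  proof
    fix h
    have "continuous_on (cbox ?a ?b) (fx x)"
      unfolding fx_def by (intro continuous_intros continuous_on_compose2[OF C1_grad_D(2)[OF kg]] continuous_on_compose2[OF f]) auto
    then have "integral (cbox ?a ?b) ((\<lambda>B. blinfun_apply B h) \<circ> fx x) = blinfun_apply (integral (cbox ?a ?b) (fx x)) h"
      by (intro integral_linear integrable_continuous blinfun.bounded_linear_left)
    then show "blinfun_apply (integral (cbox ?a ?b) (fx x)) h = conv (\<lambda>z. g z \<bullet> h) f x"
      unfolding c2 by (simp add: o_def fx)
  qed
  ultimately have "((\<lambda>x. integral (cbox ?a ?b) (\<lambda>y. k (x - y) *\<^sub>R f y)) has_derivative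
      (\<lambda>h. conv (\<lambda>z. g z \<bullet> h) f x)) (at x)" by (simp only:)
  then show ?thesis
    by (rule has_derivative_transform_within_open[of _ _ _ _ "ball x 1"]) (auto simp: c1)
qed

text \<open>Convolving f with the constant 1 yields the integral of f at every point, so the
  derivative of this convolution vanishes; by \<open>conv_has_derivative\<close> it is also the
  integral of a derivative of f. This takes the place of the divergence theorem.\<close>

lemma integral_grad_eq_0:
  assumes "C1_grad f g" "\<And>x. x \<notin> cube c r \<Longrightarrow> f x = 0"
  shows "integral UNIV (\<lambda>x. g x \<bullet> h) = 0"
proof -
  have "conv f (\<lambda>_. 1::real) x = integral UNIV f" for x
    using integral_UNIV_reflect[OF assms(2) C1_grad_D(3)[OF assms(1)], of c r x] by (simp add: conv_def)
  then have "conv f (\<lambda>_. 1::real) = (\<lambda>x. integral UNIV f)" by auto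
  moreover have "(conv f (\<lambda>_. 1::real) has_derivative (\<lambda>h. conv (\<lambda>z. g z \<bullet> h) (\<lambda>_. 1) 0)) (at 0)"
    by (rule conv_has_derivative[OF assms]) auto
  ultimately have "(\<lambda>h. conv (\<lambda>z. g z \<bullet> h) (\<lambda>_. 1::real) 0) = (\<lambda>h. 0)"
    by (metis has_derivative_const has_derivative_unique)
  then have "conv (\<lambda>z. g z \<bullet> h) (\<lambda>_. 1::real) 0 = 0" by metis
  moreover have "integral UNIV (\<lambda>x. g (0 - x) \<bullet> h) = integral UNIV (\<lambda>x. g x \<bullet> h)"
    by (rule integral_UNIV_reflect[where f="\<lambda>x. g x \<bullet> h" and c=c and r=r])
      (use C1_grad_eq_0_outside[OF assms(1) assms(2)] in \<open>auto intro!: continuous_intros C1_grad_D(2)[OF assms(1)]\<close>)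
  ultimately show ?thesis by (simp add: conv_def)
qed

section \<open>Elliptic potentials\<close>

text \<open>Peel off one rank-one form for each basis vector, as in a Cholesky factorization.\<close>

lemma psd_decomposition:
  fixes A :: "'a::euclidean_space \<Rightarrow> 'a"
  assumes "linear A" "\<And>h k. A h \<bullet> k = A k \<bullet> h" "\<And>h. 0 \<le> A h \<bullet> h"
  shows "\<exists>l::'a \<Rightarrow> 'a. \<forall>x. A x = (\<Sum>k\<in>Basis. (l k \<bullet> x) *\<^sub>R l k)"
proof -
  have "\<exists>l Q. linear Q \<and> (\<forall>h k. Q h \<bullet> k = Q k \<bullet> h) \<and> (\<forall>h. 0 \<le> Q h \<bullet> h) \<and> (\<forall>k\<in>I. Q k = 0) \<and>
      (\<forall>x. A x = Q x + (\<Sum>k\<in>I. (l k \<bullet> x) *\<^sub>R l k))" if "finite I" for I :: "'a set"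
    using that
  proof (induction I)
    case empty
    then show ?case using assms by (intro exI[of _ "\<lambda>_. 0"] exI[of _ A]) auto
  next
    case (insert e I)
    then obtain l Q where Q: "linear Q" "\<And>h k. Q h \<bullet> k = Q k \<bullet> h" "\<And>h. 0 \<le> Q h \<bullet> h"
      "\<And>k. k \<in> I \<Longrightarrow> Q k = 0" "\<And>x. A x = Q x + (\<Sum>k\<in>I. (l k \<bullet> x) *\<^sub>R l k)" by blast
    have quad: "Q (h + t *\<^sub>R k) \<bullet> (h + t *\<^sub>R k) = Q h \<bullet> h + 2 * t * (Q k \<bullet> h) + t * t * (Q k \<bullet> k)" for h k t
      using Q(2)[of h k] by (simp add: linear_add[OF Q(1)] linear_cmul[OF Q(1)] algebra_simps)
    show ?case
    proof (cases "Q e \<bullet> e = 0")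
      case True
      have "Q e \<bullet> h = 0" for h
      proof (rule ccontr)
        assume nz: "Q e \<bullet> h \<noteq> 0"
        \<comment> \<open>As \<open>Q e \<bullet> e = 0\<close>, the form is affine in t along h + t
          e; at this t it equals -1, against positivity.\<close>
        define t where "t = - (Q h \<bullet> h + 1) / (2 * (Q e \<bullet> h))"
        have "Q (h + t *\<^sub>R e) \<bullet> (h + t *\<^sub>R e) = -1"
          using nz True unfolding quad by (simp add: t_def field_simps)
        then show False using Q(3)[of "h + t *\<^sub>R e"] by simp
      qed
      then have "Q e = 0" using inner_eq_zero_iff by blast
      moreover have "A x = Q x + (\<Sum>k\<in>insert e I. ((l(e := 0)) k \<bullet> x) *\<^sub>R (l(e := 0)) k)" for x
      proof -
        have "(\<Sum>k\<in>I. ((l(e := 0)) k \<bullet> x) *\<^sub>R (l(e := 0)) k) = (\<Sum>k\<in>I. (l k \<bullet> x) *\<^sub>R l k)"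
          using insert.hyps by (intro sum.cong) auto
        then show ?thesis using insert.hyps Q(5)[of x] by simp
      qed
      ultimately show ?thesis using Q(1-4) by (intro exI[of _ "l(e := 0)"] exI[of _ Q]) blast
    next
      case False
      then have pos: "Q e \<bullet> e > 0" using Q(3)[of e] by simp
      define q where "q = Q e \<bullet> e"
      define m where "m = (1 / sqrt q) *\<^sub>R Q e"
      have mm: "(m \<bullet> x) *\<^sub>R m = ((Q e \<bullet> x) / q) *\<^sub>R Q e" for x
        using pos by (simp add: m_def q_def)
      define P where "P x = Q x - (m \<bullet> x) *\<^sub>R m" for x
      have "linear P" unfolding P_def
        by (intro linear_compose_sub Q(1)) (auto intro!: linearI simp: inner_add_right scaleR_add_left)
      moreover have "P h \<bullet> k = P k \<bullet> h" for h k
        using Q(2)[of h k] by (simp add: P_def inner_diff_left mult.commute)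
      moreover have "0 \<le> P h \<bullet> h" for h
      proof -
        \<comment> \<open>The form of \<open>P\<close> at h is the minimum of the form of
          \<open>Q\<close> on the line through h in direction e.\<close>
        have "Q (h + (- (Q e \<bullet> h) / q) *\<^sub>R e) \<bullet> (h + (- (Q e \<bullet> h) / q) *\<^sub>R e) = P h \<bullet> h"
          unfolding quad P_def mm using pos by (simp add: inner_diff_left q_def[symmetric] field_simps)
        then show ?thesis using Q(3) by metis
      qed
      moreover have "P k = 0" if "k \<in> insert e I" for k
      proof (cases "k = e")
        case True
        then show ?thesis using pos by (simp add: P_def mm q_def)
      next
        case False
        then have "Q k = 0" using Q(4) that by auto
        moreover from this have "Q e \<bullet> k = 0" using Q(2)[of e k] by simp
        ultimately show ?thesis by (simp add: P_def mm)
      qed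
      moreover have "A x = P x + (\<Sum>k\<in>insert e I. ((l(e := m)) k \<bullet> x) *\<^sub>R (l(e := m)) k)" for x
      proof -
        have "(\<Sum>k\<in>I. ((l(e := m)) k \<bullet> x) *\<^sub>R (l(e := m)) k) = (\<Sum>k\<in>I. (l k \<bullet> x) *\<^sub>R l k)"
          using insert.hyps by (intro sum.cong) auto
        then show ?thesis using insert.hyps Q(5)[of x] by (simp add: P_def)
      qed
      ultimately show ?thesis
        by (intro exI[of _ "l(e := m)"] exI[of _ P] conjI allI ballI)
    qed
  qed
  from this[OF finite_Basis] obtain l :: "'a \<Rightarrow> 'a" and Q where Q: "linear Q" "\<And>k. k \<in> Basis \<Longrightarrow> Q k = 0"
    "\<And>x. A x = Q x + (\<Sum>k\<in>Basis. (l k \<bullet> x) *\<^sub>R l k)" by blast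
  have "Q x = 0" for x
  proof -
    have "Q x = Q (\<Sum>k\<in>Basis. (x \<bullet> k) *\<^sub>R k)" by (simp add: euclidean_representation)
    also have "\<dots> = 0" by (simp add: linear_sum[OF Q(1)] linear_cmul[OF Q(1)] Q(2))
    finally show ?thesis .
  qed
  then show ?thesis using Q(3) by auto
qed

text \<open>The vectors l_k with A = \<Sum> l_k l_k^T act as a square root of A: tr(ASAS) = \<Sum>
  A(S l_k) \<bullet> S l_k \<ge> \<gamma> \<Sum> |S l_k|^2, and \<Sum> |S l_k|^2 = tr(SAS) \<ge>
  \<gamma> |S|^2.\<close>

lemma trace_square_ge:
  fixes A S :: "'a::euclidean_space \<Rightarrow> 'a"
  assumes A: "linear A" "\<And>h k. A h \<bullet> k = A k \<bullet> h" "\<And>h. \<gamma> * (h \<bullet> h) \<le> A h \<bullet> h" and "0 \<le> \<gamma>"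
    and S: "linear S" "\<And>h k. S h \<bullet> k = S k \<bullet> h"
  shows "\<gamma>\<^sup>2 * (\<Sum>b\<in>Basis. S b \<bullet> S b) \<le> (\<Sum>b\<in>Basis. A (S (A (S b))) \<bullet> b)"
proof -
  have "0 \<le> A h \<bullet> h" for h using A(3)[of h] \<open>0 \<le> \<gamma>\<close> by (meson inner_ge_zero mult_nonneg_nonneg order_trans)
  then obtain l :: "'a \<Rightarrow> 'a" where l: "\<And>x. A x = (\<Sum>k\<in>Basis. (l k \<bullet> x) *\<^sub>R l k)"
    using psd_decomposition[OF A(1,2)] by blast
  have tr: "(\<Sum>b\<in>Basis. A (M b) \<bullet> b) = (\<Sum>k\<in>Basis. l k \<bullet> M (l k))" if "linear M" for M
  proof -
    have "(\<Sum>b\<in>Basis. A (M b) \<bullet> b) = (\<Sum>b\<in>Basis. \<Sum>k\<in>Basis. (l k \<bullet> M b) * (l k \<bullet> b))"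
      by (simp add: l inner_sum_left)
    also have "\<dots> = (\<Sum>k\<in>Basis. \<Sum>b\<in>Basis. (l k \<bullet> M b) * (l k \<bullet> b))" by (rule sum.swap)
    also have "\<dots> = (\<Sum>k\<in>Basis. l k \<bullet> M (\<Sum>b\<in>Basis. (l k \<bullet> b) *\<^sub>R b))"
      by (simp add: linear_sum[OF that] linear_cmul[OF that] inner_sum_right mult.commute)
    finally show ?thesis by (simp add: euclidean_representation)
  qed
  have "\<gamma> * (\<Sum>k\<in>Basis. S (l k) \<bullet> S (l k)) \<le> (\<Sum>k\<in>Basis. A (S (l k)) \<bullet> S (l k))"
    by (simp add: sum_distrib_left A(3) sum_mono)
  also have "\<dots> = (\<Sum>k\<in>Basis. l k \<bullet> S (A (S (l k))))"
    by (intro sum.cong refl) (metis S(2) inner_commute)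
  also have "\<dots> = (\<Sum>b\<in>Basis. A (S (A (S b))) \<bullet> b)"
    by (rule tr[symmetric]) (use linear_compose[OF linear_compose[OF S(1) A(1)] S(1)] in \<open>simp add: o_def\<close>)
  finally have 1: "\<gamma> * (\<Sum>k\<in>Basis. S (l k) \<bullet> S (l k)) \<le> (\<Sum>b\<in>Basis. A (S (A (S b))) \<bullet> b)" .
  have "(\<Sum>k\<in>Basis. S (l k) \<bullet> S (l k)) = (\<Sum>k\<in>Basis. \<Sum>b\<in>Basis. (S (l k) \<bullet> b) * (S (l k) \<bullet> b))"
    by (intro sum.cong refl) (rule euclidean_inner)
  also have "\<dots> = (\<Sum>k\<in>Basis. \<Sum>b\<in>Basis. (l k \<bullet> S b) * (l k \<bullet> S b))"
    by (intro sum.cong refl) (metis S(2) inner_commute)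
  also have "\<dots> = (\<Sum>b\<in>Basis. A (S b) \<bullet> S b)"
    by (subst sum.swap) (simp add: l inner_sum_left)
  also have "\<dots> \<ge> \<gamma> * (\<Sum>b\<in>Basis. S b \<bullet> S b)"
    by (simp add: sum_distrib_left A(3) sum_mono)
  finally have "\<gamma> * (\<gamma> * (\<Sum>b\<in>Basis. S b \<bullet> S b)) \<le> \<gamma> * (\<Sum>k\<in>Basis. S (l k) \<bullet> S (l k))"
    using \<open>0 \<le> \<gamma>\<close> by (intro mult_left_mono)
  with 1 show ?thesis by (simp add: power2_eq_square mult.assoc)
qed

text \<open>In the application S is the Hessian of the mollified v and T the derivative of the
  mollified Y, so T = AS holds only up to an error Q with |Q| \<le> \<delta> J. Expand TT = ASAS +
  QAS + TQ and use |T| \<le> (\<Lambda> + \<delta>) J: each basis vector contributes at most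
  \<delta> \<Lambda> J^2 + (\<Lambda> + \<delta>) \<delta> J^2.\<close>

lemma trace_square_perturb:
  fixes A S T :: "'a::euclidean_space \<Rightarrow> 'a"
  assumes A: "linear A" "\<And>h k. A h \<bullet> k = A k \<bullet> h" "\<And>h. \<gamma> * (h \<bullet> h) \<le> A h \<bullet> h" and "0 \<le> \<gamma>"
    and S: "linear S" "\<And>h k. S h \<bullet> k = S k \<bullet> h" and T: "linear T"
    and bd: "\<And>h. norm (A h) \<le> \<Lambda> * norm h" "\<And>h. norm (S h) \<le> J * norm h"
      "\<And>h. norm (T h - A (S h)) \<le> \<delta> * J * norm h" and nn: "0 \<le> J" "0 \<le> \<delta>" "0 \<le> \<Lambda>"
  shows "\<gamma>\<^sup>2 * (\<Sum>b\<in>Basis. S b \<bullet> S b) \<le> (\<Sum>b\<in>Basis. T (T b) \<bullet> b) + real DIM('a) * (2 * \<Lambda> + \<delta>) * \<delta> * J\<^sup>2"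
proof -
  define Q where "Q h = T h - A (S h)" for h
  have AS: "norm (A (S h)) \<le> \<Lambda> * J * norm h" for h
    using bd(1)[of "S h"] mult_left_mono[OF bd(2)[of h] nn(3)] by (simp add: mult.assoc)
  have Tb: "norm (T h) \<le> (\<Lambda> + \<delta>) * J * norm h" for h
    using norm_triangle_ineq[of "A (S h)" "Q h"] AS[of h] bd(3)[of h] by (simp add: Q_def algebra_simps)
  have "A (S (A (S b))) \<bullet> b \<le> T (T b) \<bullet> b + (2 * \<Lambda> + \<delta>) * \<delta> * J\<^sup>2" if b: "b \<in> Basis" for b
  proof -
    have dec: "T (T b) = A (S (A (S b))) + Q (A (S b)) + T (Q b)"
      by (simp add: Q_def linear_diff[OF T])
    have "norm (Q (A (S b))) \<le> \<delta> * J * (\<Lambda> * J)"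
      using bd(3)[of "A (S b)"] mult_left_mono[OF AS[of b], of "\<delta> * J"] nn b by (simp add: Q_def)
    moreover have "norm (T (Q b)) \<le> (\<Lambda> + \<delta>) * J * (\<delta> * J)"
      using Tb[of "Q b"] mult_left_mono[OF bd(3)[of b], of "(\<Lambda> + \<delta>) * J"] nn b by (simp add: Q_def)
    moreover have "\<bar>x \<bullet> b\<bar> \<le> norm x" for x by (rule Basis_le_norm[OF b])
    ultimately have "\<bar>Q (A (S b)) \<bullet> b\<bar> \<le> \<delta> * J * (\<Lambda> * J)" "\<bar>T (Q b) \<bullet> b\<bar> \<le> (\<Lambda> + \<delta>) * J * (\<delta> * J)"
      by (meson order_trans)+
    moreover have "(2 * \<Lambda> + \<delta>) * \<delta> * J\<^sup>2 = \<delta> * J * (\<Lambda> * J) + (\<Lambda> + \<delta>) * J * (\<delta> * J)"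
      by (simp add: power2_eq_square algebra_simps)
    ultimately show ?thesis unfolding dec by (simp add: inner_add_left)
  qed
  then have "(\<Sum>b\<in>Basis. A (S (A (S b))) \<bullet> b) \<le> (\<Sum>b\<in>Basis. T (T b) \<bullet> b + (2 * \<Lambda> + \<delta>) * \<delta> * J\<^sup>2)"
    by (rule sum_mono)
  also have "\<dots> = (\<Sum>b\<in>Basis. T (T b) \<bullet> b) + real DIM('a) * (2 * \<Lambda> + \<delta>) * \<delta> * J\<^sup>2"
    by (simp add: sum.distrib)
  finally show ?thesis using trace_square_ge[OF A \<open>0 \<le> \<gamma>\<close> S] by linarith
qed

lemma linear_norm_bound_Basis:
  fixes L :: "'a::euclidean_space \<Rightarrow> 'b::real_normed_vector"
  assumes "linear L" "\<And>b. b \<in> Basis \<Longrightarrow> norm (L b) \<le> c b"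
  shows "norm (L h) \<le> (\<Sum>b\<in>Basis. c b) * norm h"
proof -
  have "L h = L (\<Sum>b\<in>Basis. (h \<bullet> b) *\<^sub>R b)" by (simp add: euclidean_representation)
  also have "\<dots> = (\<Sum>b\<in>Basis. (h \<bullet> b) *\<^sub>R L b)" using assms(1) by (simp add: linear_sum linear_cmul)
  also have "norm \<dots> \<le> (\<Sum>b\<in>Basis. norm ((h \<bullet> b) *\<^sub>R L b))" by (rule norm_sum)
  also have "\<dots> \<le> (\<Sum>b\<in>Basis. norm h * c b)"
    by (intro sum_mono) (auto intro!: mult_mono assms(2) Basis_le_norm)
  finally show ?thesis by (simp add: sum_distrib_left mult.commute)
qed

text \<open>What the local argument needs to know of \<open>B \<circ> H\<close> near a nonzero
  point, with \<open>N\<close> as gradient and \<open>A\<close> as Hessian. Convexity of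
  \<open>D\<close> serves the mean value theorem, compactness the uniformity of constants.\<close>

locale elliptic_potential =
  fixes E :: "'a::euclidean_space \<Rightarrow> real" and N :: "'a \<Rightarrow> 'a" and A :: "'a \<Rightarrow> 'a \<Rightarrow> 'a" and D :: "'a set" and \<gamma> :: real
  assumes D: "convex D" "compact D" and gamma: "0 < \<gamma>"
    and E: "\<xi> \<in> D \<Longrightarrow> (E has_derivative (\<lambda>h. N \<xi> \<bullet> h)) (at \<xi>)"
    and N: "\<xi> \<in> D \<Longrightarrow> (N has_derivative A \<xi>) (at \<xi>)"
    and A_cont: "continuous_on D (\<lambda>\<xi>. A \<xi> h)"
    and A_sym: "\<xi> \<in> D \<Longrightarrow> A \<xi> h \<bullet> k = A \<xi> k \<bullet> h"
    and A_ge: "\<xi> \<in> D \<Longrightarrow> \<gamma> * (h \<bullet> h) \<le> A \<xi> h \<bullet> h"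
begin

lemma A_linear: "\<xi> \<in> D \<Longrightarrow> linear (A \<xi>)"
  using N has_derivative_linear by blast

lemma A_bounded: "\<exists>\<Lambda>>0. \<forall>\<xi>\<in>D. \<forall>h. norm (A \<xi> h) \<le> \<Lambda> * norm h"
proof -
  have "\<exists>c. \<forall>\<xi>\<in>D. norm (A \<xi> b) \<le> c" for b
    using compact_imp_bounded[OF compact_continuous_image[OF A_cont D(2)], of b] by (auto simp: bounded_iff)
  then obtain c where c: "\<And>b \<xi>. \<xi> \<in> D \<Longrightarrow> norm (A \<xi> b) \<le> c b" by metis
  have "norm (A \<xi> h) \<le> (\<bar>\<Sum>b\<in>Basis. c b\<bar> + 1) * norm h" if "\<xi> \<in> D" for \<xi> h
  proof -
    have "norm (A \<xi> h) \<le> (\<Sum>b\<in>Basis. c b) * norm h"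
      by (rule linear_norm_bound_Basis[OF A_linear[OF that] c[OF that]])
    also have "\<dots> \<le> (\<bar>\<Sum>b\<in>Basis. c b\<bar> + 1) * norm h" by (intro mult_right_mono) auto
    finally show ?thesis .
  qed
  then show ?thesis by (intro exI[of _ "\<bar>\<Sum>b\<in>Basis. c b\<bar> + 1"]) auto
qed

lemma N_lipschitz:
  assumes "\<And>\<xi> h. \<xi> \<in> D \<Longrightarrow> norm (A \<xi> h) \<le> \<Lambda> * norm h" "\<xi> \<in> D" "\<eta> \<in> D"
  shows "norm (N \<eta> - N \<xi>) \<le> \<Lambda> * norm (\<eta> - \<xi>)"
  by (rule differentiable_bound[OF D(1), of N A])
    (use assms N in \<open>auto intro!: onorm_le intro: has_derivative_at_withinI\<close>)

lemma N_monotone: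
  assumes "\<xi> \<in> D" "\<eta> \<in> D"
  shows "\<gamma> * (norm (\<eta> - \<xi>))\<^sup>2 \<le> (N \<eta> - N \<xi>) \<bullet> (\<eta> - \<xi>)"
proof -
  let ?p = "\<lambda>t. \<xi> + t *\<^sub>R (\<eta> - \<xi>)"
  have pD: "?p t \<in> D" if "0 \<le> t" "t \<le> 1" for t
    using convexD_alt[OF D(1) assms that] by (simp add: algebra_simps)
  have d: "((\<lambda>t. N (?p t) \<bullet> (\<eta> - \<xi>)) has_real_derivative A (?p t) (\<eta> - \<xi>) \<bullet> (\<eta> - \<xi>)) (at t)"
    if "0 \<le> t" "t \<le> 1" for t
  proof -
    note * = N[OF pD[OF that]]
    have "((\<lambda>t. N (?p t)) has_derivative (\<lambda>r. A (?p t) (r *\<^sub>R (\<eta> - \<xi>)))) (at t)"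
      by (rule has_derivative_compose[where g=N and f="?p" and x=t, OF _ *]) (auto intro!: derivative_eq_intros)
    then have "((\<lambda>t. N (?p t) \<bullet> (\<eta> - \<xi>)) has_derivative (\<lambda>r. A (?p t) (r *\<^sub>R (\<eta> - \<xi>)) \<bullet> (\<eta> - \<xi>))) (at t)"
      by (rule has_derivative_inner_left)
    then show ?thesis unfolding has_field_derivative_def
      by (rule has_derivative_eq_rhs) (auto simp: linear_cmul[OF has_derivative_linear[OF *]] mult.commute)
  qed
  obtain t where t: "0 < t" "t < 1" "N (?p 1) \<bullet> (\<eta> - \<xi>) - N (?p 0) \<bullet> (\<eta> - \<xi>) = (1 - 0) * (A (?p t) (\<eta> - \<xi>) \<bullet> (\<eta> - \<xi>))"
    using MVT2[of 0 1 "\<lambda>t. N (?p t) \<bullet> (\<eta> - \<xi>)" "\<lambda>t. A (?p t) (\<eta> - \<xi>) \<bullet> (\<eta> - \<xi>)"] d by auto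
  then show ?thesis
    using A_ge[OF pD, of t "\<eta> - \<xi>"] by (simp add: inner_diff_left power2_norm_eq_inner)
qed

text \<open>Uniform continuity of A on the compact set D makes the Taylor remainder of N small
  relative to the increment, uniformly in the base point; for E the Lipschitz bound on N does the
  same. When E \<eta> = E \<xi>, the second estimate says that the increment is nearly orthogonal to
  N \<xi>, the finite-difference form of D^2v Y = 0.\<close>

lemma linearization:
  assumes "\<delta> > 0"
  shows "\<exists>s>0. \<forall>\<xi>\<in>D. \<forall>\<eta>\<in>D. norm (\<eta> - \<xi>) < s \<longrightarrow>
    norm (N \<eta> - N \<xi> - A \<xi> (\<eta> - \<xi>)) \<le> \<delta> * norm (\<eta> - \<xi>) \<and>
    \<bar>E \<eta> - E \<xi> - N \<xi> \<bullet> (\<eta> - \<xi>)\<bar> \<le> \<delta> * norm (\<eta> - \<xi>)"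
proof -
  obtain \<Lambda> where \<Lambda>: "\<Lambda> > 0" "\<And>\<xi> h. \<xi> \<in> D \<Longrightarrow> norm (A \<xi> h) \<le> \<Lambda> * norm h" using A_bounded by blast
  define \<delta>' where "\<delta>' = \<delta> / real DIM('a)"
  have \<delta>': "\<delta>' > 0" "real DIM('a) * \<delta>' = \<delta>" using assms by (auto simp: \<delta>'_def)
  have "\<exists>s>0. \<forall>\<xi>\<in>D. \<forall>\<eta>\<in>D. norm (\<eta> - \<xi>) < s \<longrightarrow> norm (A \<eta> b - A \<xi> b) < \<delta>'" for b
    using compact_uniformly_continuous[OF A_cont D(2), of b] \<delta>'
    unfolding uniformly_continuous_on_def dist_norm by blast
  then obtain s where s: "\<And>b. s b > 0"
    "\<And>b \<xi> \<eta>. \<xi> \<in> D \<Longrightarrow> \<eta> \<in> D \<Longrightarrow> norm (\<eta> - \<xi>) < s b \<Longrightarrow> norm (A \<eta> b - A \<xi> b) < \<delta>'" by metis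
  \<comment> \<open>The entry \<delta> / \<Lambda> yields |N x - N \<xi>| \<le> \<delta>; the
    minimum over the basis controls the variation of A on each basis vector.\<close>
  define s0 where "s0 = min (\<delta> / \<Lambda>) (Min (s ` Basis))"
  have s0: "s0 > 0" using s assms \<Lambda> by (auto simp: s0_def)
  have close: "norm (A \<eta> h - A \<xi> h) \<le> \<delta> * norm h" if "\<xi> \<in> D" "\<eta> \<in> D" "norm (\<eta> - \<xi>) < s0" for \<xi> \<eta> h
  proof -
    have "norm (A \<eta> h - A \<xi> h) \<le> (\<Sum>b\<in>(Basis::'a set). \<delta>') * norm h"
    proof (rule linear_norm_bound_Basis)
      show "linear (\<lambda>h. A \<eta> h - A \<xi> h)" by (intro linear_compose_sub A_linear that)
      fix b :: 'a assume b: "b \<in> Basis"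
      have "s0 \<le> s b" using b by (auto simp: s0_def min.coboundedI2)
      then show "norm (A \<eta> b - A \<xi> b) \<le> \<delta>'" using s(2)[OF that(1,2), of b] that(3) by simp
    qed
    then show ?thesis using \<delta>' by simp
  qed
  have "norm (N \<eta> - N \<xi> - A \<xi> (\<eta> - \<xi>)) \<le> \<delta> * norm (\<eta> - \<xi>) \<and>
    \<bar>E \<eta> - E \<xi> - N \<xi> \<bullet> (\<eta> - \<xi>)\<bar> \<le> \<delta> * norm (\<eta> - \<xi>)"
    if "\<xi> \<in> D" "\<eta> \<in> D" "norm (\<eta> - \<xi>) < s0" for \<xi> \<eta>
  proof -
    let ?X = "D \<inter> ball \<xi> s0"
    have X: "convex ?X" "\<xi> \<in> ?X" "\<eta> \<in> ?X"
      using that s0 D(1) by (auto simp: dist_norm norm_minus_commute intro: convex_Int)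
    have bl: "bounded_linear (A \<xi>)" using N[OF that(1)] has_derivative_bounded_linear by blast
    have "norm ((N \<eta> - A \<xi> \<eta>) - (N \<xi> - A \<xi> \<xi>)) \<le> \<delta> * norm (\<eta> - \<xi>)"
    proof (rule differentiable_bound[OF X(1) _ _ X(3,2), of _ "\<lambda>x h. A x h - A \<xi> h"])
      fix x assume x: "x \<in> ?X"
      show "((\<lambda>\<eta>. N \<eta> - A \<xi> \<eta>) has_derivative (\<lambda>h. A x h - A \<xi> h)) (at x within ?X)"
        using x N bounded_linear_imp_has_derivative[OF bl]
        by (auto intro!: has_derivative_diff intro: has_derivative_at_withinI)
      show "onorm (\<lambda>h. A x h - A \<xi> h) \<le> \<delta>"
        using x that by (auto intro!: onorm_le close simp: dist_norm norm_minus_commute)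
    qed
    moreover have "norm ((E \<eta> - N \<xi> \<bullet> \<eta>) - (E \<xi> - N \<xi> \<bullet> \<xi>)) \<le> \<delta> * norm (\<eta> - \<xi>)"
    proof (rule differentiable_bound[OF X(1) _ _ X(3,2), of _ "\<lambda>x h. N x \<bullet> h - N \<xi> \<bullet> h"])
      fix x assume x: "x \<in> ?X"
      show "((\<lambda>\<eta>. E \<eta> - N \<xi> \<bullet> \<eta>) has_derivative (\<lambda>h. N x \<bullet> h - N \<xi> \<bullet> h)) (at x within ?X)"
        using x E by (auto intro!: derivative_eq_intros intro: has_derivative_at_withinI)
      show "onorm (\<lambda>h. N x \<bullet> h - N \<xi> \<bullet> h) \<le> \<delta>"
      proof (rule onorm_le)
        fix h
        have "norm (N x \<bullet> h - N \<xi> \<bullet> h) \<le> norm (N x - N \<xi>) * norm h"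
          using Cauchy_Schwarz_ineq2[of "N x - N \<xi>" h] by (simp add: inner_diff_left)
        also have "norm (N x - N \<xi>) \<le> \<Lambda> * norm (x - \<xi>)" using N_lipschitz[OF \<Lambda>(2)] x that by auto
        also have "\<dots> \<le> \<Lambda> * (\<delta> / \<Lambda>)"
          using x \<Lambda> by (intro mult_left_mono) (auto simp: s0_def dist_norm norm_minus_commute)
        finally show "norm (N x \<bullet> h - N \<xi> \<bullet> h) \<le> \<delta> * norm h" using \<Lambda>(1) by (simp add: mult_right_mono)
      qed
    qed
    ultimately show ?thesis
      by (simp add: linear_diff[OF A_linear[OF that(1)]] inner_diff_right algebra_simps)
  qed
  then show ?thesis using s0 by blast
qed

end

section \<open>Local rigidity\<close>

lemma C1_gradI:
  assumes "\<And>x. (f has_derivative D x) (at x)" "\<And>b. b \<in> Basis \<Longrightarrow> continuous_on UNIV (\<lambda>x. D x b)"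
  shows "C1_grad f (vgrad f)" "vgrad f x \<bullet> h = D x h"
proof -
  have d: "(f has_derivative (\<lambda>h. vgrad f x \<bullet> h)) (at x)" for x
    using assms(1) by (intro vgrad_has_derivative) (auto simp: differentiable_def)
  then have "(\<lambda>h. vgrad f x \<bullet> h) = D x" for x
    using assms(1) has_derivative_unique by blast
  then show eq: "vgrad f x \<bullet> h = D x h" for x h by metis
  have "continuous_on UNIV (vgrad f)"
    by (rule continuous_on_componentwise[THEN iffD2]) (simp add: eq assms(2))
  then show "C1_grad f (vgrad f)" using d by (simp add: C1_grad_def)
qed

lemma C1_grad_shift: "C1_grad f g \<Longrightarrow> C1_grad (\<lambda>x. f (x + z)) (\<lambda>x. g (x + z))"
  unfolding C1_grad_def
proof safe
  assume c: "continuous_on UNIV g" and d: "\<forall>x. (f has_derivative (\<bullet>) (g x)) (at x)"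
  show "continuous_on UNIV (\<lambda>x. g (x + z))"
    by (intro continuous_on_compose2[OF c] continuous_intros) auto
  show "((\<lambda>x. f (x + z)) has_derivative (\<bullet>) (g (x + z))) (at x)" for x
    by (rule has_derivative_compose[where g=f and f="\<lambda>x. x + z" and f'="\<lambda>h. h"])
      (auto intro!: derivative_eq_intros simp: d)
qed

lemma C1_grad_reflect: "C1_grad f g \<Longrightarrow> C1_grad (\<lambda>y. f (x - y)) (\<lambda>y. - g (x - y))"
  unfolding C1_grad_def
proof safe
  assume c: "continuous_on UNIV g" and d: "\<forall>x. (f has_derivative (\<bullet>) (g x)) (at x)"
  show "continuous_on UNIV (\<lambda>y. - g (x - y))"
    by (intro continuous_on_compose2[OF c] continuous_intros) auto
  fix y
  have "((\<lambda>y. f (x - y)) has_derivative (\<lambda>h. g (x - y) \<bullet> (- h))) (at y)"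
    by (rule has_derivative_compose[where g=f and f="\<lambda>y. x - y"])
      (auto intro!: derivative_eq_intros simp: d)
  then show "((\<lambda>y. f (x - y)) has_derivative (\<bullet>) (- g (x - y))) (at y)"
    by (rule has_derivative_eq_rhs) auto
qed

lemma C1_grad_mult:
  assumes "C1_grad f f'" "C1_grad g g'"
  shows "C1_grad (\<lambda>x. f x * g x) (\<lambda>x. f x *\<^sub>R g' x + g x *\<^sub>R f' x)"
  unfolding C1_grad_def
proof safe
  show "continuous_on UNIV (\<lambda>x. f x *\<^sub>R g' x + g x *\<^sub>R f' x)"
    by (intro continuous_intros C1_grad_D(2,3)[OF assms(1)] C1_grad_D(2,3)[OF assms(2)])
  show "((\<lambda>x. f x * g x) has_derivative (\<bullet>) (f x *\<^sub>R g' x + g x *\<^sub>R f' x)) (at x)" for x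
    by (rule has_derivative_eq_rhs[OF has_derivative_mult[OF C1_grad_D(1)[OF assms(1)] C1_grad_D(1)[OF assms(2)]]])
      (auto simp: inner_add_left mult.commute)
qed

lemma C1_grad_diff:
  assumes "C1_grad f f'" "C1_grad g g'"
  shows "C1_grad (\<lambda>x. f x - g x) (\<lambda>x. f' x - g' x)"
  unfolding C1_grad_def
  by (auto intro!: continuous_intros C1_grad_D(2)[OF assms(1)] C1_grad_D(2)[OF assms(2)]
     has_derivative_eq_rhs[OF has_derivative_diff[OF C1_grad_D(1)[OF assms(1)] C1_grad_D(1)[OF assms(2)]]]
     simp: inner_diff_left)

lemma bounded_on_cube:
  fixes f :: "'a::euclidean_space \<Rightarrow> 'b::real_normed_vector"
  assumes "continuous_on UNIV f"
  shows "\<exists>c>0. \<forall>x\<in>cube z r. norm (f x) \<le> c"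
proof -
  have "bounded (f ` cube z r)"
    by (intro compact_imp_bounded compact_continuous_image continuous_on_subset[OF assms] compact_cube) auto
  then show ?thesis unfolding bounded_pos by auto
qed

lemma integral_cube_const: "integral (cube x r) (\<lambda>_. c) = measure lborel (cube x r) * (c::real)"
  by (simp add: cube_def integral_const)

text \<open>A positive lower bound on the inner cube is all the estimates require of a cutoff, so a
  rescaled bump suffices in place of a function equal to 1 there.\<close>

lemma cutoff_exists:
  assumes "0 < r" "r < s"
  shows "\<exists>\<theta> \<theta>' c. C1_grad \<theta> \<theta>' \<and> (\<forall>x. 0 \<le> \<theta> x) \<and> (\<forall>x. x \<notin> cube (z::'a::euclidean_space) s \<longrightarrow> \<theta> x = 0) \<and>
    0 < c \<and> (\<forall>x\<in>cube z r. c \<le> \<theta> x)"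
proof -
  define \<theta> :: "'a \<Rightarrow> real" where "\<theta> x = bump ((1/s) *\<^sub>R x + (- (1/s)) *\<^sub>R z)" for x
  have C1: "C1_grad \<theta> (vgrad \<theta>)"
    unfolding \<theta>_def[abs_def] by (intro C1_grad_vgrad C_k_compose_affine C_k_bump)
  have eq: "((1/s) *\<^sub>R x + (- (1/s)) *\<^sub>R z) \<bullet> b = ((x - z) \<bullet> b) / s" for x b
    by (simp add: inner_diff_left inner_add_left diff_divide_distrib)
  have s: "s > 0" using assms by simp
  have zero: "\<theta> x = 0" if out: "x \<notin> cube z s" for x
  proof -
    obtain b where "b \<in> Basis" "s < \<bar>(x - z) \<bullet> b\<bar>" using out by (metis mem_cube not_le)
    then have "(1/s) *\<^sub>R x + (- (1/s)) *\<^sub>R z \<notin> cube 0 1"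
      unfolding mem_cube diff_0_right eq using s by (auto simp: field_simps intro!: bexI[of _ b])
    then show ?thesis by (simp add: \<theta>_def bump_eq_0)
  qed
  have pos: "\<theta> x > 0" if "x \<in> cube z r" for x
    unfolding \<theta>_def
  proof (rule bump_pos)
    fix b :: 'a assume "b \<in> Basis"
    then have "\<bar>(x - z) \<bullet> b\<bar> < s" using that assms by (auto simp: mem_cube)
    then show "\<bar>((1/s) *\<^sub>R x + (- (1/s)) *\<^sub>R z) \<bullet> b\<bar> < 1" unfolding eq using s by simp
  qed
  have "cube z r \<noteq> {}" using center_in_cube[of r z] assms by auto
  then obtain y where y: "y \<in> cube z r" "\<And>x. x \<in> cube z r \<Longrightarrow> \<theta> y \<le> \<theta> x"
    using continuous_attains_inf[OF compact_cube _ continuous_on_subset[OF C1_grad_D(3)[OF C1]]] by blast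
  have "0 \<le> \<theta> x" for x by (simp add: \<theta>_def bump_nonneg)
  then show ?thesis using C1 zero y pos by blast
qed

text \<open>Continuity of v, a and Y is demanded on all of space, so that translates and
  convolutions need no restriction, while the relations between them hold in the cube only.
  \<open>weak\<close> says div Y = 0 there; it admits C^1 test functions because those built from
  \<open>v\<close> are no smoother.\<close>

locale local_solution = elliptic_potential E N A D \<gamma>
  for E :: "'a::euclidean_space \<Rightarrow> real" and N A D \<gamma> +
  fixes v :: "'a \<Rightarrow> real" and a Y :: "'a \<Rightarrow> 'a" and x\<^sub>0 :: 'a and R e\<^sub>0 :: real
  assumes v: "C1_grad v a" and Y_cont: "continuous_on UNIV Y" and R: "0 < R"
    and a_D: "x \<in> cube x\<^sub>0 R \<Longrightarrow> a x \<in> D"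
    and Y_eq: "x \<in> cube x\<^sub>0 R \<Longrightarrow> Y x = N (a x)"
    and eikonal: "x \<in> cube x\<^sub>0 R \<Longrightarrow> E (a x) = e\<^sub>0"
    and weak: "C1_grad \<phi> g \<Longrightarrow> (\<And>x. x \<notin> cube x\<^sub>0 R \<Longrightarrow> \<phi> x = 0) \<Longrightarrow> integral UNIV (\<lambda>x. Y x \<bullet> g x) = 0"
begin

lemma a_cont: "continuous_on UNIV a"
  using C1_grad_D(2)[OF v] .

lemma cont_shift: "continuous_on UNIV f \<Longrightarrow> continuous_on UNIV (\<lambda>x. f (x - z))"
  for f :: "'a \<Rightarrow> 'b::topological_space" and z
  by (rule continuous_on_compose2[of UNIV f]) (auto intro!: continuous_intros)

text \<open>Test the equation and its translate by \<open>z\<close> with \<open>\<theta>\<^sup>2 (v(x - z) - v(x))\<close>.\<close>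

lemma caccioppoli:
  "\<exists>C\<ge>0. \<forall>z\<in>cube 0 (R/4). integral (cube x\<^sub>0 (R/4)) (\<lambda>x. (norm (a (x - z) - a x))\<^sup>2) \<le> C * (norm z)\<^sup>2"
proof -
  obtain \<Lambda> where \<Lambda>: "\<Lambda> > 0" "\<And>\<xi> h. \<xi> \<in> D \<Longrightarrow> norm (A \<xi> h) \<le> \<Lambda> * norm h" using A_bounded by blast
  obtain L where L: "L > 0" "\<And>x. x \<in> cube x\<^sub>0 R \<Longrightarrow> norm (a x) \<le> L"
    using bounded_on_cube[OF a_cont] by blast
  obtain \<theta> \<theta>' c where chi: "C1_grad \<theta> \<theta>'" "\<And>x. 0 \<le> \<theta> x" "\<And>x. x \<notin> cube x\<^sub>0 (R/2) \<Longrightarrow> \<theta> x = 0"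
    "0 < c" "\<And>x. x \<in> cube x\<^sub>0 (R/4) \<Longrightarrow> c \<le> \<theta> x"
    using cutoff_exists[of "R/4" "R/2" x\<^sub>0] R by auto
  obtain G where G: "G > 0" "\<And>x. x \<in> cube x\<^sub>0 (R/2) \<Longrightarrow> norm (\<theta>' x) \<le> G"
    using bounded_on_cube[OF C1_grad_D(2)[OF chi(1)]] by blast
  \<comment> \<open>With t = \<theta> |da| and p = L \<Lambda> G |z|, the cross term 2tp is at most
    (\<gamma>/2) t^2 + (2/\<gamma>) p^2. The first part is absorbed by the monotonicity of N, the
    second is K |z|^2.\<close>
  define K where "K = 2 / \<gamma> * (L * \<Lambda> * G)\<^sup>2"
  define V where "V = measure lborel (cube x\<^sub>0 (R/2))"
  define C where "C = 2 / \<gamma> * (K * V) / c\<^sup>2"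
  have "integral (cube x\<^sub>0 (R/4)) (\<lambda>x. (norm (a (x - z) - a x))\<^sup>2) \<le> C * (norm z)\<^sup>2"
    if z: "z \<in> cube 0 (R/4)" for z
  proof -
    define w where "w x = v (x - z) - v x" for x
    define da where "da x = a (x - z) - a x" for x
    define dY where "dY x = Y (x - z) - Y x" for x
    define \<phi> where "\<phi> x = (\<theta> x * \<theta> x) * w x" for x
    define \<phi>' where "\<phi>' x = (\<theta> x * \<theta> x) *\<^sub>R da x + w x *\<^sub>R (\<theta> x *\<^sub>R \<theta>' x + \<theta> x *\<^sub>R \<theta>' x)" for x
    have vz: "C1_grad (\<lambda>x. v (x - z)) (\<lambda>x. a (x - z))" using C1_grad_shift[OF v, of "- z"] by simp
    have w': "C1_grad w da"
      unfolding w_def[abs_def] da_def[abs_def] by (rule C1_grad_diff[OF vz v])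
    have \<phi>: "C1_grad \<phi> \<phi>'"
      unfolding \<phi>_def[abs_def] \<phi>'_def[abs_def] by (rule C1_grad_mult[OF C1_grad_mult[OF chi(1) chi(1)] w'])
    have \<phi>0: "\<phi> x = 0" if "x \<notin> cube x\<^sub>0 (R/2)" for x using chi(3)[OF that] by (simp add: \<phi>_def)
    have \<phi>'0: "\<phi>' x = 0" if "x \<notin> cube x\<^sub>0 (R/2)" for x using chi(3)[OF that] by (simp add: \<phi>'_def)
    have \<phi>'c: "continuous_on UNIV \<phi>'" using C1_grad_D(2)[OF \<phi>] .
    have sub: "cube x\<^sub>0 (R/2) \<subseteq> cube x\<^sub>0 R" using R by (intro cube_mono) auto
    have sub2: "x - z \<in> cube x\<^sub>0 R" if "x \<in> cube x\<^sub>0 (R/2)" for x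
      using cube_diff[OF that z] cube_mono[of "R/2+R/4" R x\<^sub>0] R by auto
    have 1: "integral UNIV (\<lambda>x. Y x \<bullet> \<phi>' x) = 0" using \<phi>0 sub by (intro weak[OF \<phi>]) auto
    have supp: "x + z \<notin> cube x\<^sub>0 (R/2)" if "x \<notin> cube x\<^sub>0 (R/2 + R/4)" for x
      using cube_diff[of "x + z" x\<^sub>0 "R/2" z "R/4"] z that by auto
    \<comment> \<open>The equation for the translate of Y is the equation for Y tested with the
      opposite translate of \<phi>, whose support stays within radius R/2 + R/4 < R.\<close>
    have "integral UNIV (\<lambda>x. Y x \<bullet> \<phi>' (x + z)) = 0"
    proof (rule weak[OF C1_grad_shift[OF \<phi>]])
      fix x assume "x \<notin> cube x\<^sub>0 R"
      then have "x \<notin> cube x\<^sub>0 (R/2 + R/4)" using cube_mono[of "R/2+R/4" R x\<^sub>0] R by auto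
      then show "\<phi> (x + z) = 0" by (intro \<phi>0 supp)
    qed
    moreover have "integral UNIV (\<lambda>x. Y (x + - z) \<bullet> \<phi>' (x + - z + z)) = integral UNIV (\<lambda>x. Y x \<bullet> \<phi>' (x + z))"
    proof (rule integral_UNIV_shift[where f="\<lambda>x. Y x \<bullet> \<phi>' (x + z)" and c=x\<^sub>0 and r="R/2+R/4"])
      show "Y x \<bullet> \<phi>' (x + z) = 0" if "x \<notin> cube x\<^sub>0 (R/2 + R/4)" for x using \<phi>'0[OF supp[OF that]] by simp
      show "continuous_on UNIV (\<lambda>x. Y x \<bullet> \<phi>' (x + z))"
        by (intro continuous_intros Y_cont continuous_on_compose2[OF \<phi>'c]) auto
    qed
    ultimately have 2: "integral UNIV (\<lambda>x. Y (x - z) \<bullet> \<phi>' x) = 0" by simp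
    have dYc: "continuous_on UNIV dY" and dac: "continuous_on UNIV da"
      unfolding dY_def da_def by (intro continuous_intros cont_shift Y_cont a_cont)+
    have "integral (cube x\<^sub>0 (R/2)) (\<lambda>x. dY x \<bullet> \<phi>' x) =
      integral (cube x\<^sub>0 (R/2)) (\<lambda>x. Y (x - z) \<bullet> \<phi>' x) - integral (cube x\<^sub>0 (R/2)) (\<lambda>x. Y x \<bullet> \<phi>' x)"
      unfolding dY_def inner_diff_left
      by (intro integral_diff integrable_on_cube continuous_intros cont_shift Y_cont \<phi>'c)
    also have "\<dots> = 0"
      using 1 2 integral_UNIV_eq[of "cube x\<^sub>0 (R/2)" "\<lambda>x. Y (x - z) \<bullet> \<phi>' x"]
        integral_UNIV_eq[of "cube x\<^sub>0 (R/2)" "\<lambda>x. Y x \<bullet> \<phi>' x"] \<phi>'0 by simp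
    finally have zero: "integral (cube x\<^sub>0 (R/2)) (\<lambda>x. dY x \<bullet> \<phi>' x) = 0" .
    have pw: "\<gamma> / 2 * (\<theta> x * norm (da x))\<^sup>2 - K * (norm z)\<^sup>2 \<le> dY x \<bullet> \<phi>' x" if x: "x \<in> cube x\<^sub>0 (R/2)" for x
    proof -
      have D: "a x \<in> D" "a (x - z) \<in> D" using a_D sub sub2 x by auto
      have Yx: "dY x = N (a (x - z)) - N (a x)" using Y_eq sub sub2 x by (auto simp: dY_def)
      have mono: "\<gamma> * (norm (da x))\<^sup>2 \<le> dY x \<bullet> da x"
        unfolding Yx da_def by (rule N_monotone[OF D])
      have lip: "norm (dY x) \<le> \<Lambda> * norm (da x)"
        unfolding Yx da_def by (rule N_lipschitz[OF \<Lambda>(2) D])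
      have wz: "\<bar>w x\<bar> \<le> L * norm z"
      proof -
        have "norm (v (x - z) - v x) \<le> L * norm (x - z - x)"
        proof (rule differentiable_bound[OF convex_cube])
          show "(v has_derivative (\<lambda>h. a y \<bullet> h)) (at y within cube x\<^sub>0 R)" for y
            using C1_grad_D(1)[OF v] by (rule has_derivative_at_withinI)
          show "onorm (\<lambda>h. a y \<bullet> h) \<le> L" if "y \<in> cube x\<^sub>0 R" for y
            by (rule onorm_le) (use L(2)[OF that] in \<open>auto intro!: order_trans[OF Cauchy_Schwarz_ineq2] mult_right_mono\<close>)
        qed (use sub sub2 x in auto)
        then show ?thesis by (simp add: w_def)
      qed
      define t where "t = \<theta> x * norm (da x)"
      define p where "p = L * \<Lambda> * G * norm z"
      have "\<bar>w x * (\<theta> x * (dY x \<bullet> \<theta>' x))\<bar> \<le> (L * norm z) * (\<theta> x * ((\<Lambda> * norm (da x)) * G))"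
        unfolding abs_mult using wz lip G(2)[OF x] chi(2)[of x] \<Lambda>(1)
        by (intro mult_mono) (auto intro!: order_trans[OF Cauchy_Schwarz_ineq2] mult_mono)
      also have "\<dots> = t * p" by (simp add: t_def p_def)
      finally have cross: "\<bar>w x * (\<theta> x * (dY x \<bullet> \<theta>' x))\<bar> \<le> t * p" .
      have main: "\<gamma> * t\<^sup>2 \<le> (\<theta> x * \<theta> x) * (dY x \<bullet> da x)"
        using mult_left_mono[OF mono, of "\<theta> x * \<theta> x"] chi(2)[of x]
        by (simp add: t_def power2_eq_square mult.assoc mult.left_commute)
      have eq: "dY x \<bullet> \<phi>' x = (\<theta> x * \<theta> x) * (dY x \<bullet> da x) + 2 * (w x * (\<theta> x * (dY x \<bullet> \<theta>' x)))"
        by (simp add: \<phi>'_def inner_add_right algebra_simps)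
      have "0 \<le> \<gamma> / 2 * (t - 2 / \<gamma> * p)\<^sup>2" using gamma by simp
      also have "\<dots> = \<gamma> / 2 * t\<^sup>2 - 2 * (t * p) + 2 / \<gamma> * p\<^sup>2"
        using gamma by (simp add: power2_eq_square field_simps)
      finally have "\<gamma> / 2 * t\<^sup>2 - 2 / \<gamma> * p\<^sup>2 \<le> \<gamma> * t\<^sup>2 - 2 * (t * p)" by simp
      moreover have "2 / \<gamma> * p\<^sup>2 = K * (norm z)\<^sup>2" by (simp add: K_def p_def power_mult_distrib)
      ultimately show ?thesis unfolding eq t_def[symmetric] using main cross by linarith
    qed
    have "integral (cube x\<^sub>0 (R/2)) (\<lambda>x. \<gamma> / 2 * (\<theta> x * norm (da x))\<^sup>2 - K * (norm z)\<^sup>2) \<le> 0"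
      unfolding zero[symmetric]
      by (intro integral_le integrable_on_cube continuous_intros dac dYc \<phi>'c C1_grad_D(3)[OF chi(1)] pw)
    moreover have "integral (cube x\<^sub>0 (R/2)) (\<lambda>x. \<gamma> / 2 * (\<theta> x * norm (da x))\<^sup>2 - K * (norm z)\<^sup>2)
      = \<gamma> / 2 * integral (cube x\<^sub>0 (R/2)) (\<lambda>x. (\<theta> x * norm (da x))\<^sup>2) - V * (K * (norm z)\<^sup>2)"
      by (subst integral_diff)
        (auto intro!: integrable_on_cube continuous_intros dac C1_grad_D(3)[OF chi(1)] simp: integral_cube_const V_def)
    ultimately have I1: "integral (cube x\<^sub>0 (R/2)) (\<lambda>x. (\<theta> x * norm (da x))\<^sup>2) \<le> 2 / \<gamma> * (V * (K * (norm z)\<^sup>2))"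
      using gamma by (simp add: field_simps)
    have "c\<^sup>2 * integral (cube x\<^sub>0 (R/4)) (\<lambda>x. (norm (da x))\<^sup>2) = integral (cube x\<^sub>0 (R/4)) (\<lambda>x. c\<^sup>2 * (norm (da x))\<^sup>2)"
      by simp
    also have "\<dots> \<le> integral (cube x\<^sub>0 (R/4)) (\<lambda>x. (\<theta> x * norm (da x))\<^sup>2)"
    proof (rule integral_le)
      show "c\<^sup>2 * (norm (da x))\<^sup>2 \<le> (\<theta> x * norm (da x))\<^sup>2" if "x \<in> cube x\<^sub>0 (R/4)" for x
        using chi(4) chi(5)[OF that] by (auto simp: power_mult_distrib intro!: mult_right_mono power_mono)
    qed (intro integrable_on_cube continuous_intros dac C1_grad_D(3)[OF chi(1)])+
    also have "\<dots> \<le> integral (cube x\<^sub>0 (R/2)) (\<lambda>x. (\<theta> x * norm (da x))\<^sup>2)"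
      using R by (intro integral_subset_le integrable_on_cube continuous_intros dac C1_grad_D(3)[OF chi(1)] cube_mono) auto
    also note I1
    finally have "c\<^sup>2 * integral (cube x\<^sub>0 (R/4)) (\<lambda>x. (norm (da x))\<^sup>2) \<le> 2 / \<gamma> * (V * (K * (norm z)\<^sup>2))" .
    then have "integral (cube x\<^sub>0 (R/4)) (\<lambda>x. (norm (da x))\<^sup>2) \<le> 2 / \<gamma> * (V * (K * (norm z)\<^sup>2)) / c\<^sup>2"
      using chi(4) by (subst pos_le_divide_eq) (auto simp: mult.commute)
    then show ?thesis by (simp add: C_def da_def field_simps)
  qed
  moreover have "C \<ge> 0" using gamma by (simp add: C_def K_def V_def)
  ultimately show ?thesis by blast
qed

end

section \<open>Derivatives of mollified functions\<close>

lemma C_k_sum: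
  assumes "finite I" "\<And>i. i \<in> I \<Longrightarrow> C_k k UNIV (f i)"
  shows "C_k k UNIV (\<lambda>x::'a::euclidean_space. \<Sum>i\<in>I. f i x)"
  using assms by (induction I) (auto intro: C_k_add C_k_const)

lemma C1_grad_vgrad_inner:
  fixes \<rho> :: "'a::euclidean_space \<Rightarrow> real"
  assumes "\<And>k. C_k k UNIV \<rho>"
  shows "C1_grad (\<lambda>z. vgrad \<rho> z \<bullet> c) (vgrad (\<lambda>z. vgrad \<rho> z \<bullet> c))"
proof (rule C1_grad_vgrad)
  have "C_k (Suc 0) UNIV (\<lambda>z. \<Sum>b\<in>Basis. dir_deriv b \<rho> z * (b \<bullet> c))"
    by (intro C_k_sum C_k_mult C_k_const) (use assms[of "Suc (Suc 0)"] in auto)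
  then show "C_k (Suc 0) UNIV (\<lambda>z. vgrad \<rho> z \<bullet> c)"
    by (simp add: vgrad_def inner_sum_left)
qed

text \<open>The Cauchy-Schwarz inequality for f and 1, obtained from the nonnegativity of the
  variance of f on the cube.\<close>

lemma integral_square_le:
  fixes f :: "'a::euclidean_space \<Rightarrow> real"
  assumes "continuous_on UNIV f" "0 < r"
  shows "(integral (cube x r) f)\<^sup>2 \<le> measure lborel (cube x r) * integral (cube x r) (\<lambda>y. (f y)\<^sup>2)"
proof -
  define V where "V = measure lborel (cube x r)"
  define m where "m = integral (cube x r) f / V"
  have V: "V > 0" using assms(2) by (auto simp: V_def cube_def content_pos_lt_eq inner_diff_left inner_add_left)
  have "0 \<le> integral (cube x r) (\<lambda>y. (f y - m)\<^sup>2)"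
    by (intro integral_nonneg integrable_on_cube continuous_intros assms) auto
  also have "\<dots> = integral (cube x r) (\<lambda>y. (f y)\<^sup>2 - 2 * m * f y + m\<^sup>2)"
    by (simp add: power2_eq_square algebra_simps)
  also have "\<dots> = integral (cube x r) (\<lambda>y. (f y)\<^sup>2) - 2 * m * integral (cube x r) f + V * m\<^sup>2"
    by (subst integral_add, simp_all add: integrable_on_cube continuous_intros assms integral_cube_const V_def[symmetric],
      subst integral_diff) (auto intro!: integrable_on_cube continuous_intros assms)
  finally have "0 \<le> V * (integral (cube x r) (\<lambda>y. (f y)\<^sup>2) - 2 * m * integral (cube x r) f + V * m\<^sup>2)"
    using V by simp
  also have "\<dots> = V * integral (cube x r) (\<lambda>y. (f y)\<^sup>2) - (integral (cube x r) f)\<^sup>2"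
    using V by (simp add: m_def power2_eq_square field_simps)
  finally show ?thesis by (simp add: V_def)
qed

context mollifier
begin

abbreviation "g \<equiv> vgrad \<rho>"

lemma \<rho>_C1: "C1_grad \<rho> g"
  by (rule C1_grad_vgrad[OF \<rho>_smooth])

lemma \<rho>_cont: "continuous_on UNIV \<rho>"
  using C1_grad_D(3)[OF \<rho>_C1] .

lemma g_cont: "continuous_on UNIV g"
  using C1_grad_D(2)[OF \<rho>_C1] .

lemma g_supp: "z \<notin> cube 0 \<epsilon> \<Longrightarrow> g z = 0"
  using C1_grad_eq_0_outside[OF \<rho>_C1 \<rho>_supp] .

lemma g_C1: "C1_grad (\<lambda>z. g z \<bullet> c) (vgrad (\<lambda>z. g z \<bullet> c))"
  by (rule C1_grad_vgrad_inner[OF \<rho>_smooth])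

text \<open>Integration by parts: y \<mapsto> \<rho>(x - y) v(y) has compact support, so its
  gradient integrates to 0 and the derivative moves from the kernel to v.\<close>

lemma conv_C1_has_derivative:
  assumes v: "C1_grad v a"
  shows "(conv \<rho> v has_derivative (\<lambda>h. conv \<rho> a x \<bullet> h)) (at x)"
proof -
  note a_cont = C1_grad_D(2)[OF v]
  have "conv (\<lambda>z. g z \<bullet> h) v x = conv \<rho> a x \<bullet> h" for h
  proof -
    have p: "C1_grad (\<lambda>y. \<rho> (x - y) * v y) (\<lambda>y. \<rho> (x - y) *\<^sub>R a y + v y *\<^sub>R - g (x - y))"
      by (rule C1_grad_mult[OF C1_grad_reflect[OF \<rho>_C1] v])
    have s: "x - y \<notin> cube 0 \<epsilon>" if "y \<notin> cube x \<epsilon>" for y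
      using that cube_uminus[of "x - y" \<epsilon>] by (simp add: cube_0_diff)
    have s': "\<rho> (x - y) = 0" "g (x - y) = 0" if "y \<notin> cube x \<epsilon>" for y
      using \<rho>_supp g_supp s[OF that] by auto
    have "integral UNIV (\<lambda>y. (\<rho> (x - y) *\<^sub>R a y + v y *\<^sub>R - g (x - y)) \<bullet> h) = 0"
      by (rule integral_grad_eq_0[OF p, of x \<epsilon>]) (simp add: s')
    moreover have i1: "(\<lambda>y. \<rho> (x - y) *\<^sub>R a y) integrable_on UNIV"
      by (rule integrable_on_UNIV[of x \<epsilon>])
        (auto simp: s' intro!: continuous_intros a_cont continuous_on_compose2[OF \<rho>_cont])
    moreover have i2: "(\<lambda>y. (g (x - y) \<bullet> h) * v y) integrable_on UNIV"
      by (rule integrable_on_UNIV[of x \<epsilon>])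
        (auto simp: s' intro!: continuous_intros C1_grad_D(3)[OF v] continuous_on_compose2[OF g_cont])
    moreover have "(\<rho> (x - y) *\<^sub>R a y + v y *\<^sub>R - g (x - y)) \<bullet> h = (\<rho> (x - y) *\<^sub>R a y) \<bullet> h - (g (x - y) \<bullet> h) * v y" for y
      by (simp add: inner_diff_left)
    moreover have "integral UNIV (\<lambda>y. (\<rho> (x - y) *\<^sub>R a y) \<bullet> h) = conv \<rho> a x \<bullet> h"
      using integral_linear[OF i1 bounded_linear_inner_left[of h]] by (simp add: conv_def o_def)
    moreover have "(\<lambda>y. (\<rho> (x - y) *\<^sub>R a y) \<bullet> h) integrable_on UNIV"
      using integrable_linear[OF i1 bounded_linear_inner_left[of h]] by (simp add: o_def)
    ultimately show ?thesis by (simp only: integral_diff) (simp add: conv_def)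
  qed
  then show ?thesis using conv_has_derivative[where c=0 and r=\<epsilon>, OF \<rho>_C1 \<rho>_supp C1_grad_D(3)[OF v], where x=x] by simp
qed

lemma g_mean_zero: "integral (cube 0 \<epsilon>) (\<lambda>w. g w \<bullet> h) = 0"
  using integral_grad_eq_0[where c=0 and r=\<epsilon> and h=h, OF \<rho>_C1 \<rho>_supp] integral_UNIV_eq[of "cube 0 \<epsilon>" "\<lambda>w. g w \<bullet> h"] g_supp by simp

text \<open>As the components of g have mean zero, the constant f x may be subtracted. Derivatives
  of mollified functions are thereby controlled by increments.\<close>

lemma conv_g_eq:
  fixes f :: "'a \<Rightarrow> 'b::euclidean_space"
  assumes "continuous_on UNIV f"
  shows "conv (\<lambda>z. g z \<bullet> h) f x = integral (cube 0 \<epsilon>) (\<lambda>w. (g w \<bullet> h) *\<^sub>R (f (x - w) - f x))"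
proof -
  have fc: "continuous_on UNIV (\<lambda>w. f (x - w))"
    by (rule continuous_on_compose2[OF assms]) (auto intro!: continuous_intros)
  have "integral (cube 0 \<epsilon>) (\<lambda>w. (g w \<bullet> h) *\<^sub>R (f (x - w) - f x)) =
    integral (cube 0 \<epsilon>) (\<lambda>w. (g w \<bullet> h) *\<^sub>R f (x - w)) - integral (cube 0 \<epsilon>) (\<lambda>w. (g w \<bullet> h) *\<^sub>R f x)"
    unfolding scaleR_diff_right by (intro integral_diff integrable_on_cube continuous_intros g_cont fc)
  also have "integral (cube 0 \<epsilon>) (\<lambda>w. (g w \<bullet> h) *\<^sub>R f x) = integral (cube 0 \<epsilon>) (\<lambda>w. g w \<bullet> h) *\<^sub>R f x"
    using integral_linear[OF integrable_on_cube[of "\<lambda>w. g w \<bullet> h" 0 \<epsilon>] bounded_linear_scaleR_left[of "f x"]]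
    by (simp add: o_def continuous_intros g_cont)
  finally show ?thesis
    unfolding g_mean_zero
    by (subst conv_eq_integral_cube[where c=0 and r=\<epsilon>]) (auto simp: g_supp intro!: continuous_intros g_cont assms)
qed

lemma conv_close:
  fixes f :: "'a \<Rightarrow> 'b::euclidean_space"
  assumes f: "continuous_on UNIV f" and d: "\<And>w. w \<in> cube 0 \<epsilon> \<Longrightarrow> norm (f (x - w) - f x) \<le> d"
  shows "norm (conv \<rho> f x - f x) \<le> d"
proof -
  have fc: "continuous_on UNIV (\<lambda>w. f (x - w))"
    by (rule continuous_on_compose2[OF f]) (auto intro!: continuous_intros)
  have "integral (cube 0 \<epsilon>) (\<lambda>w. \<rho> w *\<^sub>R f x) = f x"
    using integral_linear[OF integrable_on_cube[OF \<rho>_cont, of 0 \<epsilon>] bounded_linear_scaleR_left[of "f x"]]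
    by (simp add: o_def \<rho>_integral)
  then have "conv \<rho> f x - f x = integral (cube 0 \<epsilon>) (\<lambda>w. \<rho> w *\<^sub>R f (x - w)) - integral (cube 0 \<epsilon>) (\<lambda>w. \<rho> w *\<^sub>R f x)"
    using conv_eq_integral_cube[where c=0 and r=\<epsilon>, OF \<rho>_supp \<rho>_cont f] by simp
  also have "\<dots> = integral (cube 0 \<epsilon>) (\<lambda>w. \<rho> w *\<^sub>R (f (x - w) - f x))"
    unfolding scaleR_diff_right
    by (intro integral_diff[symmetric] integrable_on_cube continuous_intros \<rho>_cont fc)
  also have "norm \<dots> \<le> integral (cube 0 \<epsilon>) (\<lambda>w. \<rho> w * d)"
    by (rule integral_norm_bound_integral)
      (auto intro!: integrable_on_cube continuous_intros \<rho>_cont fc mult_left_mono d simp: \<rho>_nonneg)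
  also have "\<dots> = d" by (simp add: \<rho>_integral)
  finally show ?thesis .
qed

end

text \<open>The bound \<epsilon> \<le> R/4 keeps the averages at points of the cube of radius R/2
  inside the cube of radius R, and lets \<open>caccioppoli\<close> cover all translations by points
  of the support of \<rho>.\<close>

locale mollified_solution = local_solution E N A D \<gamma> v a Y x\<^sub>0 R e\<^sub>0 + mollifier \<rho> \<epsilon> M
  for E :: "'a::euclidean_space \<Rightarrow> real" and N A D \<gamma> v a Y x\<^sub>0 R e\<^sub>0 and \<rho> :: "'a \<Rightarrow> real" and \<epsilon> M +
  assumes \<epsilon>_le: "\<epsilon> \<le> R / 4"
begin

lemmas \<epsilon> = \<epsilon>_pos \<epsilon>_le

text \<open>\<open>S\<close> and \<open>T\<close> are the derivatives of the mollified \<open>a\<close> and \<open>Y\<close>. Both are bounded by a multiple of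
  \<open>J\<close>, which involves only increments of \<open>a\<close> and is therefore bounded in \<open>L\<^sup>2\<close> uniformly in \<open>\<epsilon>\<close>.\<close>

definition S :: "'a \<Rightarrow> 'a \<Rightarrow> 'a" where "S x h = conv (\<lambda>z. g z \<bullet> h) a x"
definition T :: "'a \<Rightarrow> 'a \<Rightarrow> 'a" where "T x h = conv (\<lambda>z. g z \<bullet> h) Y x"
definition J :: "'a \<Rightarrow> real" where
  "J x = M / \<epsilon> ^ (DIM('a) + 1) * integral (cube 0 \<epsilon>) (\<lambda>w. norm (a (x - w) - a x))"

lemma conv_a_deriv: "(conv \<rho> a has_derivative S x) (at x)"
  using conv_has_derivative[where c=0 and r=\<epsilon>, OF \<rho>_C1 \<rho>_supp a_cont] by (simp add: S_def[abs_def])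

lemma conv_Y_deriv: "(conv \<rho> Y has_derivative T x) (at x)"
  using conv_has_derivative[where c=0 and r=\<epsilon>, OF \<rho>_C1 \<rho>_supp Y_cont] by (simp add: T_def[abs_def])

lemma S_linear: "linear (S x)" and T_linear: "linear (T x)"
  using conv_a_deriv conv_Y_deriv has_derivative_linear by blast+

lemma S_cont: "continuous_on UNIV (\<lambda>x. S x h)"
  unfolding S_def by (rule continuous_conv[where c=0 and r=\<epsilon>]) (auto simp: g_supp intro!: continuous_intros g_cont a_cont)

lemma T_cont: "continuous_on UNIV (\<lambda>x. T x h)"
  unfolding T_def by (rule continuous_conv[where c=0 and r=\<epsilon>]) (auto simp: g_supp intro!: continuous_intros g_cont Y_cont)

text \<open>\<open>S x\<close> is the Hessian of the mollified v.\<close>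

lemma S_sym: "S x h \<bullet> k = S x k \<bullet> h"
  using second_derivative_symmetric[of UNIV x "conv \<rho> v" "conv \<rho> a" S] conv_C1_has_derivative[OF v] conv_a_deriv S_cont by auto

lemma a_diff_cont: "continuous_on UNIV (\<lambda>w. a (x - w) - a x)" and Y_diff_cont: "continuous_on UNIV (\<lambda>w. Y (x - w) - Y x)"
  by (auto intro!: continuous_intros continuous_on_compose2[OF a_cont] continuous_on_compose2[OF Y_cont])

lemma J_nonneg: "0 \<le> J x"
  unfolding J_def using M \<epsilon>
  by (intro mult_nonneg_nonneg integral_nonneg integrable_on_cube continuous_intros a_diff_cont) auto

text \<open>Transfers pointwise smallness to averages: a factor \<kappa> in front of |a(x - w) -
  a(x)| reappears as a factor \<kappa> in front of J. It is used with \<kappa> = 1 for S and with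
  \<kappa> = \<delta> for the linearization errors.\<close>

lemma kernel_bound:
  fixes q :: "'a \<Rightarrow> 'b::euclidean_space"
  assumes "continuous_on UNIV q" "\<And>w. w \<in> cube 0 \<epsilon> \<Longrightarrow> norm (q w) \<le> \<kappa> * norm (a (x - w) - a x)"
  shows "norm (integral (cube 0 \<epsilon>) (\<lambda>w. (g w \<bullet> h) *\<^sub>R q w)) \<le> \<kappa> * J x * norm h"
proof -
  let ?m = "M / \<epsilon> ^ (DIM('a) + 1)"
  have "norm (integral (cube 0 \<epsilon>) (\<lambda>w. (g w \<bullet> h) *\<^sub>R q w)) \<le>
      integral (cube 0 \<epsilon>) (\<lambda>w. (?m * norm h * \<kappa>) * norm (a (x - w) - a x))"
  proof (rule integral_norm_bound_integral)
    fix w :: 'a assume w: "w \<in> cube 0 \<epsilon>"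
    have "norm ((g w \<bullet> h) *\<^sub>R q w) \<le> (?m * norm h) * (\<kappa> * norm (a (x - w) - a x))"
      unfolding norm_scaleR using M \<epsilon>
      by (intro mult_mono assms(2)[OF w] order_trans[OF Cauchy_Schwarz_ineq2] mult_right_mono \<rho>_grad) auto
    then show "norm ((g w \<bullet> h) *\<^sub>R q w) \<le> (?m * norm h * \<kappa>) * norm (a (x - w) - a x)" by (simp add: mult_ac)
  qed (intro integrable_on_cube continuous_intros g_cont assms a_diff_cont)+
  also have "\<dots> = \<kappa> * J x * norm h" by (simp add: J_def)
  finally show ?thesis .
qed

lemma S_bound: "norm (S x h) \<le> J x * norm h"
  using kernel_bound[OF a_diff_cont, of x 1 x h] by (simp add: S_def conv_g_eq[OF a_cont])

text \<open>Cauchy-Schwarz on the cube of measure (2\<epsilon>)^n, exchange of the integrals, and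
  the Caccioppoli bound with |w| \<le> n\<epsilon>. The powers of \<epsilon> are -2(n+1) from the
  kernel, n + n from the two measures and 2 from |w|^2, so they cancel.\<close>

lemma integral_J_square:
  assumes "\<And>z. z \<in> cube 0 (R/4) \<Longrightarrow> integral (cube x\<^sub>0 (R/4)) (\<lambda>x. (norm (a (x - z) - a x))\<^sup>2) \<le> C * (norm z)\<^sup>2"
    and "0 \<le> C"
  shows "integral (cube x\<^sub>0 (R/4)) (\<lambda>x. (J x)\<^sup>2) \<le> M\<^sup>2 * 4 ^ DIM('a) * (real DIM('a))\<^sup>2 * C"
    and "continuous_on UNIV J"
proof -
  let ?n = "DIM('a)"
  show J_cont: "continuous_on UNIV J"
    unfolding J_def[abs_def] cube_def
    by (intro continuous_on_mult continuous_on_const integral_continuous_on_param)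
      (auto simp: split_beta intro!: continuous_intros continuous_on_compose2[OF a_cont])
  have content: "measure lborel (cube (0::'a) \<epsilon>) = (2 * \<epsilon>) ^ ?n"
    using \<epsilon> by (subst cube_def, subst content_cbox') (auto simp: box_ne_empty inner_diff_left)
  define m where "m = (M / \<epsilon> ^ (?n + 1))\<^sup>2 * (2 * \<epsilon>) ^ ?n"
  have m: "m \<ge> 0" using \<epsilon> by (simp add: m_def)
  have J2: "(J x)\<^sup>2 \<le> m * integral (cube 0 \<epsilon>) (\<lambda>w. (norm (a (x - w) - a x))\<^sup>2)" for x
  proof -
    have "continuous_on UNIV (\<lambda>w. norm (a (x - w) - a x))"
      by (intro continuous_intros a_diff_cont)
    from integral_square_le[OF this \<epsilon>(1), of 0]
    show ?thesis unfolding J_def power_mult_distrib m_def content mult.assoc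
      by (intro mult_left_mono) auto
  qed
  have "integral (cube x\<^sub>0 (R/4)) (\<lambda>x. (J x)\<^sup>2) \<le>
      integral (cube x\<^sub>0 (R/4)) (\<lambda>x. m * integral (cube 0 \<epsilon>) (\<lambda>w. (norm (a (x - w) - a x))\<^sup>2))"
  proof (rule integral_le)
    have "continuous_on UNIV (\<lambda>x. integral (cube 0 \<epsilon>) (\<lambda>w. (norm (a (x - w) - a x))\<^sup>2))"
      unfolding cube_def by (intro integral_continuous_on_param)
        (auto simp: split_beta intro!: continuous_intros continuous_on_compose2[OF a_cont])
    then show "(\<lambda>x. m * integral (cube 0 \<epsilon>) (\<lambda>w. (norm (a (x - w) - a x))\<^sup>2)) integrable_on cube x\<^sub>0 (R/4)"
      by (intro integrable_on_cube continuous_intros)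
  qed (intro integrable_on_cube continuous_intros J_cont J2)+
  also have "\<dots> = m * integral (cube 0 \<epsilon>) (\<lambda>w. integral (cube x\<^sub>0 (R/4)) (\<lambda>x. (norm (a (x - w) - a x))\<^sup>2))"
    unfolding integral_mult_right cube_def
    by (subst integral_swap_continuous) (auto simp: split_beta intro!: continuous_intros continuous_on_compose2[OF a_cont])
  also have "\<dots> \<le> m * integral (cube 0 \<epsilon>) (\<lambda>w::'a. C * (real ?n * \<epsilon>)\<^sup>2)"
  proof (intro mult_left_mono integral_le m)
    have "continuous_on UNIV (\<lambda>w. integral (cube x\<^sub>0 (R/4)) (\<lambda>x. (norm (a (x - w) - a x))\<^sup>2))"
      unfolding cube_def by (intro integral_continuous_on_param) (auto simp: split_beta intro!: continuous_intros continuous_on_compose2[OF a_cont])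
    then show "(\<lambda>w. integral (cube x\<^sub>0 (R/4)) (\<lambda>x. (norm (a (x - w) - a x))\<^sup>2)) integrable_on cube 0 \<epsilon>"
      by (rule integrable_on_cube)
    fix w :: 'a assume w: "w \<in> cube 0 \<epsilon>"
    have "norm w \<le> real ?n * \<epsilon>" using subsetD[OF cube_subset_cball w] by simp
    then have "C * (norm w)\<^sup>2 \<le> C * (real ?n * \<epsilon>)\<^sup>2"
      using assms(2) by (intro mult_left_mono power_mono) auto
    moreover have "w \<in> cube 0 (R/4)" using w cube_mono[OF \<epsilon>(2)] by blast
    ultimately show "integral (cube x\<^sub>0 (R/4)) (\<lambda>x. (norm (a (x - w) - a x))\<^sup>2) \<le> C * (real ?n * \<epsilon>)\<^sup>2"
      using assms(1) by (meson order_trans)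
  qed (intro integrable_on_cube continuous_intros)
  also have "\<dots> = m * ((2 * \<epsilon>) ^ ?n * (C * (real ?n * \<epsilon>)\<^sup>2))"
    by (simp only: integral_cube_const content)
  also have "\<dots> = M\<^sup>2 * 4 ^ ?n * (real ?n)\<^sup>2 * C"
  proof -
    have "(2 * \<epsilon>) ^ ?n * (2 * \<epsilon>) ^ ?n = 4 ^ ?n * (\<epsilon> ^ ?n)\<^sup>2"
    proof -
      have "(4::real) ^ ?n = 2 ^ ?n * 2 ^ ?n" by (simp flip: power_mult_distrib)
      then show ?thesis by (simp add: power_mult_distrib power2_eq_square)
    qed
    moreover have "m * ((2 * \<epsilon>) ^ ?n * (C * (real ?n * \<epsilon>)\<^sup>2)) =
      (M / \<epsilon> ^ (?n + 1))\<^sup>2 * ((2 * \<epsilon>) ^ ?n * (2 * \<epsilon>) ^ ?n) * (C * (real ?n * \<epsilon>)\<^sup>2)"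
      unfolding m_def by (simp only: mult.assoc)
    ultimately have "m * ((2 * \<epsilon>) ^ ?n * (C * (real ?n * \<epsilon>)\<^sup>2)) =
      (M / \<epsilon> ^ (?n + 1))\<^sup>2 * (4 ^ ?n * (\<epsilon> ^ ?n)\<^sup>2) * (C * (real ?n * \<epsilon>)\<^sup>2)"
      by (simp only:)
    also have "\<dots> = M\<^sup>2 * 4 ^ ?n * (real ?n)\<^sup>2 * C"
    proof -
      have "(M / (p * e))\<^sup>2 * (q * p\<^sup>2) * (C * (d * e)\<^sup>2) = M\<^sup>2 * q * d\<^sup>2 * C"
        if "p \<noteq> 0" "e \<noteq> 0" for p q d e :: real
        using that by (simp add: power2_eq_square)
      from this[of "\<epsilon> ^ ?n" \<epsilon> "4 ^ ?n" "real ?n"] show ?thesis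
        using \<epsilon>(1) by (simp only: power_add power_one_right) simp
    qed
    finally show ?thesis .
  qed
  finally show "integral (cube x\<^sub>0 (R/4)) (\<lambda>x. (J x)\<^sup>2) \<le> M\<^sup>2 * 4 ^ ?n * (real ?n)\<^sup>2 * C" .
qed

text \<open>Test the equation with y \<mapsto> k(x - y). A general kernel is allowed because the
  lemma is applied to a directional derivative of \<rho>: then it says that derivatives of the
  mollified Y are divergence-free.\<close>

lemma divergence_conv_Y:
  assumes "C1_grad k k'" "\<And>z. z \<notin> cube 0 \<epsilon> \<Longrightarrow> k z = 0" "x \<in> cube x\<^sub>0 (R/2)"
  shows "(\<Sum>b\<in>Basis. conv (\<lambda>z. k' z \<bullet> b) Y x \<bullet> b) = 0"
proof -
  have s: "x - y \<notin> cube 0 \<epsilon>" if "y \<notin> cube x \<epsilon>" for y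
    using that cube_uminus[of "x - y" \<epsilon>] by (simp add: cube_0_diff)
  have s': "k (x - y) = 0" "k' (x - y) = 0" if "y \<notin> cube x \<epsilon>" for y
    using assms(2) C1_grad_eq_0_outside[OF assms(1,2)] s[OF that] by auto
  have sub: "cube x \<epsilon> \<subseteq> cube x\<^sub>0 R"
  proof
    fix y assume "y \<in> cube x \<epsilon>"
    then have "x + (y - x) \<in> cube x\<^sub>0 (R/2 + \<epsilon>)" by (intro cube_add assms) (simp add: cube_0_diff)
    then show "y \<in> cube x\<^sub>0 R" using cube_mono[of "R/2 + \<epsilon>" R x\<^sub>0] \<epsilon> R by auto
  qed
  have k'c: "continuous_on UNIV (\<lambda>y. k' (x - y))"
    by (rule continuous_on_compose2[OF C1_grad_D(2)[OF assms(1)]]) (auto intro!: continuous_intros)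
  have i: "(\<lambda>y. (k' (x - y) \<bullet> b) *\<^sub>R Y y) integrable_on UNIV" for b
    by (rule integrable_on_UNIV[of x \<epsilon>]) (auto simp: s' intro!: continuous_intros k'c Y_cont)
  have "conv (\<lambda>z. k' z \<bullet> b) Y x \<bullet> b = integral UNIV (\<lambda>y. ((k' (x - y) \<bullet> b) *\<^sub>R Y y) \<bullet> b)" for b
    using integral_linear[OF i bounded_linear_inner_left[of b]] by (simp add: conv_def o_def)
  then have "(\<Sum>b\<in>Basis. conv (\<lambda>z. k' z \<bullet> b) Y x \<bullet> b) = (\<Sum>b\<in>Basis. integral UNIV (\<lambda>y. ((k' (x - y) \<bullet> b) *\<^sub>R Y y) \<bullet> b))"
    by simp
  also have "\<dots> = integral UNIV (\<lambda>y. \<Sum>b\<in>Basis. ((k' (x - y) \<bullet> b) *\<^sub>R Y y) \<bullet> b)"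
    using integrable_linear[OF i bounded_linear_inner_left] by (intro integral_sum[symmetric]) (auto simp: o_def)
  also have "\<dots> = integral UNIV (\<lambda>y. - (Y y \<bullet> - k' (x - y)))"
  proof -
    have "(\<Sum>b\<in>Basis. ((k' (x - y) \<bullet> b) *\<^sub>R Y y) \<bullet> b) = Y y \<bullet> k' (x - y)" for y
      by (subst euclidean_inner[of "Y y" "k' (x - y)"]) (simp add: mult.commute)
    then show ?thesis by simp
  qed
  also have "\<dots> = - integral UNIV (\<lambda>y. Y y \<bullet> - k' (x - y))" by (rule integral_neg)
  also have "integral UNIV (\<lambda>y. Y y \<bullet> - k' (x - y)) = 0"
    by (rule weak[OF C1_grad_reflect[OF assms(1)]]) (use s' sub in auto)
  finally show ?thesis by simp
qed

end

context mollified_solution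
begin

lemma cont_conv_Y: "continuous_on UNIV (conv \<rho> Y)" and cont_conv_a: "continuous_on UNIV (conv \<rho> a)"
  by (rule continuous_conv[where c=0 and r=\<epsilon>], rule \<rho>_supp, assumption, rule \<rho>_cont, rule Y_cont a_cont)+

text \<open>Integrate the divergence of the field \<open>\<eta> T(Y\<^sub>\<epsilon>)\<close>, \<open>Y\<^sub>\<epsilon>\<close> being the mollified \<open>Y\<close>. The term
  containing second derivatives drops out because a derivative of \<open>Y\<^sub>\<epsilon>\<close> is again divergence-free.\<close>

lemma trace_identity:
  assumes \<eta>: "C1_grad \<eta> \<eta>'" "\<And>x. x \<notin> cube x\<^sub>0 (R/4) \<Longrightarrow> \<eta> x = 0"
  shows "integral (cube x\<^sub>0 (R/4)) (\<lambda>x. \<eta>' x \<bullet> T x (conv \<rho> Y x) + \<eta> x * (\<Sum>b\<in>Basis. T x (T x b) \<bullet> b)) = 0"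
    and "continuous_on UNIV (\<lambda>x. \<eta>' x \<bullet> T x (conv \<rho> Y x) + \<eta> x * (\<Sum>b\<in>Basis. T x (T x b) \<bullet> b))"
proof -
  define k where "k c = vgrad (\<lambda>z. g z \<bullet> c)" for c
  have k: "C1_grad (\<lambda>z. g z \<bullet> c) (k c)" for c unfolding k_def by (rule g_C1)
  have ks: "k c z = 0" if "z \<notin> cube 0 \<epsilon>" for z c
    by (rule C1_grad_eq_0_outside[OF k _ that]) (simp add: g_supp)
  \<comment> \<open>The second derivative of the mollified Y in the directions c and h, both
    derivatives falling on the kernel.\<close>
  define T2 where "T2 c x h = conv (\<lambda>z. k c z \<bullet> h) Y x" for c x h
  have T': "((\<lambda>x. T x c) has_derivative T2 c x) (at x)" for c x
    unfolding T_def T2_def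
    by (rule conv_has_derivative[where c=0 and r=\<epsilon>, OF k _ Y_cont]) (simp add: g_supp)
  have T2c: "continuous_on UNIV (\<lambda>x. T2 c x h)" for c h
    unfolding T2_def
    by (rule continuous_conv[where c=0 and r=\<epsilon>]) (auto simp: ks intro!: continuous_intros C1_grad_D(2)[OF k] Y_cont)
  define F where "F x = T x (conv \<rho> Y x)" for x
  \<comment> \<open>Both the map T x and its argument vary with x; expanding the argument in the
    basis brings this under the product rule.\<close>
  have rep: "T x h = (\<Sum>c\<in>Basis. (h \<bullet> c) *\<^sub>R T x c)" for x h
  proof -
    have "T x h = T x (\<Sum>c\<in>Basis. (h \<bullet> c) *\<^sub>R c)" by (simp add: euclidean_representation)
    then show ?thesis by (simp add: linear_sum[OF T_linear] linear_cmul[OF T_linear])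
  qed
  define DF where "DF x h = (\<Sum>c\<in>Basis. (conv \<rho> Y x \<bullet> c) *\<^sub>R T2 c x h) + T x (T x h)" for x h
  have F': "(F has_derivative DF x) (at x)" for x
  proof -
    have "((\<lambda>x. \<Sum>c\<in>Basis. (conv \<rho> Y x \<bullet> c) *\<^sub>R T x c) has_derivative
      (\<lambda>h. \<Sum>c\<in>Basis. (conv \<rho> Y x \<bullet> c) *\<^sub>R T2 c x h + (T x h \<bullet> c) *\<^sub>R T x c)) (at x)"
      by (intro has_derivative_sum has_derivative_scaleR has_derivative_inner_left conv_Y_deriv T')
    then show ?thesis unfolding F_def[abs_def] DF_def[abs_def]
      by (simp add: rep[of _ "conv \<rho> Y _"] rep[of x "T x _"] sum.distrib)
  qed
  have Fc: "continuous_on UNIV F"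
    by (rule has_derivative_continuous_on[of _ F DF]) (auto intro: F')
  have Tc: "continuous_on UNIV (\<lambda>x. T x (f x))" if "continuous_on UNIV f" for f
    unfolding rep[of _ "f _"] by (intro continuous_intros that T_cont)
  have DFc: "continuous_on UNIV (\<lambda>x. DF x h)" for h
    unfolding DF_def by (intro continuous_intros Tc T_cont T2c cont_conv_Y)
  define G where "G b x h = (\<eta>' x \<bullet> h) * (F x \<bullet> b) + \<eta> x * (DF x h \<bullet> b)" for b x h
  have Gc: "continuous_on UNIV (\<lambda>x. G b x h)" for b h
    unfolding G_def by (intro continuous_intros DFc Fc C1_grad_D(2,3)[OF \<eta>(1)])
  have G': "((\<lambda>x. \<eta> x * (F x \<bullet> b)) has_derivative G b x) (at x)" for b x
    by (rule has_derivative_eq_rhs[OF has_derivative_mult[OF C1_grad_D(1)[OF \<eta>(1)] has_derivative_inner_left[OF F']]])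
      (auto simp: G_def)
  note C = C1_gradI[of "\<lambda>x. \<eta> x * (F x \<bullet> b)" "G b" for b, OF G' Gc]
  have "integral (cube x\<^sub>0 (R/4)) (\<lambda>x. G b x b) = 0" for b
  proof -
    have "integral UNIV (\<lambda>x. G b x b) = 0"
      using integral_grad_eq_0[OF C(1), of x\<^sub>0 "R/4" b b] \<eta>(2) by (simp add: C(2))
    moreover have "G b x b = 0" if "x \<notin> cube x\<^sub>0 (R/4)" for x
      using \<eta>(2)[OF that] C1_grad_eq_0_outside[OF \<eta> that] by (simp add: G_def)
    ultimately show ?thesis using integral_UNIV_eq[of "cube x\<^sub>0 (R/4)" "\<lambda>x. G b x b"] by simp
  qed
  then have "integral (cube x\<^sub>0 (R/4)) (\<lambda>x. \<Sum>b\<in>Basis. G b x b) = 0"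
    by (subst integral_sum) (auto intro!: integrable_on_cube Gc)
  moreover have "(\<Sum>b\<in>Basis. G b x b) = \<eta>' x \<bullet> T x (conv \<rho> Y x) + \<eta> x * (\<Sum>b\<in>Basis. T x (T x b) \<bullet> b)"
    if x: "x \<in> cube x\<^sub>0 (R/4)" for x
  proof -
    have x': "x \<in> cube x\<^sub>0 (R/2)" using x cube_mono[of "R/4" "R/2" x\<^sub>0] R by auto
    \<comment> \<open>This is the term Y \<bullet> \<nabla>(div Y) for the mollified Y; summing over
      b first exposes the divergence of its c-derivative.\<close>
    have "(\<Sum>b\<in>Basis. \<Sum>c\<in>Basis. (conv \<rho> Y x \<bullet> c) * (T2 c x b \<bullet> b)) =
      (\<Sum>c\<in>Basis. (conv \<rho> Y x \<bullet> c) * (\<Sum>b\<in>Basis. T2 c x b \<bullet> b))"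
      by (subst sum.swap) (simp add: sum_distrib_left)
    also have "\<dots> = 0"
    proof (rule sum.neutral, rule ballI)
      fix c
      have "(\<Sum>b\<in>Basis. T2 c x b \<bullet> b) = 0"
        unfolding T2_def by (rule divergence_conv_Y[OF k _ x']) (simp add: g_supp)
      then show "(conv \<rho> Y x \<bullet> c) * (\<Sum>b\<in>Basis. T2 c x b \<bullet> b) = 0" by simp
    qed
    finally have "(\<Sum>b\<in>Basis. DF x b \<bullet> b) = (\<Sum>b\<in>Basis. T x (T x b) \<bullet> b)"
      by (simp add: DF_def inner_add_left inner_sum_left sum.distrib)
    moreover have "(\<Sum>b\<in>Basis. (\<eta>' x \<bullet> b) * (F x \<bullet> b)) = \<eta>' x \<bullet> F x"
      by (rule euclidean_inner[symmetric])
    ultimately show ?thesis by (simp add: G_def sum.distrib sum_distrib_left[symmetric] F_def)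
  qed
  ultimately show "integral (cube x\<^sub>0 (R/4)) (\<lambda>x. \<eta>' x \<bullet> T x (conv \<rho> Y x) + \<eta> x * (\<Sum>b\<in>Basis. T x (T x b) \<bullet> b)) = 0"
    by (simp cong: integral_cong)
  show "continuous_on UNIV (\<lambda>x. \<eta>' x \<bullet> T x (conv \<rho> Y x) + \<eta> x * (\<Sum>b\<in>Basis. T x (T x b) \<bullet> b))"
    by (intro continuous_intros Tc T_cont cont_conv_Y C1_grad_D(2,3)[OF \<eta>(1)])
qed

text \<open>Two errors remain after the trace identity. Replacing T by AS costs a multiple of
  \<delta> J^2. The cutoff term contains T applied to the mollified Y, which is close to ASY; since
  |SY| \<le> \<delta> J, it is of order \<delta> J. Both are dominated by a multiple of \<delta> (1
  + 2 J^2), whose integral is bounded uniformly in \<epsilon>.\<close>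

lemma integral_S_square:
  assumes \<eta>: "C1_grad \<eta> \<eta>'" "\<And>x. x \<notin> cube x\<^sub>0 (R/4) \<Longrightarrow> \<eta> x = 0" "\<And>x. 0 \<le> \<eta> x"
    and \<Lambda>: "0 \<le> \<Lambda>" "\<And>\<xi> h. \<xi> \<in> D \<Longrightarrow> norm (A \<xi> h) \<le> \<Lambda> * norm h"
    and H: "\<And>x. x \<in> cube x\<^sub>0 (R/4) \<Longrightarrow> \<eta> x \<le> H" "\<And>x. x \<in> cube x\<^sub>0 (R/4) \<Longrightarrow> norm (\<eta>' x) \<le> H"
      "\<And>x. x \<in> cube x\<^sub>0 (R/4) \<Longrightarrow> norm (Y x) \<le> L"
    and \<delta>: "0 < \<delta>" "\<delta> \<le> 1"
    and close: "\<And>x w. x \<in> cube x\<^sub>0 (R/4) \<Longrightarrow> w \<in> cube 0 \<epsilon> \<Longrightarrow>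
        norm (Y (x - w) - Y x - A (a x) (a (x - w) - a x)) \<le> \<delta> * norm (a (x - w) - a x) \<and>
        \<bar>Y x \<bullet> (a (x - w) - a x)\<bar> \<le> \<delta> * norm (a (x - w) - a x) \<and> norm (Y (x - w) - Y x) \<le> \<delta>"
    and J: "continuous_on UNIV J" "integral (cube x\<^sub>0 (R/4)) (\<lambda>x. (J x)\<^sup>2) \<le> C"
  shows "\<gamma>\<^sup>2 * integral (cube x\<^sub>0 (R/4)) (\<lambda>x. \<eta> x * (\<Sum>b\<in>Basis. S x b \<bullet> S x b)) \<le>
    \<delta> * ((H * (real DIM('a) * (2 * \<Lambda> + 1)) + H * (2 * \<Lambda> + 1 + L)) * (measure lborel (cube x\<^sub>0 (R/4)) + 2 * C))"
proof -
  let ?Q = "cube x\<^sub>0 (R/4)" and ?n = "real DIM('a)"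
  define K where "K = H * (?n * (2 * \<Lambda> + 1)) + H * (2 * \<Lambda> + 1 + L)"
  define f where "f x = \<eta>' x \<bullet> T x (conv \<rho> Y x) + \<eta> x * (\<Sum>b\<in>Basis. T x (T x b) \<bullet> b)" for x
  have Qne: "x\<^sub>0 \<in> ?Q" using R by (simp add: center_in_cube)
  have H0: "0 \<le> H" "0 \<le> L" using H(2,3)[OF Qne] norm_ge_zero order_trans by blast+
  have K0: "0 \<le> K" using H0 \<Lambda>(1) by (simp add: K_def)
  have pw: "\<gamma>\<^sup>2 * (\<eta> x * (\<Sum>b\<in>Basis. S x b \<bullet> S x b)) \<le> f x + \<delta> * K * (1 + 2 * (J x)\<^sup>2)" if x: "x \<in> ?Q" for x
  proof -
    have aD: "a x \<in> D" using a_D x cube_mono[of "R/4" R x\<^sub>0] R by auto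
    have Abl: "bounded_linear (A (a x))" using N[OF aD] has_derivative_bounded_linear by blast
    have J0: "0 \<le> J x" by (rule J_nonneg)
    \<comment> \<open>Both T h and A(S h) average increments against the same kernel, so their
      difference averages the linearization error of N.\<close>
    have TS: "norm (T x h - A (a x) (S x h)) \<le> \<delta> * J x * norm h" for h
    proof -
      have i: "(\<lambda>w. (g w \<bullet> h) *\<^sub>R (a (x - w) - a x)) integrable_on cube 0 \<epsilon>"
        by (intro integrable_on_cube continuous_intros g_cont a_diff_cont)
      have Ac: "continuous_on UNIV (\<lambda>w. A (a x) (a (x - w) - a x))"
        by (rule linear_continuous_on_compose[OF a_diff_cont bounded_linear.linear[OF Abl]])
      have "A (a x) (S x h) = integral (cube 0 \<epsilon>) (\<lambda>w. (g w \<bullet> h) *\<^sub>R A (a x) (a (x - w) - a x))"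
        unfolding S_def conv_g_eq[OF a_cont] integral_linear[OF i Abl, symmetric]
        by (simp add: o_def linear_cmul[OF A_linear[OF aD]])
      then have "T x h - A (a x) (S x h) =
        integral (cube 0 \<epsilon>) (\<lambda>w. (g w \<bullet> h) *\<^sub>R (Y (x - w) - Y x - A (a x) (a (x - w) - a x)))"
        unfolding T_def conv_g_eq[OF Y_cont] scaleR_diff_right[of _ "Y (x - _) - Y x"]
        by (subst integral_diff) (auto intro!: integrable_on_cube continuous_intros g_cont Y_diff_cont Ac)
      also have "norm \<dots> \<le> \<delta> * J x * norm h"
        by (rule kernel_bound) (use close x in \<open>auto intro!: continuous_intros Y_diff_cont Ac\<close>)
      finally show ?thesis .
    qed
    \<comment> \<open>By symmetry |SY|^2 = S(SY) \<bullet> Y, and S h \<bullet> Y averages the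
      products of Y with increments of a, which are small by the second part of
      \<open>close\<close>.\<close>
    have SY: "norm (S x (Y x)) \<le> \<delta> * J x"
    proof -
      have i: "(\<lambda>w. (g w \<bullet> h) *\<^sub>R (a (x - w) - a x)) integrable_on cube 0 \<epsilon>" for h
        by (intro integrable_on_cube continuous_intros g_cont a_diff_cont)
      have "\<bar>S x h \<bullet> Y x\<bar> \<le> \<delta> * J x * norm h" for h
      proof -
        have "S x h \<bullet> Y x = integral (cube 0 \<epsilon>) (\<lambda>w. (g w \<bullet> h) *\<^sub>R ((a (x - w) - a x) \<bullet> Y x))"
          unfolding S_def conv_g_eq[OF a_cont]
          using integral_linear[OF i bounded_linear_inner_left[of "Y x"]] by (simp add: o_def)
        also have "norm \<dots> \<le> \<delta> * J x * norm h"
          by (rule kernel_bound) (use close[OF x] in \<open>auto intro!: continuous_intros a_diff_cont simp: inner_commute\<close>)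
        finally show ?thesis by simp
      qed
      from this[of "S x (Y x)"] have "norm (S x (Y x)) * norm (S x (Y x)) \<le> (\<delta> * J x) * norm (S x (Y x))"
        using S_sym[of x "S x (Y x)" "Y x"] by (simp add: power2_norm_eq_inner[symmetric] power2_eq_square)
      then show ?thesis
        using J0 \<delta>(1) by (cases "S x (Y x) = 0") auto
    qed
    have Yc: "norm (conv \<rho> Y x - Y x) \<le> \<delta>"
      by (rule conv_close[OF Y_cont]) (use close[OF x] in auto)
    have Tb: "norm (T x h) \<le> (\<Lambda> + \<delta>) * J x * norm h" for h
    proof -
      have "norm (A (a x) (S x h)) \<le> \<Lambda> * (J x * norm h)"
        using \<Lambda>(2)[OF aD, of "S x h"] mult_left_mono[OF S_bound[of x h] \<Lambda>(1)] by linarith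
      then show ?thesis using norm_triangle_ineq[of "A (a x) (S x h)" "T x h - A (a x) (S x h)"] TS[of h]
        by (simp add: algebra_simps)
    qed
    \<comment> \<open>Three errors add up: Y against its mollification, T against AS, and the size
      of SY.\<close>
    have TY: "norm (T x (conv \<rho> Y x)) \<le> \<delta> * J x * (2 * \<Lambda> + 1 + L)"
    proof -
      have "T x (conv \<rho> Y x) = T x (conv \<rho> Y x - Y x) + (T x (Y x) - A (a x) (S x (Y x))) + A (a x) (S x (Y x))"
        by (simp add: linear_diff[OF T_linear])
      also have "norm \<dots> \<le> (\<Lambda> + \<delta>) * J x * \<delta> + \<delta> * J x * L + \<Lambda> * (\<delta> * J x)"
      proof (intro order_trans[OF norm_triangle_ineq] add_mono)
        show "norm (T x (conv \<rho> Y x - Y x)) \<le> (\<Lambda> + \<delta>) * J x * \<delta>"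
          by (rule order_trans[OF Tb mult_left_mono[OF Yc]]) (use \<Lambda>(1) \<delta> J0 in auto)
        show "norm (T x (Y x) - A (a x) (S x (Y x))) \<le> \<delta> * J x * L"
          by (rule order_trans[OF TS mult_left_mono[OF H(3)[OF x]]]) (use \<delta> J0 in auto)
        show "norm (A (a x) (S x (Y x))) \<le> \<Lambda> * (\<delta> * J x)"
          using \<Lambda>(2)[OF aD, of "S x (Y x)"] mult_left_mono[OF SY \<Lambda>(1)] by linarith
      qed
      also have "\<dots> = \<delta> * J x * (2 * \<Lambda> + \<delta> + L)" by (simp add: algebra_simps)
      also have "\<dots> \<le> \<delta> * J x * (2 * \<Lambda> + 1 + L)" using \<delta> J0 by (intro mult_left_mono) auto
      finally show ?thesis .
    qed
    have c1: "- (\<eta>' x \<bullet> T x (conv \<rho> Y x)) \<le> \<delta> * (H * (2 * \<Lambda> + 1 + L)) * J x"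
    proof -
      have "- (\<eta>' x \<bullet> T x (conv \<rho> Y x)) \<le> norm (\<eta>' x) * norm (T x (conv \<rho> Y x))"
        using Cauchy_Schwarz_ineq2[of "\<eta>' x" "T x (conv \<rho> Y x)"] by linarith
      also have "\<dots> \<le> H * (\<delta> * J x * (2 * \<Lambda> + 1 + L))" using H(2)[OF x] TY H0 by (intro mult_mono) auto
      finally show ?thesis by (simp add: mult_ac)
    qed
    have "\<gamma>\<^sup>2 * (\<Sum>b\<in>Basis. S x b \<bullet> S x b) \<le>
        (\<Sum>b\<in>Basis. T x (T x b) \<bullet> b) + ?n * (2 * \<Lambda> + \<delta>) * \<delta> * (J x)\<^sup>2"
      by (rule trace_square_perturb[of "A (a x)"])
        (use A_linear A_sym A_ge aD gamma S_linear T_linear S_sym \<Lambda> S_bound TS J0 \<delta> in auto)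
    also have "\<dots> \<le> (\<Sum>b\<in>Basis. T x (T x b) \<bullet> b) + \<delta> * (?n * (2 * \<Lambda> + 1)) * (J x)\<^sup>2"
    proof -
      have "?n * (2 * \<Lambda> + \<delta>) * \<delta> * (J x)\<^sup>2 \<le> ?n * (2 * \<Lambda> + 1) * \<delta> * (J x)\<^sup>2"
        using \<delta> \<Lambda>(1) by (intro mult_right_mono mult_left_mono) auto
      then show ?thesis by (simp add: mult_ac)
    qed
    finally have c2: "\<gamma>\<^sup>2 * (\<eta> x * (\<Sum>b\<in>Basis. S x b \<bullet> S x b)) \<le>
        \<eta> x * (\<Sum>b\<in>Basis. T x (T x b) \<bullet> b) + \<eta> x * (\<delta> * (?n * (2 * \<Lambda> + 1)) * (J x)\<^sup>2)"
      using mult_left_mono[OF _ \<eta>(3)[of x]] by (fastforce simp: algebra_simps)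
    have c3: "\<eta> x * (\<delta> * (?n * (2 * \<Lambda> + 1)) * (J x)\<^sup>2) \<le> H * (\<delta> * (?n * (2 * \<Lambda> + 1)) * (J x)\<^sup>2)"
      using H(1)[OF x] \<delta> \<Lambda>(1) by (intro mult_right_mono) auto
    have J1: "J x \<le> 1 + (J x)\<^sup>2"
    proof -
      have "0 \<le> (J x - 1/2)\<^sup>2" by simp
      then show ?thesis by (simp add: power2_eq_square algebra_simps)
    qed
    have c4: "\<delta> * (H * (2 * \<Lambda> + 1 + L)) * J x \<le> \<delta> * (H * (2 * \<Lambda> + 1 + L)) * (1 + 2 * (J x)\<^sup>2)"
      using J1 \<delta> H0 \<Lambda>(1) by (intro mult_left_mono) (auto intro: order_trans[OF J1])
    have c5: "H * (\<delta> * (?n * (2 * \<Lambda> + 1)) * (J x)\<^sup>2) \<le> \<delta> * (H * (?n * (2 * \<Lambda> + 1))) * (1 + 2 * (J x)\<^sup>2)"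
    proof -
      have "\<delta> * (H * (?n * (2 * \<Lambda> + 1))) * (J x)\<^sup>2 \<le> \<delta> * (H * (?n * (2 * \<Lambda> + 1))) * (1 + 2 * (J x)\<^sup>2)"
        using \<delta> H0 \<Lambda>(1) by (intro mult_left_mono) auto
      then show ?thesis by (simp add: mult_ac)
    qed
    have "\<delta> * K * (1 + 2 * (J x)\<^sup>2) =
      \<delta> * (H * (?n * (2 * \<Lambda> + 1))) * (1 + 2 * (J x)\<^sup>2) + \<delta> * (H * (2 * \<Lambda> + 1 + L)) * (1 + 2 * (J x)\<^sup>2)"
      by (simp add: K_def distrib_left distrib_right)
    then show ?thesis unfolding f_def using c1 c2 c3 c4 c5 by linarith
  qed
  have fc: "continuous_on UNIV f" unfolding f_def by (rule trace_identity(2)[OF \<eta>(1,2)])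
  have "\<gamma>\<^sup>2 * integral ?Q (\<lambda>x. \<eta> x * (\<Sum>b\<in>Basis. S x b \<bullet> S x b)) =
      integral ?Q (\<lambda>x. \<gamma>\<^sup>2 * (\<eta> x * (\<Sum>b\<in>Basis. S x b \<bullet> S x b)))" by simp
  also have "\<dots> \<le> integral ?Q (\<lambda>x. f x + \<delta> * K * (1 + 2 * (J x)\<^sup>2))"
    by (intro integral_le integrable_on_cube continuous_intros fc J(1) S_cont C1_grad_D(3)[OF \<eta>(1)] pw)
  also have "\<dots> = integral ?Q f + integral ?Q (\<lambda>x. \<delta> * K * (1 + 2 * (J x)\<^sup>2))"
    by (intro integral_add integrable_on_cube continuous_intros fc J(1))
  also have "integral ?Q f = 0" unfolding f_def by (rule trace_identity(1)[OF \<eta>(1,2)])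
  also have "integral ?Q (\<lambda>x. \<delta> * K * (1 + 2 * (J x)\<^sup>2)) = \<delta> * K * (integral ?Q (\<lambda>x. 1 + 2 * (J x)\<^sup>2))"
    by simp
  also have "integral ?Q (\<lambda>x. 1 + 2 * (J x)\<^sup>2) = integral ?Q (\<lambda>x. 1) + integral ?Q (\<lambda>x. 2 * (J x)\<^sup>2)"
    by (intro integral_add integrable_on_cube continuous_intros J(1))
  also have "\<dots> = measure lborel ?Q + 2 * integral ?Q (\<lambda>x. (J x)\<^sup>2)"
    by (simp only: integral_cube_const integral_mult_right mult_1_right)
  finally have "\<gamma>\<^sup>2 * integral ?Q (\<lambda>x. \<eta> x * (\<Sum>b\<in>Basis. S x b \<bullet> S x b)) \<le>
    \<delta> * K * (measure lborel ?Q + 2 * integral ?Q (\<lambda>x. (J x)\<^sup>2))" by simp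
  also have "\<dots> \<le> \<delta> * K * (measure lborel ?Q + 2 * C)"
    using J(2) K0 \<delta> by (intro mult_left_mono) auto
  finally show ?thesis by (simp only: K_def mult.assoc)
qed

end

context local_solution
begin

text \<open>The eikonal equation enters here: E(a(x - w)) = E(a x), so the linearization of E leaves
  nothing but its error as a bound for |Y x \<bullet> (a(x - w) - a x)|.\<close>

lemma uniform_closeness:
  assumes "\<delta> > 0"
  shows "\<exists>\<epsilon>>0. \<epsilon> \<le> R/16 \<and> (\<forall>x\<in>cube x\<^sub>0 (R/4). \<forall>w\<in>cube 0 \<epsilon>.
        norm (Y (x - w) - Y x - A (a x) (a (x - w) - a x)) \<le> \<delta> * norm (a (x - w) - a x) \<and>
        \<bar>Y x \<bullet> (a (x - w) - a x)\<bar> \<le> \<delta> * norm (a (x - w) - a x) \<and>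
        norm (Y (x - w) - Y x) \<le> \<delta> \<and> norm (a (x - w) - a x) \<le> \<delta>)"
proof -
  obtain s where s: "s > 0" "\<And>\<xi> \<eta>. \<xi> \<in> D \<Longrightarrow> \<eta> \<in> D \<Longrightarrow> norm (\<eta> - \<xi>) < s \<Longrightarrow>
    norm (N \<eta> - N \<xi> - A \<xi> (\<eta> - \<xi>)) \<le> \<delta> * norm (\<eta> - \<xi>) \<and>
    \<bar>E \<eta> - E \<xi> - N \<xi> \<bullet> (\<eta> - \<xi>)\<bar> \<le> \<delta> * norm (\<eta> - \<xi>)"
    using linearization[OF assms] by blast
  have uc: "\<exists>t>0. \<forall>x\<in>cube x\<^sub>0 R. \<forall>y\<in>cube x\<^sub>0 R. dist y x < t \<longrightarrow> dist (f y) (f x) < d"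
    if "continuous_on UNIV f" "d > 0" for f :: "'a \<Rightarrow> 'a" and d
    using compact_uniformly_continuous[OF continuous_on_subset[OF that(1)] compact_cube] that(2)
    unfolding uniformly_continuous_on_def by blast
  obtain t1 where t1: "t1 > 0" "\<And>x y. x \<in> cube x\<^sub>0 R \<Longrightarrow> y \<in> cube x\<^sub>0 R \<Longrightarrow> dist y x < t1 \<Longrightarrow> dist (a y) (a x) < min s \<delta>"
    using uc[OF a_cont, of "min s \<delta>"] s(1) assms by auto
  obtain t2 where t2: "t2 > 0" "\<And>x y. x \<in> cube x\<^sub>0 R \<Longrightarrow> y \<in> cube x\<^sub>0 R \<Longrightarrow> dist y x < t2 \<Longrightarrow> dist (Y y) (Y x) < \<delta>"
    using uc[OF Y_cont assms] by auto
  define \<epsilon> where "\<epsilon> = min (R/16) (min t1 t2 / (2 * real DIM('a)))"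
  have \<epsilon>: "\<epsilon> > 0" "\<epsilon> \<le> R/16" using R t1(1) t2(1) by (auto simp: \<epsilon>_def)
  have "norm (Y (x - w) - Y x - A (a x) (a (x - w) - a x)) \<le> \<delta> * norm (a (x - w) - a x) \<and>
        \<bar>Y x \<bullet> (a (x - w) - a x)\<bar> \<le> \<delta> * norm (a (x - w) - a x) \<and>
        norm (Y (x - w) - Y x) \<le> \<delta> \<and> norm (a (x - w) - a x) \<le> \<delta>"
    if x: "x \<in> cube x\<^sub>0 (R/4)" and w: "w \<in> cube 0 \<epsilon>" for x w
  proof -
    have x': "x \<in> cube x\<^sub>0 R" using x cube_mono[of "R/4" R x\<^sub>0] R by auto
    have xw: "x - w \<in> cube x\<^sub>0 R"
      using cube_diff[OF x w] cube_mono[of "R/4 + \<epsilon>" R x\<^sub>0] R \<epsilon> by auto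
    have "norm w \<le> real DIM('a) * \<epsilon>" using subsetD[OF cube_subset_cball w] by simp
    also have "\<dots> \<le> real DIM('a) * (min t1 t2 / (2 * real DIM('a)))" by (intro mult_left_mono) (auto simp: \<epsilon>_def)
    also have "\<dots> = min t1 t2 / 2" by simp
    also have "\<dots> < min t1 t2" using t1(1) t2(1) by (simp add: min_def)
    finally have d: "dist (x - w) x < t1" "dist (x - w) x < t2" by (auto simp: dist_norm)
    have da: "norm (a (x - w) - a x) < s" "norm (a (x - w) - a x) < \<delta>"
      using t1(2)[OF x' xw d(1)] by (auto simp: dist_norm)
    have "norm (Y (x - w) - Y x) < \<delta>" using t2(2)[OF x' xw d(2)] by (simp add: dist_norm)
    moreover have "Y (x - w) = N (a (x - w))" "Y x = N (a x)" "E (a (x - w)) = E (a x)"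
      using Y_eq eikonal x' xw by auto
    ultimately show ?thesis using s(2)[OF a_D[OF x'] a_D[OF xw] da(1)] da(2) by auto
  qed
  then show ?thesis using \<epsilon> by blast
qed

text \<open>The integral of \<eta> |S|^2 is at most \<delta> K / \<gamma>^2 with K independent of
  \<epsilon>, so the derivatives of the mollified a disappear in the limit, while the mollified a
  itself converges uniformly to a.\<close>

lemma weak_gradient_zero:
  assumes \<phi>: "C1_grad \<phi> \<phi>'" "\<And>x. x \<notin> cube x\<^sub>0 (R/8) \<Longrightarrow> \<phi> x = 0" and b: "b \<in> Basis" "c \<in> Basis"
  shows "integral (cube x\<^sub>0 (R/4)) (\<lambda>x. (\<phi>' x \<bullet> b) * (a x \<bullet> c)) = 0"
proof -
  let ?Q = "cube x\<^sub>0 (R/4)" and ?n = "real DIM('a)"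
  define V where "V = measure lborel ?Q"
  obtain \<Lambda> where \<Lambda>: "\<Lambda> > 0" "\<And>\<xi> h. \<xi> \<in> D \<Longrightarrow> norm (A \<xi> h) \<le> \<Lambda> * norm h" using A_bounded by blast
  obtain L where L: "L > 0" "\<And>x. x \<in> ?Q \<Longrightarrow> norm (Y x) \<le> L"
    using bounded_on_cube[OF Y_cont] by blast
  obtain \<eta> \<eta>' q where \<eta>: "C1_grad \<eta> \<eta>'" "\<And>x. 0 \<le> \<eta> x" "\<And>x. x \<notin> ?Q \<Longrightarrow> \<eta> x = 0"
    "0 < q" "\<And>x. x \<in> cube x\<^sub>0 (R/8) \<Longrightarrow> q \<le> \<eta> x"
    using cutoff_exists[of "R/8" "R/4" x\<^sub>0] R by auto
  obtain H1 where H1: "H1 > 0" "\<And>x. x \<in> ?Q \<Longrightarrow> norm (\<eta> x) \<le> H1"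
    using bounded_on_cube[OF C1_grad_D(3)[OF \<eta>(1)]] by blast
  obtain H2 where H2: "H2 > 0" "\<And>x. x \<in> ?Q \<Longrightarrow> norm (\<eta>' x) \<le> H2"
    using bounded_on_cube[OF C1_grad_D(2)[OF \<eta>(1)]] by blast
  define H where "H = max H1 H2"
  have H: "0 < H" "\<And>x. x \<in> ?Q \<Longrightarrow> \<eta> x \<le> H" "\<And>x. x \<in> ?Q \<Longrightarrow> norm (\<eta>' x) \<le> H"
    using H1 H2 by (force simp: H_def le_max_iff_disj)+
  obtain P1 where P1: "P1 > 0" "\<And>x. x \<in> ?Q \<Longrightarrow> norm (\<phi> x) \<le> P1"
    using bounded_on_cube[OF C1_grad_D(3)[OF \<phi>(1)]] by blast
  obtain P2 where P2: "P2 > 0" "\<And>x. x \<in> ?Q \<Longrightarrow> norm (\<phi>' x) \<le> P2"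
    using bounded_on_cube[OF C1_grad_D(2)[OF \<phi>(1)]] by blast
  obtain C where C: "0 \<le> C" "\<And>z. z \<in> cube 0 (R/4) \<Longrightarrow> integral ?Q (\<lambda>x. (norm (a (x - z) - a x))\<^sup>2) \<le> C * (norm z)\<^sup>2"
    using caccioppoli by blast
  obtain M where M: "\<And>\<epsilon>. \<epsilon> > 0 \<Longrightarrow> \<exists>\<rho>::'a \<Rightarrow> real. mollifier \<rho> \<epsilon> M"
    using mollifier_exists by blast
  define K where "K = (H * (?n * (2 * \<Lambda> + 1)) + H * (2 * \<Lambda> + 1 + L)) * (V + 2 * (M\<^sup>2 * 4 ^ DIM('a) * ?n\<^sup>2 * C))"
  define I where "I = integral ?Q (\<lambda>x. (\<phi>' x \<bullet> b) * (a x \<bullet> c))"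
  \<comment> \<open>\<open>P2 * V\<close> pays for replacing \<open>a\<close> by its mollification.
    The rest bounds the integral of |\<phi>| |S|, with the factor 1/q because \<eta> \<ge> q on the
    cube where \<phi> may be nonzero.\<close>
  define B where "B = P2 * V + P1 / q * (H * V + K / \<gamma>\<^sup>2)"
  have bound: "\<bar>I\<bar> \<le> \<tau> * B" if \<tau>: "0 < \<tau>" "\<tau> \<le> 1" for \<tau>
  proof -
    text \<open>The bound \<open>t \<le> \<tau> + t\<^sup>2 / \<tau>\<close> turns the estimate \<open>\<delta> K\<close> for \<open>\<integral>\<eta>|S|\<^sup>2\<close> into one of order \<open>\<tau>\<close> for \<open>\<integral>\<eta>|S|\<close>.\<close>
    define \<delta> where "\<delta> = \<tau>\<^sup>2"
    have \<delta>: "0 < \<delta>" "\<delta> \<le> 1" "\<delta> \<le> \<tau>"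
      using \<tau> by (auto simp: \<delta>_def power_le_one power2_eq_square mult_left_le_one_le mult_le_one)
    obtain \<epsilon> where \<epsilon>: "\<epsilon> > 0" "\<epsilon> \<le> R/16" and close: "\<And>x w. x \<in> ?Q \<Longrightarrow> w \<in> cube 0 \<epsilon> \<Longrightarrow>
        norm (Y (x - w) - Y x - A (a x) (a (x - w) - a x)) \<le> \<delta> * norm (a (x - w) - a x) \<and>
        \<bar>Y x \<bullet> (a (x - w) - a x)\<bar> \<le> \<delta> * norm (a (x - w) - a x) \<and>
        norm (Y (x - w) - Y x) \<le> \<delta> \<and> norm (a (x - w) - a x) \<le> \<delta>"
      using uniform_closeness[OF \<delta>(1)] by blast
    obtain \<rho> :: "'a \<Rightarrow> real" where \<rho>: "mollifier \<rho> \<epsilon> M" using M[OF \<epsilon>(1)] by blast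
    interpret m: mollified_solution E N A D \<gamma> v a Y x\<^sub>0 R e\<^sub>0 \<rho> \<epsilon> M
      by (intro mollified_solution.intro mollified_solution_axioms.intro local_solution_axioms \<rho>) (use \<epsilon> R in auto)
    note J = m.integral_J_square[OF C(2,1)]
    define Z where "Z x = (\<Sum>b\<in>Basis. m.S x b \<bullet> m.S x b)" for x
    have Zc: "continuous_on UNIV Z" unfolding Z_def[abs_def] by (intro continuous_intros m.S_cont)
    have "\<gamma>\<^sup>2 * integral ?Q (\<lambda>x. \<eta> x * Z x) \<le> \<delta> * K"
      unfolding Z_def K_def V_def
      by (rule m.integral_S_square[OF \<eta>(1,3,2) _ \<Lambda>(2) H(2,3) L(2) \<delta>(1,2) _ J(2,1)])
        (use \<Lambda>(1) close in auto)
    then have IZ: "integral ?Q (\<lambda>x. \<eta> x * Z x) \<le> \<delta> * K / \<gamma>\<^sup>2"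
      using gamma by (simp add: field_simps)
    \<comment> \<open>The derivative of \<phi> times a component of the mollified \<open>a\<close>.
      Its integral vanishes, so it may be subtracted under the integral defining \<open>I\<close>,
      leaving two small terms.\<close>
    define G where "G x h = (\<phi>' x \<bullet> h) * (conv \<rho> a x \<bullet> c) + \<phi> x * (m.S x h \<bullet> c)" for x h
    have Gd: "((\<lambda>x. \<phi> x * (conv \<rho> a x \<bullet> c)) has_derivative G x) (at x)" for x
      by (rule has_derivative_eq_rhs[OF has_derivative_mult[OF C1_grad_D(1)[OF \<phi>(1)] has_derivative_inner_left[OF m.conv_a_deriv]]])
        (auto simp: G_def)
    have Gc: "continuous_on UNIV (\<lambda>x. G x h)" for h
      unfolding G_def by (intro continuous_intros m.cont_conv_a m.S_cont C1_grad_D(2,3)[OF \<phi>(1)])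
    note G = C1_gradI[of "\<lambda>x. \<phi> x * (conv \<rho> a x \<bullet> c)" G, OF Gd Gc]
    have \<phi>Q: "\<phi> x = 0" if "x \<notin> ?Q" for x
      using \<phi>(2) that cube_mono[of "R/8" "R/4" x\<^sub>0] R by auto
    have \<phi>'Q: "\<phi>' x = 0" if "x \<notin> ?Q" for x
      using C1_grad_eq_0_outside[OF \<phi>(1) \<phi>Q that] .
    have "integral UNIV (\<lambda>x. G x b) = 0"
      using integral_grad_eq_0[OF G(1), of x\<^sub>0 "R/4" b] \<phi>Q by (simp add: G(2))
    then have G0: "integral ?Q (\<lambda>x. G x b) = 0"
      using integral_UNIV_eq[of ?Q "\<lambda>x. G x b"] \<phi>Q \<phi>'Q by (simp add: G_def)
    have "I = I - integral ?Q (\<lambda>x. G x b)" using G0 by simp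
    also have "\<dots> = integral ?Q (\<lambda>x. (\<phi>' x \<bullet> b) * (a x \<bullet> c) - G x b)"
      unfolding I_def by (intro integral_diff[symmetric] integrable_on_cube continuous_intros a_cont Gc C1_grad_D(2)[OF \<phi>(1)])
    finally have I: "I = integral ?Q (\<lambda>x. (\<phi>' x \<bullet> b) * (a x \<bullet> c) - G x b)" .
    have pw: "norm ((\<phi>' x \<bullet> b) * (a x \<bullet> c) - G x b) \<le> P2 * \<tau> + P1 / q * (H * \<tau> + (\<eta> x * Z x) / \<tau>)"
      if x: "x \<in> ?Q" for x
    proof -
      have "norm (conv \<rho> a x - a x) \<le> \<delta>"
        by (rule m.conv_close[OF a_cont]) (use close[OF x] in auto)
      then have "\<bar>(a x - conv \<rho> a x) \<bullet> c\<bar> \<le> \<tau>"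
        using Basis_le_norm[OF b(2), of "a x - conv \<rho> a x"] \<delta>(3) by (simp add: norm_minus_commute)
      moreover have "\<bar>\<phi>' x \<bullet> b\<bar> \<le> P2" using Basis_le_norm[OF b(1), of "\<phi>' x"] P2(2)[OF x] by linarith
      ultimately have t1: "\<bar>(\<phi>' x \<bullet> b) * ((a x - conv \<rho> a x) \<bullet> c)\<bar> \<le> P2 * \<tau>"
        unfolding abs_mult using P2(1) by (intro mult_mono) auto
      have t2: "\<bar>\<phi> x * (m.S x b \<bullet> c)\<bar> \<le> P1 / q * (H * \<tau> + (\<eta> x * Z x) / \<tau>)"
      proof (cases "x \<in> cube x\<^sub>0 (R/8)")
        case False
        then show ?thesis using \<phi>(2) P1(1) \<eta>(2)[of x] \<eta>(4) H(1) \<tau> by (simp add: Z_def sum_nonneg)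
      next
        case True
        define t where "t = norm (m.S x b)"
        have "t * t \<le> Z x"
          unfolding Z_def t_def using b(1) member_le_sum[of b Basis "\<lambda>b. m.S x b \<bullet> m.S x b"]
          by (simp add: power2_norm_eq_inner[symmetric] power2_eq_square)
        moreover have "t \<le> \<tau> + t * t / \<tau>"
        proof -
          have "0 \<le> (t - \<tau> / 2)\<^sup>2 + 3 / 4 * \<tau>\<^sup>2" by simp
          then have "t * \<tau> \<le> \<tau> * \<tau> + t * t" by (simp add: power2_eq_square algebra_simps)
          then show ?thesis using \<tau>(1) by (simp add: field_simps)
        qed
        moreover have "t * t / \<tau> \<le> Z x / \<tau>" using calculation(1) \<tau>(1) by (simp add: divide_right_mono)
        ultimately have tZ: "t \<le> \<tau> + Z x / \<tau>" by linarith
        have "\<bar>\<phi> x * (m.S x b \<bullet> c)\<bar> \<le> P1 * (\<tau> + Z x / \<tau>)"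
          unfolding abs_mult using P1(2)[OF x] P1(1) Basis_le_norm[OF b(2), of "m.S x b"] tZ
          by (intro mult_mono) (auto simp: t_def)
        also have "\<dots> = P1 / q * (q * (\<tau> + Z x / \<tau>))" using \<eta>(4) by simp
        also have "\<dots> \<le> P1 / q * (\<eta> x * (\<tau> + Z x / \<tau>))"
          using P1(1) \<eta>(4) \<eta>(5)[OF True] \<tau>(1)
          by (intro mult_left_mono mult_right_mono) (auto simp: Z_def sum_nonneg)
        also have "\<dots> \<le> P1 / q * (H * \<tau> + (\<eta> x * Z x) / \<tau>)"
          using P1(1) \<eta>(4) H(2)[OF x] \<tau>(1)
          by (intro mult_left_mono) (auto simp: distrib_left intro!: mult_right_mono)
        finally show ?thesis .
      qed
      have "(\<phi>' x \<bullet> b) * (a x \<bullet> c) - G x b = (\<phi>' x \<bullet> b) * ((a x - conv \<rho> a x) \<bullet> c) - \<phi> x * (m.S x b \<bullet> c)"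
        by (simp add: G_def inner_diff_left algebra_simps)
      then show ?thesis using t1 t2 by simp
    qed
    have "\<bar>I\<bar> \<le> integral ?Q (\<lambda>x. P2 * \<tau> + P1 / q * (H * \<tau> + (\<eta> x * Z x) / \<tau>))"
      unfolding I real_norm_def[symmetric]
      by (rule integral_norm_bound_integral[OF _ _ pw])
        (use \<tau>(1) \<eta>(4) in \<open>auto intro!: integrable_on_cube continuous_intros a_cont Gc Zc C1_grad_D(2)[OF \<phi>(1)] C1_grad_D(3)[OF \<eta>(1)]\<close>)
    also have "\<dots> = V * (P2 * \<tau>) + P1 / q * (V * (H * \<tau>) + integral ?Q (\<lambda>x. \<eta> x * Z x) / \<tau>)"
    proof (rule integral_unique)
      have c: "((\<lambda>x. k) has_integral V * k) ?Q" for k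
        using has_integral_const[of k "x\<^sub>0 - (R/4) *\<^sub>R One" "x\<^sub>0 + (R/4) *\<^sub>R One"] by (simp add: V_def cube_def)
      have "((\<lambda>x. \<eta> x * Z x) has_integral integral ?Q (\<lambda>x. \<eta> x * Z x)) ?Q"
        by (intro integrable_integral integrable_on_cube continuous_intros Zc C1_grad_D(3)[OF \<eta>(1)])
      then show "((\<lambda>x. P2 * \<tau> + P1 / q * (H * \<tau> + (\<eta> x * Z x) / \<tau>)) has_integral
          V * (P2 * \<tau>) + P1 / q * (V * (H * \<tau>) + integral ?Q (\<lambda>x. \<eta> x * Z x) / \<tau>)) ?Q"
        by (intro has_integral_add c has_integral_mult_right has_integral_divide)
    qed
    also have "\<dots> \<le> V * (P2 * \<tau>) + P1 / q * (V * (H * \<tau>) + (\<delta> * K / \<gamma>\<^sup>2) / \<tau>)"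
      using IZ P1(1) \<eta>(4) \<tau>(1) by (intro add_left_mono mult_left_mono divide_right_mono) auto
    also have "\<dots> = \<tau> * B"
      using \<tau>(1) \<eta>(4) by (simp add: B_def \<delta>_def power2_eq_square field_simps)
    finally show ?thesis .
  qed
  have "\<bar>I\<bar> \<le> 0"
  proof (rule field_le_epsilon)
    fix e :: real assume e: "e > 0"
    define \<tau> where "\<tau> = min 1 (e / (\<bar>B\<bar> + 1))"
    have \<tau>: "0 < \<tau>" "\<tau> \<le> 1" using e by (auto simp: \<tau>_def)
    have "\<bar>I\<bar> \<le> \<tau> * B" by (rule bound[OF \<tau>])
    also have "\<dots> \<le> \<tau> * (\<bar>B\<bar> + 1)" using \<tau> by (intro mult_left_mono) auto
    also have "\<dots> \<le> e / (\<bar>B\<bar> + 1) * (\<bar>B\<bar> + 1)" by (intro mult_right_mono) (auto simp: \<tau>_def)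
    finally show "\<bar>I\<bar> \<le> 0 + e" by simp
  qed
  then show ?thesis by (simp add: I_def)
qed

text \<open>With z \<mapsto> \<rho>(y - z) as test function, \<open>weak_gradient_zero\<close> gives
  S y = 0 exactly, so the mollified a is constant on the small cube; it is also uniformly close to
  a. The radius is R/16 since then the support of this test function, of radius at most R/16 +
  \<epsilon>, lies in the cube of radius R/8.\<close>

theorem gradient_locally_constant:
  assumes "x \<in> cube x\<^sub>0 (R/16)"
  shows "a x = a x\<^sub>0"
proof -
  have "norm (a x - a x\<^sub>0) \<le> 0"
  proof (rule field_le_epsilon)
    fix e :: real assume e: "e > 0"
    obtain \<epsilon> where \<epsilon>: "\<epsilon> > 0" "\<epsilon> \<le> R/16" and close: "\<And>x w. x \<in> cube x\<^sub>0 (R/4) \<Longrightarrow> w \<in> cube 0 \<epsilon> \<Longrightarrow> norm (a (x - w) - a x) \<le> e / 2"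
      using uniform_closeness[of "e/2"] e by fastforce
    obtain M where M: "\<And>\<epsilon>. \<epsilon> > 0 \<Longrightarrow> \<exists>\<rho>::'a \<Rightarrow> real. mollifier \<rho> \<epsilon> M"
    using mollifier_exists by blast
    obtain \<rho> :: "'a \<Rightarrow> real" where \<rho>: "mollifier \<rho> \<epsilon> M" using M[OF \<epsilon>(1)] by blast
    interpret m: mollified_solution E N A D \<gamma> v a Y x\<^sub>0 R e\<^sub>0 \<rho> \<epsilon> M
      by (intro mollified_solution.intro mollified_solution_axioms.intro local_solution_axioms \<rho>) (use \<epsilon> R in auto)
    have S0: "m.S y h = 0" if y: "y \<in> cube x\<^sub>0 (R/16)" for y h
    proof -
      have b0: "m.S y b \<bullet> c = 0" if b: "b \<in> Basis" "c \<in> Basis" for b c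
      proof -
        have supp: "\<rho> (y - z) = 0" if z: "z \<notin> cube x\<^sub>0 (R/8)" for z
        proof (rule m.\<rho>_supp, rule notI)
          assume "y - z \<in> cube 0 \<epsilon>"
          from cube_diff[OF y this] have "z \<in> cube x\<^sub>0 (R/16 + \<epsilon>)" by simp
          then show False using z cube_mono[of "R/16 + \<epsilon>" "R/8" x\<^sub>0] \<epsilon> by auto
        qed
        note r = C1_grad_reflect[OF m.\<rho>_C1, of y]
        have sg: "- m.g (y - z) = 0" if "z \<notin> cube x\<^sub>0 (R/4)" for z
        proof -
          have "z \<notin> cube x\<^sub>0 (R/8)" using that cube_mono[of "R/8" "R/4" x\<^sub>0] R by auto
          then show ?thesis by (intro C1_grad_eq_0_outside[where z=x\<^sub>0 and r="R/8", OF r] supp)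
        qed
        have gc: "continuous_on UNIV (\<lambda>z. m.g (y - z))"
          by (rule continuous_on_compose2[OF m.g_cont]) (auto intro!: continuous_intros)
        have i: "(\<lambda>z. (m.g (y - z) \<bullet> b) *\<^sub>R a z) integrable_on UNIV"
          by (rule integrable_on_UNIV[of x\<^sub>0 "R/4"]) (use sg in \<open>auto intro!: continuous_intros gc a_cont\<close>)
        have "m.S y b \<bullet> c = integral UNIV (\<lambda>z. ((m.g (y - z) \<bullet> b) *\<^sub>R a z) \<bullet> c)"
          using integral_linear[OF i bounded_linear_inner_left[of c]] by (simp add: m.S_def conv_def o_def)
        also have "\<dots> = integral (cube x\<^sub>0 (R/4)) (\<lambda>z. - ((- m.g (y - z) \<bullet> b) * (a z \<bullet> c)))"
          using integral_UNIV_eq[of "cube x\<^sub>0 (R/4)" "\<lambda>z. ((m.g (y - z) \<bullet> b) *\<^sub>R a z) \<bullet> c"] sg by auto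
        also have "\<dots> = - integral (cube x\<^sub>0 (R/4)) (\<lambda>z. (- m.g (y - z) \<bullet> b) * (a z \<bullet> c))" by (rule integral_neg)
        also have "integral (cube x\<^sub>0 (R/4)) (\<lambda>z. (- m.g (y - z) \<bullet> b) * (a z \<bullet> c)) = 0"
          by (rule weak_gradient_zero[OF r supp b])
        finally show ?thesis by simp
      qed
      have "m.S y b = 0" if "b \<in> Basis" for b
        using b0[OF that] by (auto intro: euclidean_eqI)
      then have "m.S y (\<Sum>b\<in>Basis. (h \<bullet> b) *\<^sub>R b) = 0"
        by (simp add: linear_sum[OF m.S_linear] linear_cmul[OF m.S_linear])
      then show ?thesis by (simp add: euclidean_representation)
    qed
    have "\<exists>k. \<forall>y\<in>cube x\<^sub>0 (R/16). conv \<rho> a y = k"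
    proof (rule has_derivative_zero_constant[OF convex_cube])
      fix y assume "y \<in> cube x\<^sub>0 (R/16)"
      then have "m.S y = (\<lambda>h. 0)" using S0 by auto
      then show "(conv \<rho> a has_derivative (\<lambda>h. 0)) (at y within cube x\<^sub>0 (R/16))"
        using m.conv_a_deriv[of y] by (auto intro: has_derivative_at_withinI)
    qed
    moreover have x0: "x\<^sub>0 \<in> cube x\<^sub>0 (R/16)" using R by (intro center_in_cube) auto
    ultimately have eq: "conv \<rho> a x = conv \<rho> a x\<^sub>0" using assms by metis
    have "norm (conv \<rho> a y - a y) \<le> e/2" if "y \<in> cube x\<^sub>0 (R/16)" for y
    proof (rule m.conv_close[OF a_cont])
      fix w :: 'a assume "w \<in> cube 0 \<epsilon>"
      then show "norm (a (y - w) - a y) \<le> e / 2"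
        using that cube_mono[of "R/16" "R/4" x\<^sub>0] R by (intro close) auto
    qed
    from this[OF assms] this[OF x0] show "norm (a x - a x\<^sub>0) \<le> 0 + e"
      using norm_triangle_ineq4[of "conv \<rho> a x\<^sub>0 - a x\<^sub>0" "conv \<rho> a x - a x"] eq by simp
  qed
  then show ?thesis by simp
qed

end

section \<open>Test functions of class \<open>C\<^sup>1\<close>\<close>

lemma C_k_conv:
  fixes \<rho> :: "'a::euclidean_space \<Rightarrow> real" and f :: "'a \<Rightarrow> real"
  assumes "\<And>k. C_k k UNIV \<rho>" "\<And>x. x \<notin> cube c r \<Longrightarrow> \<rho> x = 0" "continuous_on UNIV f"
  shows "C_k k UNIV (conv \<rho> f)"
  using assms(1,2)
proof (induction k arbitrary: \<rho>)
  case 0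
  then show ?case
    using continuous_conv[of c r \<rho> f] C_k_continuous[OF 0(1)] assms(3) by simp
next
  case (Suc k)
  have C1: "C1_grad \<rho> (vgrad \<rho>)" by (rule C1_grad_vgrad[OF Suc.prems(1)])
  have d: "(conv \<rho> f has_derivative (\<lambda>h. conv (\<lambda>z. vgrad \<rho> z \<bullet> h) f x)) (at x)" for x
    by (rule conv_has_derivative[where c=c and r=r, OF C1 Suc.prems(2) assms(3)])
  have dd: "dir_deriv b (conv \<rho> f) = conv (dir_deriv b \<rho>) f" if "b \<in> Basis" for b
    by (rule ext) (simp add: dir_deriv_eq[OF d] vgrad_inner_Basis[OF that])
  have s: "dir_deriv b \<rho> x = 0" if "x \<notin> cube c r" "b \<in> Basis" for x b
    using C1_grad_eq_0_outside[OF C1 Suc.prems(2) that(1)] vgrad_inner_Basis[OF that(2), of \<rho> x] by simp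
  have "C_k k UNIV (dir_deriv b (conv \<rho> f))" if b: "b \<in> Basis" for b
    unfolding dd[OF b]
  proof (rule Suc.IH)
    show "C_k m UNIV (dir_deriv b \<rho>)" for m using Suc.prems(1)[of "Suc m"] b by simp
  qed (use s b in auto)
  then show ?case using d by (auto simp: differentiable_def)
qed

text \<open>Weak solutions are tested with smooth functions, but the test functions of this proof
  are built from u and v and are merely C^1. Mollifying \<phi> changes \<phi> and its gradient by a
  uniformly small amount, and R' < R leaves room for the support to grow.\<close>

lemma weak_form_C1:
  fixes W :: "'a::euclidean_space \<Rightarrow> 'a" and f :: "'a \<Rightarrow> real"
  assumes W: "continuous_on (cube x R) W" and f: "continuous_on (cube x R) f" and R: "0 < R'" "R' < R"
    and weak: "\<And>\<phi>. test_function \<phi> \<Longrightarrow> (\<And>y. y \<notin> cube x R \<Longrightarrow> \<phi> y = 0) \<Longrightarrow>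
        integral (cube x R) (\<lambda>y. W y \<bullet> vgrad \<phi> y - f y * \<phi> y) = 0"
    and \<phi>: "C1_grad \<phi> \<phi>'" "\<And>y. y \<notin> cube x R' \<Longrightarrow> \<phi> y = 0"
  shows "integral (cube x R) (\<lambda>y. W y \<bullet> \<phi>' y - f y * \<phi> y) = 0"
proof -
  let ?Q = "cube x R"
  obtain c1 where c1: "c1 > 0" "\<And>y. y \<in> ?Q \<Longrightarrow> norm (W y) \<le> c1"
    using compact_imp_bounded[OF compact_continuous_image[OF W compact_cube]] by (auto simp: bounded_pos)
  obtain c2 where c2: "c2 > 0" "\<And>y. y \<in> ?Q \<Longrightarrow> norm (f y) \<le> c2"
    using compact_imp_bounded[OF compact_continuous_image[OF f compact_cube]] by (auto simp: bounded_pos)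
  define V where "V = measure lborel ?Q"
  define I where "I = integral ?Q (\<lambda>y. W y \<bullet> \<phi>' y - f y * \<phi> y)"
  have int: "g integrable_on ?Q" if "continuous_on ?Q g" for g :: "'a \<Rightarrow> real"
    using that unfolding cube_def by (rule integrable_continuous)
  have cont: "continuous_on ?Q \<psi>" if "continuous_on UNIV \<psi>" for \<psi> :: "'a \<Rightarrow> 'b::topological_space"
    using that by (rule continuous_on_subset) simp
  obtain M where M: "\<And>\<epsilon>. \<epsilon> > 0 \<Longrightarrow> \<exists>\<rho>::'a \<Rightarrow> real. mollifier \<rho> \<epsilon> M"
    using mollifier_exists by blast
  have bound: "\<bar>I\<bar> \<le> V * ((c1 + c2) * \<delta>)" if \<delta>: "\<delta> > 0" for \<delta>
  proof -
    have uc: "\<exists>t>0. \<forall>y\<in>cube x (R+1). \<forall>z\<in>cube x (R+1). dist z y < t \<longrightarrow> dist (g z) (g y) < \<delta>"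
      if "continuous_on UNIV g" for g :: "'a \<Rightarrow> 'b::metric_space"
      using compact_uniformly_continuous[OF continuous_on_subset[OF that] compact_cube] \<delta>
      unfolding uniformly_continuous_on_def by blast
    obtain t1 where t1: "t1 > 0" "\<And>y z. y \<in> cube x (R+1) \<Longrightarrow> z \<in> cube x (R+1) \<Longrightarrow> dist z y < t1 \<Longrightarrow> dist (\<phi> z) (\<phi> y) < \<delta>"
      using uc[OF C1_grad_D(3)[OF \<phi>(1)]] by blast
    obtain t2 where t2: "t2 > 0" "\<And>y z. y \<in> cube x (R+1) \<Longrightarrow> z \<in> cube x (R+1) \<Longrightarrow> dist z y < t2 \<Longrightarrow> dist (\<phi>' z) (\<phi>' y) < \<delta>"
      using uc[OF C1_grad_D(2)[OF \<phi>(1)]] by blast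
    define \<epsilon> where "\<epsilon> = min (min 1 (R - R')) (min t1 t2 / (2 * real DIM('a)))"
    have \<epsilon>: "\<epsilon> > 0" "\<epsilon> \<le> R - R'" "\<epsilon> \<le> 1" using R t1(1) t2(1) by (auto simp: \<epsilon>_def)
    have small: "norm w < min t1 t2" if w: "w \<in> cube 0 \<epsilon>" for w :: 'a
    proof -
      have "norm w \<le> real DIM('a) * \<epsilon>" using subsetD[OF cube_subset_cball w] by simp
      also have "\<dots> \<le> real DIM('a) * (min t1 t2 / (2 * real DIM('a)))" by (intro mult_left_mono) (auto simp: \<epsilon>_def)
      also have "\<dots> = min t1 t2 / 2" by simp
      also have "\<dots> < min t1 t2" using t1(1) t2(1) by (simp add: min_def)
      finally show ?thesis .
    qed
    obtain \<rho> :: "'a \<Rightarrow> real" where "mollifier \<rho> \<epsilon> M" using M[OF \<epsilon>(1)] by blast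
    then interpret m: mollifier \<rho> \<epsilon> M .
    define \<phi>\<epsilon> where "\<phi>\<epsilon> = conv \<rho> \<phi>"
    have smooth: "C_k k UNIV \<phi>\<epsilon>" for k
      unfolding \<phi>\<epsilon>_def by (rule C_k_conv[OF m.\<rho>_smooth m.\<rho>_supp C1_grad_D(3)[OF \<phi>(1)]])
    have supp: "\<phi>\<epsilon> y = 0" if y: "y \<notin> ?Q" for y
    proof -
      have z: "\<rho> w *\<^sub>R \<phi> (y - w) = 0" if w: "w \<in> cube 0 \<epsilon>" for w
      proof -
        have "y - w \<notin> cube x R'"
        proof
          assume "y - w \<in> cube x R'"
          from cube_add[OF this w] have "y \<in> cube x (R' + \<epsilon>)" by simp
          then show False using y \<epsilon>(2) cube_mono[of "R' + \<epsilon>" R x] by auto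
        qed
        then show ?thesis using \<phi>(2) by simp
      qed
      have "\<phi>\<epsilon> y = integral (cube 0 \<epsilon>) (\<lambda>w. \<rho> w *\<^sub>R \<phi> (y - w))"
        unfolding \<phi>\<epsilon>_def by (rule conv_eq_integral_cube[OF m.\<rho>_supp m.\<rho>_cont C1_grad_D(3)[OF \<phi>(1)]])
      also have "\<dots> = integral (cube 0 \<epsilon>) (\<lambda>w::'a. 0)" by (rule integral_cong) (rule z)
      finally show ?thesis by simp
    qed
    have "{y. \<phi>\<epsilon> y \<noteq> 0} \<subseteq> ?Q" using supp by auto
    then have "bounded {y. \<phi>\<epsilon> y \<noteq> 0}" using compact_imp_bounded[OF compact_cube] bounded_subset by blast
    then have "test_function \<phi>\<epsilon>" using smooth by (simp add: test_function_def compact_closure)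
    then have w0: "integral ?Q (\<lambda>y. W y \<bullet> vgrad \<phi>\<epsilon> y - f y * \<phi>\<epsilon> y) = 0" by (rule weak[OF _ supp])
    have C1\<epsilon>: "C1_grad \<phi>\<epsilon> (vgrad \<phi>\<epsilon>)" by (rule C1_grad_vgrad[OF smooth])
    have vg: "vgrad \<phi>\<epsilon> y = conv \<rho> \<phi>' y" for y
    proof -
      have "(\<lambda>h. vgrad \<phi>\<epsilon> y \<bullet> h) = (\<lambda>h. conv \<rho> \<phi>' y \<bullet> h)"
        using has_derivative_unique[OF C1_grad_D(1)[OF C1\<epsilon>, of y]] m.conv_C1_has_derivative[OF \<phi>(1), of y]
        by (simp add: \<phi>\<epsilon>_def)
      then have "\<forall>h. vgrad \<phi>\<epsilon> y \<bullet> h = conv \<rho> \<phi>' y \<bullet> h" by metis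
      then show ?thesis by (simp only: vector_eq_rdot)
    qed
    have near: "y \<in> cube x (R+1)" "y - w \<in> cube x (R+1)" if "y \<in> ?Q" "w \<in> cube 0 \<epsilon>" for y w
      using that cube_mono[of R "R+1" x] cube_diff[OF that] cube_mono[of "R+\<epsilon>" "R+1" x] \<epsilon> by auto
    have e1: "norm (\<phi>\<epsilon> y - \<phi> y) \<le> \<delta>" if y: "y \<in> ?Q" for y
      unfolding \<phi>\<epsilon>_def
    proof (rule m.conv_close[OF C1_grad_D(3)[OF \<phi>(1)]])
      fix w :: 'a assume w: "w \<in> cube 0 \<epsilon>"
      show "norm (\<phi> (y - w) - \<phi> y) \<le> \<delta>"
        using t1(2)[OF near[OF y w]] small[OF w] by (simp add: dist_norm)
    qed
    have e2: "norm (vgrad \<phi>\<epsilon> y - \<phi>' y) \<le> \<delta>" if y: "y \<in> ?Q" for y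
      unfolding vg
    proof (rule m.conv_close[OF C1_grad_D(2)[OF \<phi>(1)]])
      fix w :: 'a assume w: "w \<in> cube 0 \<epsilon>"
      show "norm (\<phi>' (y - w) - \<phi>' y) \<le> \<delta>"
        using t2(2)[OF near[OF y w]] small[OF w] by (simp add: dist_norm)
    qed
    note conts = W f cont[OF C1_grad_D(2)[OF \<phi>(1)]] cont[OF C1_grad_D(3)[OF \<phi>(1)]]
      cont[OF C1_grad_D(2)[OF C1\<epsilon>]] cont[OF C1_grad_D(3)[OF C1\<epsilon>]]
    have "I = integral ?Q (\<lambda>y. (W y \<bullet> \<phi>' y - f y * \<phi> y) - (W y \<bullet> vgrad \<phi>\<epsilon> y - f y * \<phi>\<epsilon> y))"
      by (subst integral_diff) (auto simp: w0 I_def intro!: int continuous_intros conts)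
    also have "norm \<dots> \<le> integral ?Q (\<lambda>y. (c1 + c2) * \<delta>)"
    proof (rule integral_norm_bound_integral)
      fix y assume y: "y \<in> ?Q"
      have "\<bar>W y \<bullet> (\<phi>' y - vgrad \<phi>\<epsilon> y)\<bar> \<le> c1 * \<delta>"
        using c1(1) c1(2)[OF y] e2[OF y]
        by (intro order_trans[OF Cauchy_Schwarz_ineq2] mult_mono) (auto simp: norm_minus_commute)
      moreover have "\<bar>f y * (\<phi>\<epsilon> y - \<phi> y)\<bar> \<le> c2 * \<delta>"
        unfolding abs_mult using c2(1) c2(2)[OF y] e1[OF y] by (intro mult_mono) auto
      ultimately show "norm ((W y \<bullet> \<phi>' y - f y * \<phi> y) - (W y \<bullet> vgrad \<phi>\<epsilon> y - f y * \<phi>\<epsilon> y)) \<le> (c1 + c2) * \<delta>"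
        by (simp add: inner_diff_right algebra_simps)
    qed (auto intro!: int continuous_intros conts)
    also have "\<dots> = V * ((c1 + c2) * \<delta>)" by (simp only: integral_cube_const V_def)
    finally show ?thesis by simp
  qed
  have "\<bar>I\<bar> \<le> 0"
  proof (rule field_le_epsilon)
    fix e :: real assume e: "e > 0"
    have V: "V \<ge> 0" by (simp add: V_def)
    then have p: "(V + 1) * (c1 + c2) > 0" using c1(1) c2(1) by simp
    have "\<bar>I\<bar> \<le> V * ((c1 + c2) * (e / ((V + 1) * (c1 + c2))))" using bound[of "e / ((V + 1) * (c1 + c2))"] e p by simp
    also have "\<dots> \<le> (V + 1) * ((c1 + c2) * (e / ((V + 1) * (c1 + c2))))"
      using e p c1(1) c2(1) V by (intro mult_right_mono) auto
    also have "\<dots> = e" using p by (simp add: field_simps)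
    finally show "\<bar>I\<bar> \<le> 0 + e" by simp
  qed
  then show ?thesis by (simp add: I_def)
qed

lemma vgrad_eq_grad: "vgrad f = grad f" for f :: "real ^ 'n \<Rightarrow> real"
proof (rule ext, rule vec_eq_iff[THEN iffD2], rule allI)
  fix x i
  have "vgrad f x $ i = vgrad f x \<bullet> axis i 1" by (simp add: inner_axis)
  also have "\<dots> = grad f x $ i" by (subst vgrad_inner_Basis) (auto simp: grad_def partial_def axis_in_Basis_iff)
  finally show "vgrad f x $ i = grad f x $ i" .
qed

lemma lebesgue_integral_cube:
  fixes f :: "'a::euclidean_space \<Rightarrow> real"
  assumes "continuous_on (cube x r) f" "\<And>y. y \<notin> cube x r \<Longrightarrow> f y = 0"
  shows "(LINT y|lebesgue. f y) = integral (cube x r) f"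
proof -
  have "f absolutely_integrable_on cube x r"
    using assms(1) unfolding cube_def by (rule absolutely_integrable_continuous)
  then have "(LINT y:cube x r|lebesgue. f y) = integral (cube x r) f"
    by (rule set_lebesgue_integral_eq_integral)
  moreover have "(\<lambda>y. indicator (cube x r) y *\<^sub>R f y) = f"
    using assms(2) by (intro ext) (auto simp: indicator_def)
  ultimately show ?thesis by (simp only: set_lebesgue_integral_def)
qed

lemma weak_solution_C1:
  fixes u :: "real ^ 'n \<Rightarrow> real"
  assumes weak: "weak_solution B H F u"
    and W: "continuous_on (cube x R) (\<lambda>y. flux B H (grad u y))" and f: "continuous_on (cube x R) (\<lambda>y. deriv F (u y))"
    and R: "0 < R'" "R' < R" and \<phi>: "C1_grad \<phi> \<phi>'" "\<And>y. y \<notin> cube x R' \<Longrightarrow> \<phi> y = 0"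
  shows "integral (cube x R) (\<lambda>y. flux B H (grad u y) \<bullet> \<phi>' y - deriv F (u y) * \<phi> y) = 0"
proof (rule weak_form_C1[OF W f R _ \<phi>])
  fix \<phi> :: "real ^ 'n \<Rightarrow> real" assume t: "test_function \<phi>" and s: "\<And>y. y \<notin> cube x R \<Longrightarrow> \<phi> y = 0"
  have C1: "C1_grad \<phi> (vgrad \<phi>)" using t by (intro C1_grad_vgrad) (simp add: test_function_def del: C_k.simps)
  have eq: "(\<Sum>i\<in>UNIV. flux B H (grad u y) $ i * partial i \<phi> y) = flux B H (grad u y) \<bullet> vgrad \<phi> y" for y
    by (simp add: vgrad_eq_grad inner_vec_def grad_def)
  have "(LINT y|lebesgue. flux B H (grad u y) \<bullet> vgrad \<phi> y - deriv F (u y) * \<phi> y) = 0"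
    using weak[unfolded weak_solution_def, rule_format, OF t] unfolding eq .
  moreover have "(LINT y|lebesgue. flux B H (grad u y) \<bullet> vgrad \<phi> y - deriv F (u y) * \<phi> y) =
    integral (cube x R) (\<lambda>y. flux B H (grad u y) \<bullet> vgrad \<phi> y - deriv F (u y) * \<phi> y)"
  proof (rule lebesgue_integral_cube)
    show "continuous_on (cube x R) (\<lambda>y. flux B H (grad u y) \<bullet> vgrad \<phi> y - deriv F (u y) * \<phi> y)"
      by (intro continuous_intros W f continuous_on_subset[OF C1_grad_D(2)[OF C1]] continuous_on_subset[OF C1_grad_D(3)[OF C1]]) auto
    show "flux B H (grad u y) \<bullet> vgrad \<phi> y - deriv F (u y) * \<phi> y = 0" if "y \<notin> cube x R" for y
      using s[OF that] C1_grad_eq_0_outside[OF C1 s that] by simp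
  qed
  ultimately show "integral (cube x R) (\<lambda>y. flux B H (grad u y) \<bullet> vgrad \<phi> y - deriv F (u y) * \<phi> y) = 0" by simp
qed

section \<open>The anisotropic energy density\<close>

lemma half_deriv_eq_deriv:
  assumes "B differentiable (at t)" "0 < t"
  shows "half_deriv B t = deriv B t" "(B has_real_derivative half_deriv B t) (at t)" "dir_deriv 1 B t = deriv B t"
proof -
  have d: "(B has_real_derivative deriv B t) (at t)"
    using assms(1) by (simp add: DERIV_deriv_iff_real_differentiable)
  have "at t within {0..} = at t"
    using assms(2) by (intro at_within_interior) simp
  then show eq: "half_deriv B t = deriv B t"
    unfolding half_deriv_def using d
    by (simp add: has_real_derivative_iff_has_vector_derivative vector_derivative_at)
  show "(B has_real_derivative half_deriv B t) (at t)" unfolding eq by (rule d)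
  show "dir_deriv 1 B t = deriv B t"
    using dir_deriv_eq[of B _ t 1] d by (simp add: has_field_derivative_def)
qed

lemma standing_B_D:
  assumes "standing_B \<beta> B"
  shows "0 < t \<Longrightarrow> (B has_real_derivative half_deriv B t) (at t)"
    and "0 < t \<Longrightarrow> (half_deriv B has_real_derivative deriv (half_deriv B) t) (at t)"
    and "continuous_on {0<..} (deriv (half_deriv B))"
    and "0 < t \<Longrightarrow> 0 < half_deriv B t" "0 < t \<Longrightarrow> 0 < deriv (half_deriv B) t"
proof -
  let ?d = "dir_deriv 1 B"
  have 1: "B differentiable (at t)" "?d differentiable (at t)" "dir_deriv 1 ?d differentiable (at t)" if "0 < t" for t
    using assms that by (auto simp: standing_B_def numeral_3_eq_3)
  have eq: "half_deriv B t = ?d t" if "0 < t" for t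
    using half_deriv_eq_deriv[OF 1(1)] that by simp
  show "0 < t \<Longrightarrow> (B has_real_derivative half_deriv B t) (at t)"
    using half_deriv_eq_deriv[OF 1(1)] by simp
  have hd: "(half_deriv B has_real_derivative deriv ?d t) (at t)" if t: "0 < t" for t
  proof -
    have "(?d has_real_derivative deriv ?d t) (at t)"
      using 1(2)[OF t] by (simp add: DERIV_deriv_iff_real_differentiable)
    then show ?thesis
      by (rule has_field_derivative_transform_within_open[of _ _ _ "{0<..}"]) (use t eq in auto)
  qed
  then have dd: "deriv (half_deriv B) t = deriv ?d t" if "0 < t" for t
    using that DERIV_imp_deriv by blast
  show "0 < t \<Longrightarrow> (half_deriv B has_real_derivative deriv (half_deriv B) t) (at t)"
    using hd dd by simp
  have "deriv (half_deriv B) t = dir_deriv 1 ?d t" if "0 < t" for t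
    using dd[OF that] half_deriv_eq_deriv(3)[OF 1(2)[OF that] that] by simp
  moreover have "continuous_on {0<..} (dir_deriv 1 ?d)"
    using 1(3) by (auto intro!: continuous_at_imp_continuous_on differentiable_imp_continuous_within)
  ultimately show "continuous_on {0<..} (deriv (half_deriv B))"
    by (subst continuous_on_cong[OF refl, of _ _ "dir_deriv 1 ?d"]) auto
  show "0 < t \<Longrightarrow> 0 < half_deriv B t" "0 < t \<Longrightarrow> 0 < deriv (half_deriv B) t"
    using assms by (auto simp: standing_B_def)
qed

text \<open>The left-hand side of the energy identity is \<open>legendre B (H(\<nabla>u))\<close>.\<close>

definition legendre :: "(real \<Rightarrow> real) \<Rightarrow> real \<Rightarrow> real" where
  "legendre B t = half_deriv B t * t - B t"

lemma legendre_deriv: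
  assumes "standing_B \<beta> B" "0 < t"
  shows "(legendre B has_real_derivative deriv (half_deriv B) t * t) (at t)"
  unfolding legendre_def[abs_def]
  by (rule derivative_eq_intros standing_B_D(1,2)[OF assms] refl)+ simp

text \<open>The derivative t B''(t) is positive for t > 0, and continuity up to 0 admits s = 0. That
  endpoint matters: it separates the value taken at critical points of u from the values at all
  other points.\<close>

lemma legendre_less:
  assumes "standing_B \<beta> B" "0 \<le> s" "s < t"
  shows "legendre B s < legendre B t"
proof (rule DERIV_pos_imp_increasing_open[OF assms(3)])
  show "\<exists>y. (legendre B has_real_derivative y) (at x) \<and> 0 < y" if "s < x" "x < t" for x
    using legendre_deriv[OF assms(1), of x] standing_B_D(5)[OF assms(1), of x] that assms(2)
    by (auto intro!: exI[of _ "deriv (half_deriv B) x * x"])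
  have "continuous_on {0..} (legendre B)"
    unfolding legendre_def[abs_def] using assms(1)
    by (intro continuous_intros) (auto simp: standing_B_def differentiable_imp_continuous_on)
  then show "continuous_on {s..t} (legendre B)"
    using assms(2) by (auto intro: continuous_on_subset)
qed

lemma legendre_inj:
  assumes "standing_B \<beta> B" "0 \<le> s" "0 \<le> t" "legendre B s = legendre B t"
  shows "s = t"
  using legendre_less[OF assms(1), of s t] legendre_less[OF assms(1), of t s] assms by force

section \<open>Gradient and Hessian of \<open>B \<circ> H\<close> away from the origin\<close>

definition hess_map :: "('a::euclidean_space \<Rightarrow> real) \<Rightarrow> 'a \<Rightarrow> 'a \<Rightarrow> 'a" where
  "hess_map f x h = (\<Sum>b\<in>Basis. (vgrad (dir_deriv b f) x \<bullet> h) *\<^sub>R b)"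

lemma C2_vgrad:
  assumes "\<And>x. x \<in> S \<Longrightarrow> f differentiable (at x)"
    and "\<And>x b. x \<in> S \<Longrightarrow> b \<in> Basis \<Longrightarrow> dir_deriv b f differentiable (at x)"
    and "\<And>b c. b \<in> Basis \<Longrightarrow> c \<in> Basis \<Longrightarrow> continuous_on S (dir_deriv c (dir_deriv b f))"
  shows "x \<in> S \<Longrightarrow> (vgrad f has_derivative hess_map f x) (at x)"
    and "continuous_on S (\<lambda>x. hess_map f x h)"
proof -
  show "(vgrad f has_derivative hess_map f x) (at x)" if "x \<in> S"
  proof -
    have "vgrad f = (\<lambda>x. \<Sum>b\<in>Basis. dir_deriv b f x *\<^sub>R b)" by (rule ext) (rule vgrad_def)
    then show ?thesis unfolding hess_map_def[abs_def] using that
      by (simp only:) (intro has_derivative_sum has_derivative_scaleR_left vgrad_has_derivative assms)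
  qed
  show "continuous_on S (\<lambda>x. hess_map f x h)"
    unfolding hess_map_def vgrad_def by (intro continuous_intros assms)
qed

lemma standing_H_D:
  fixes H :: "real ^ 'n::finite \<Rightarrow> real"
  assumes "standing_H \<beta> H"
  shows "\<xi> \<noteq> 0 \<Longrightarrow> (H has_derivative (\<lambda>h. grad H \<xi> \<bullet> h)) (at \<xi>)"
    and "\<xi> \<noteq> 0 \<Longrightarrow> (grad H has_derivative hess_map H \<xi>) (at \<xi>)"
    and "continuous_on (- {0}) (\<lambda>\<xi>. hess_map H \<xi> h)"
    and "\<xi> \<noteq> 0 \<Longrightarrow> 0 < H \<xi>" "0 < t \<Longrightarrow> H (t *\<^sub>R \<xi>) = t * H \<xi>" "H 0 = 0"
proof -
  have 1: "H differentiable (at \<xi>)" "b \<in> Basis \<Longrightarrow> dir_deriv b H differentiable (at \<xi>)"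
    "b \<in> Basis \<Longrightarrow> c \<in> Basis \<Longrightarrow> dir_deriv c (dir_deriv b H) differentiable (at \<xi>)" if "\<xi> \<noteq> 0" for \<xi> b c
    using assms that by (auto simp: standing_H_def numeral_3_eq_3)
  show "\<xi> \<noteq> 0 \<Longrightarrow> (H has_derivative (\<lambda>h. grad H \<xi> \<bullet> h)) (at \<xi>)"
    using vgrad_has_derivative[OF 1(1)] by (simp add: vgrad_eq_grad)
  have c: "continuous_on (- {0}) (dir_deriv c (dir_deriv b H))" if "b \<in> Basis" "c \<in> Basis" for b c
    using 1(3) that by (auto intro!: continuous_at_imp_continuous_on differentiable_imp_continuous_within)
  show "\<xi> \<noteq> 0 \<Longrightarrow> (grad H has_derivative hess_map H \<xi>) (at \<xi>)"
    using C2_vgrad(1)[of "- {0}" H \<xi>] 1 c by (auto simp: vgrad_eq_grad)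
  show "continuous_on (- {0}) (\<lambda>\<xi>. hess_map H \<xi> h)"
    by (rule C2_vgrad(2)) (use 1 c in auto)
  show "\<xi> \<noteq> 0 \<Longrightarrow> 0 < H \<xi>" "0 < t \<Longrightarrow> H (t *\<^sub>R \<xi>) = t * H \<xi>" "H 0 = 0"
    using assms by (auto simp: standing_H_def)
qed

text \<open>Differentiate H(t\<xi>) = t H(\<xi>) with respect to \<xi>.\<close>

lemma grad_H_homogeneous:
  fixes H :: "real ^ 'n::finite \<Rightarrow> real"
  assumes H: "standing_H \<beta> H" and "\<xi> \<noteq> 0" "0 < t"
  shows "grad H (t *\<^sub>R \<xi>) = grad H \<xi>"
proof -
  have "((\<lambda>x. H (t *\<^sub>R x)) has_derivative (\<lambda>h. grad H (t *\<^sub>R \<xi>) \<bullet> (t *\<^sub>R h))) (at \<xi>)"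
    by (rule has_derivative_compose[where g=H and f="\<lambda>x. t *\<^sub>R x"])
      (use assms in \<open>auto intro!: derivative_eq_intros standing_H_D(1)\<close>)
  moreover have "((\<lambda>x. H (t *\<^sub>R x)) has_derivative (\<lambda>h. t * (grad H \<xi> \<bullet> h))) (at \<xi>)"
    unfolding standing_H_D(5)[OF H \<open>0 < t\<close>]
    by (intro has_derivative_mult_right standing_H_D(1)[OF H] assms)
  ultimately have "(\<lambda>h. grad H (t *\<^sub>R \<xi>) \<bullet> (t *\<^sub>R h)) = (\<lambda>h. t * (grad H \<xi> \<bullet> h))"
    by (rule has_derivative_unique)
  then have "grad H (t *\<^sub>R \<xi>) \<bullet> (t *\<^sub>R h) = t * (grad H \<xi> \<bullet> h)" for h by metis
  then have "\<forall>h. grad H (t *\<^sub>R \<xi>) \<bullet> h = grad H \<xi> \<bullet> h" using \<open>0 < t\<close> by auto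
  then show ?thesis by (simp only: vector_eq_rdot)
qed

text \<open>Differentiate H(t\<xi>) = t H(\<xi>) with respect to t at t = 1. Homogeneity holds for
  positive factors only, hence the comparison of derivatives on \<open>{0<..}\<close>.\<close>

lemma euler_H:
  fixes H :: "real ^ 'n::finite \<Rightarrow> real"
  assumes H: "standing_H \<beta> H" and "\<xi> \<noteq> 0"
  shows "grad H \<xi> \<bullet> \<xi> = H \<xi>"
proof -
  have "((\<lambda>t. H (t *\<^sub>R \<xi>)) has_derivative (\<lambda>r. grad H (1 *\<^sub>R \<xi>) \<bullet> (r *\<^sub>R \<xi>))) (at 1)"
    by (rule has_derivative_compose[where g=H and f="\<lambda>t. t *\<^sub>R \<xi>"])
      (use assms in \<open>auto intro!: derivative_eq_intros standing_H_D(1)\<close>)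
  moreover have "((\<lambda>t. H (t *\<^sub>R \<xi>)) has_derivative (\<lambda>r. r * H \<xi>)) (at 1)"
    by (rule has_derivative_transform_within_open[of "\<lambda>t. t * H \<xi>" _ _ _ "{0<..}"])
      (auto intro!: derivative_eq_intros simp: standing_H_D(5)[OF H])
  ultimately have "(\<lambda>r. grad H (1 *\<^sub>R \<xi>) \<bullet> (r *\<^sub>R \<xi>)) = (\<lambda>r. r * H \<xi>)"
    by (rule has_derivative_unique)
  from fun_cong[OF this, of 1] show ?thesis by simp
qed

text \<open>Away from the origin both structural assumptions amount to uniform ellipticity. For (A),
  the radius |\<xi>|/2 avoids the origin, where the weight may degenerate or blow up if \<kappa> =
  0; on the ball it is continuous and positive and so attains a positive minimum.\<close>

lemma hess_lower_bound:
  fixes H :: "real ^ 'n::finite \<Rightarrow> real"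
  assumes "assumption_A p B H \<or> assumption_B \<beta> B H" and "\<xi>\<^sub>0 \<noteq> 0"
  shows "\<exists>s>0. \<exists>\<gamma>>0. 0 \<notin> cball \<xi>\<^sub>0 s \<and> (\<forall>\<xi>\<in>cball \<xi>\<^sub>0 s. \<forall>\<zeta>.
    \<gamma> * (\<zeta> \<bullet> \<zeta>) \<le> (\<Sum>i\<in>UNIV. \<Sum>j\<in>UNIV. hess (B \<circ> H) \<xi> $ i $ j * \<zeta> $ i * \<zeta> $ j))"
proof -
  define s where "s = norm \<xi>\<^sub>0 / 2"
  have s: "s > 0" "0 \<notin> cball \<xi>\<^sub>0 s" using assms(2) by (auto simp: s_def)
  then have nz: "\<xi> \<noteq> 0" if "\<xi> \<in> cball \<xi>\<^sub>0 s" for \<xi> using that by blast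
  from assms(1) show ?thesis
  proof
    assume "assumption_A p B H"
    then obtain \<kappa> \<gamma> where \<kappa>: "0 \<le> \<kappa>" "\<gamma> > 0" "\<And>\<xi> \<zeta>. \<xi> \<noteq> 0 \<Longrightarrow>
      (\<Sum>i\<in>UNIV. \<Sum>j\<in>UNIV. hess (B \<circ> H) \<xi> $ i $ j * \<zeta> $ i * \<zeta> $ j) \<ge> \<gamma> * (\<kappa> + norm \<xi>) powr (p - 2) * (norm \<zeta>)\<^sup>2"
      unfolding assumption_A_def by blast
    have "continuous_on (cball \<xi>\<^sub>0 s) (\<lambda>\<xi>. \<gamma> * (\<kappa> + norm \<xi>) powr (p - 2))"
      using \<kappa>(1) nz by (intro continuous_intros) (auto simp: add_nonneg_eq_0_iff)
    then obtain \<xi>\<^sub>1 where \<xi>\<^sub>1: "\<xi>\<^sub>1 \<in> cball \<xi>\<^sub>0 s" "\<And>\<xi>. \<xi> \<in> cball \<xi>\<^sub>0 s \<Longrightarrow>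
        \<gamma> * (\<kappa> + norm \<xi>\<^sub>1) powr (p - 2) \<le> \<gamma> * (\<kappa> + norm \<xi>) powr (p - 2)"
      using continuous_attains_inf[of "cball \<xi>\<^sub>0 s" "\<lambda>\<xi>. \<gamma> * (\<kappa> + norm \<xi>) powr (p - 2)"] s(1) by auto
    have "\<kappa> + norm \<xi>\<^sub>1 > 0" using \<kappa>(1) nz[OF \<xi>\<^sub>1(1)] by (simp add: add_nonneg_pos)
    then have "\<gamma> * (\<kappa> + norm \<xi>\<^sub>1) powr (p - 2) > 0" using \<kappa>(2) by simp
    moreover have "\<gamma> * (\<kappa> + norm \<xi>\<^sub>1) powr (p - 2) * (\<zeta> \<bullet> \<zeta>) \<le>
        (\<Sum>i\<in>UNIV. \<Sum>j\<in>UNIV. hess (B \<circ> H) \<xi> $ i $ j * \<zeta> $ i * \<zeta> $ j)" if "\<xi> \<in> cball \<xi>\<^sub>0 s" for \<xi> \<zeta>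
    proof -
      have "\<gamma> * (\<kappa> + norm \<xi>\<^sub>1) powr (p - 2) * (\<zeta> \<bullet> \<zeta>) \<le> \<gamma> * (\<kappa> + norm \<xi>) powr (p - 2) * (\<zeta> \<bullet> \<zeta>)"
        using \<xi>\<^sub>1(2)[OF that] by (intro mult_right_mono) auto
      also have "\<dots> \<le> (\<Sum>i\<in>UNIV. \<Sum>j\<in>UNIV. hess (B \<circ> H) \<xi> $ i $ j * \<zeta> $ i * \<zeta> $ j)"
        using \<kappa>(3)[OF nz[OF that], of \<zeta>] by (simp add: power2_norm_eq_inner)
      finally show ?thesis .
    qed
    ultimately show ?thesis using s by blast
  next
    assume "assumption_B \<beta> B H"
    moreover have "norm \<xi>\<^sub>0 + s > 0" using s(1) by (simp add: add_nonneg_pos)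
    ultimately obtain \<gamma> where \<gamma>: "\<gamma> > 0" "\<And>\<xi> \<zeta>. norm \<xi> \<le> norm \<xi>\<^sub>0 + s \<Longrightarrow>
        (\<Sum>i\<in>UNIV. \<Sum>j\<in>UNIV. hess (B \<circ> H) \<xi> $ i $ j * \<zeta> $ i * \<zeta> $ j) \<ge> \<gamma> * (norm \<zeta>)\<^sup>2"
      unfolding assumption_B_def by blast
    have "norm \<xi> \<le> norm \<xi>\<^sub>0 + s" if "\<xi> \<in> cball \<xi>\<^sub>0 s" for \<xi>
      using that norm_triangle_sub[of \<xi> \<xi>\<^sub>0] by (simp add: dist_norm norm_minus_commute)
    then have "\<forall>\<xi>\<in>cball \<xi>\<^sub>0 s. \<forall>\<zeta>. \<gamma> * (\<zeta> \<bullet> \<zeta>) \<le>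
        (\<Sum>i\<in>UNIV. \<Sum>j\<in>UNIV. hess (B \<circ> H) \<xi> $ i $ j * \<zeta> $ i * \<zeta> $ j)"
      using \<gamma>(2) unfolding power2_norm_eq_inner by blast
    then show ?thesis using s \<gamma>(1) by blast
  qed
qed

definition hess_BH :: "(real \<Rightarrow> real) \<Rightarrow> (real ^ 'n::finite \<Rightarrow> real) \<Rightarrow> real ^ 'n \<Rightarrow> real ^ 'n \<Rightarrow> real ^ 'n" where
  "hess_BH B H \<xi> h = (deriv (half_deriv B) (H \<xi>) * (grad H \<xi> \<bullet> h)) *\<^sub>R grad H \<xi> + half_deriv B (H \<xi>) *\<^sub>R hess_map H \<xi> h"

lemma BH_derivatives:
  fixes H :: "real ^ 'n::finite \<Rightarrow> real"
  assumes B: "standing_B \<beta> B" and H: "standing_H \<beta> H"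
  shows "\<xi> \<noteq> 0 \<Longrightarrow> ((B \<circ> H) has_derivative (\<lambda>h. flux B H \<xi> \<bullet> h)) (at \<xi>)"
    and "\<xi> \<noteq> 0 \<Longrightarrow> (flux B H has_derivative hess_BH B H \<xi>) (at \<xi>)"
    and "continuous_on (- {0}) (\<lambda>\<xi>. hess_BH B H \<xi> h)"
    and "\<xi> \<noteq> 0 \<Longrightarrow> (\<Sum>i\<in>UNIV. \<Sum>j\<in>UNIV. hess (B \<circ> H) \<xi> $ i $ j * \<zeta> $ i * \<zeta> $ j) = hess_BH B H \<xi> \<zeta> \<bullet> \<zeta>"
proof -
  note H1 = standing_H_D(1)[OF H] and H2 = standing_H_D(2)[OF H] and H0 = standing_H_D(4)[OF H]
  have b: "((\<lambda>\<xi>. f (H \<xi>)) has_derivative (\<lambda>h. f' * (grad H \<xi> \<bullet> h))) (at \<xi>)"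
    if "(f has_real_derivative f') (at (H \<xi>))" "\<xi> \<noteq> 0" for f f' \<xi>
    using has_derivative_compose[OF H1[OF that(2)] that(1)[unfolded has_field_derivative_def]] .
  show d1: "((B \<circ> H) has_derivative (\<lambda>h. flux B H \<xi> \<bullet> h)) (at \<xi>)" if "\<xi> \<noteq> 0" for \<xi>
    using b[OF standing_B_D(1)[OF B H0[OF that]] that] that by (simp add: flux_def o_def)
  show d2: "(flux B H has_derivative hess_BH B H \<xi>) (at \<xi>)" if "\<xi> \<noteq> 0" for \<xi>
  proof -
    have "((\<lambda>\<xi>. half_deriv B (H \<xi>) *\<^sub>R grad H \<xi>) has_derivative hess_BH B H \<xi>) (at \<xi>)"
      by (rule has_derivative_eq_rhs[OF has_derivative_scaleR[OF b[OF standing_B_D(2)[OF B H0[OF that]] that] H2[OF that]]])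
        (auto simp: hess_BH_def)
    then show ?thesis
      by (rule has_derivative_transform_within_open[of _ _ _ _ "- {0}"]) (use that in \<open>auto simp: flux_def\<close>)
  qed
  have Hc: "continuous_on (- {0}) H" and gc: "continuous_on (- {0}) (grad H)"
    using H1 H2 by (auto intro!: continuous_at_imp_continuous_on has_derivative_continuous)
  have bc: "continuous_on (- {0}) (\<lambda>\<xi>. half_deriv B (H \<xi>))"
  proof (rule continuous_on_compose2[OF _ Hc])
    show "continuous_on {0<..} (half_deriv B)"
      using standing_B_D(2)[OF B] by (auto intro!: continuous_at_imp_continuous_on DERIV_isCont)
  qed (use H0 in auto)
  have b2c: "continuous_on (- {0}) (\<lambda>\<xi>. deriv (half_deriv B) (H \<xi>))"
    by (rule continuous_on_compose2[OF standing_B_D(3)[OF B] Hc]) (use H0 in auto)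
  show "continuous_on (- {0}) (\<lambda>\<xi>. hess_BH B H \<xi> h)"
    unfolding hess_BH_def by (intro continuous_intros bc b2c gc standing_H_D(3)[OF H])
  assume nz: "\<xi> \<noteq> 0"
  have pj: "partial j (B \<circ> H) \<xi> = flux B H \<xi> $ j" if "\<xi> \<noteq> 0" for j \<xi>
    unfolding partial_def dir_deriv_eq[OF d1[OF that]] by (simp add: inner_axis)
  have hs: "hess (B \<circ> H) \<xi> $ i $ j = hess_BH B H \<xi> (axis i 1) $ j" for i j
  proof -
    have "((\<lambda>\<xi>. flux B H \<xi> $ j) has_derivative (\<lambda>h. hess_BH B H \<xi> h $ j)) (at \<xi>)"
      using has_derivative_inner_left[OF d2[OF nz], of "axis j 1"] by (simp add: inner_axis)
    then have "(partial j (B \<circ> H) has_derivative (\<lambda>h. hess_BH B H \<xi> h $ j)) (at \<xi>)"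
      by (rule has_derivative_transform_within_open[of _ _ _ _ "- {0}"]) (use nz pj in auto)
    from dir_deriv_eq[OF this] show ?thesis by (simp add: hess_def partial_def)
  qed
  have lin: "linear (hess_BH B H \<xi>)" using d2[OF nz] has_derivative_linear by blast
  have "hess_BH B H \<xi> \<zeta> = hess_BH B H \<xi> (\<Sum>i\<in>UNIV. \<zeta> $ i *\<^sub>R axis i 1)"
    using basis_expansion[of \<zeta>] by (simp add: scalar_mult_eq_scaleR)
  also have "\<dots> = (\<Sum>i\<in>UNIV. \<zeta> $ i *\<^sub>R hess_BH B H \<xi> (axis i 1))"
    by (simp add: linear_sum[OF lin] linear_cmul[OF lin])
  finally have "hess_BH B H \<xi> \<zeta> \<bullet> \<zeta> = (\<Sum>i\<in>UNIV. \<zeta> $ i * (hess_BH B H \<xi> (axis i 1) \<bullet> \<zeta>))"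
    by (simp add: inner_sum_left)
  then show "(\<Sum>i\<in>UNIV. \<Sum>j\<in>UNIV. hess (B \<circ> H) \<xi> $ i $ j * \<zeta> $ i * \<zeta> $ j) = hess_BH B H \<xi> \<zeta> \<bullet> \<zeta>"
    by (simp add: hs inner_vec_def sum_distrib_left mult_ac)
qed

lemma elliptic_potential_BH:
  fixes H :: "real ^ 'n::finite \<Rightarrow> real"
  assumes "standing_B \<beta> B" "standing_H \<beta> H" "assumption_A p B H \<or> assumption_B \<beta> B H" "\<xi>\<^sub>0 \<noteq> 0"
  shows "\<exists>s>0. \<exists>\<gamma>. 0 \<notin> cball \<xi>\<^sub>0 s \<and> elliptic_potential (B \<circ> H) (flux B H) (hess_BH B H) (cball \<xi>\<^sub>0 s) \<gamma>"
proof -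
  obtain s \<gamma> where s: "s > 0" "\<gamma> > 0" "0 \<notin> cball \<xi>\<^sub>0 s"
    "\<And>\<xi> \<zeta>. \<xi> \<in> cball \<xi>\<^sub>0 s \<Longrightarrow> \<gamma> * (\<zeta> \<bullet> \<zeta>) \<le> (\<Sum>i\<in>UNIV. \<Sum>j\<in>UNIV. hess (B \<circ> H) \<xi> $ i $ j * \<zeta> $ i * \<zeta> $ j)"
    using hess_lower_bound[OF assms(3,4)] by blast
  have nz: "\<xi> \<noteq> 0" if "\<xi> \<in> cball \<xi>\<^sub>0 s" for \<xi> using that s(3) by blast
  note d = BH_derivatives[OF assms(1,2)]
  have "elliptic_potential (B \<circ> H) (flux B H) (hess_BH B H) (cball \<xi>\<^sub>0 s) \<gamma>"
  proof
    show "hess_BH B H \<xi> h \<bullet> k = hess_BH B H \<xi> k \<bullet> h" if "\<xi> \<in> cball \<xi>\<^sub>0 s" for \<xi> h k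
      by (rule second_derivative_symmetric[of "- {0}" \<xi> "B \<circ> H" "flux B H" "hess_BH B H"])
        (use nz[OF that] d in auto)
    show "continuous_on (cball \<xi>\<^sub>0 s) (\<lambda>\<xi>. hess_BH B H \<xi> h)" for h
      by (rule continuous_on_subset[OF d(3)]) (use s(3) in auto)
    show "\<gamma> * (h \<bullet> h) \<le> hess_BH B H \<xi> h \<bullet> h" if "\<xi> \<in> cball \<xi>\<^sub>0 s" for \<xi> h
      using s(4)[OF that, of h] d(4)[OF nz[OF that], of h] by simp
  qed (use s(2) nz d in auto)
  then show ?thesis using s by blast
qed

section \<open>The direction of the gradient\<close>

text \<open>By the energy identity \<open>H(\<nabla>u) = h(u)\<close>, where \<open>h\<close> is \<open>c - F\<close> followed by a local inverse of \<open>legendre B\<close>.\<close>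

lemma level_function_exists:
  assumes B: "standing_B \<beta> B" and F: "\<And>s. (F has_real_derivative F' s) (at s)"
    and t0: "0 < t\<^sub>0" "legendre B t\<^sub>0 = c - F s\<^sub>0"
  shows "\<exists>h d. 0 < d \<and> h s\<^sub>0 = t\<^sub>0 \<and> (\<forall>s. \<bar>s - s\<^sub>0\<bar> < d \<longrightarrow> 0 < h s \<and> legendre B (h s) = c - F s \<and>
    (h has_real_derivative - F' s / (deriv (half_deriv B) (h s) * h s)) (at s))"
proof -
  let ?L = "legendre B"
  \<comment> \<open>Any interval of positive numbers around \<open>t\<^sub>0\<close> would do.
    Positivity of \<open>t1\<close> confines the inverse to the range where
    \<open>legendre B\<close> has the positive derivative t B''(t).\<close>
  define t1 t2 where "t1 = t\<^sub>0 / 2" and "t2 = 2 * t\<^sub>0"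
  have t: "0 < t1" "t1 < t\<^sub>0" "t\<^sub>0 < t2" using t0(1) by (auto simp: t1_def t2_def)
  have less: "?L x < ?L y" if "0 \<le> x" "x < y" for x y using legendre_less[OF B that] .
  have cont: "isCont ?L x" if "0 < x" for x using legendre_deriv[OF B that] DERIV_isCont by blast
  define g where "g = inv_into {t1..t2} ?L"
  have inj: "inj_on ?L {t1..t2}" using legendre_inj[OF B] t(1) by (auto simp: inj_on_def)
  have gL: "g (?L x) = x" if "t1 \<le> x" "x \<le> t2" for x
    unfolding g_def using inj that by (intro inv_into_f_f) auto
  have gy: "t1 < g y \<and> g y < t2 \<and> ?L (g y) = y" if y: "?L t1 < y" "y < ?L t2" for y
  proof -
    have "continuous_on {t1..t2} ?L"
      using cont t(1) by (auto intro!: continuous_at_imp_continuous_on)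
    then obtain x where x: "t1 \<le> x" "x \<le> t2" "?L x = y"
      using IVT'[of ?L t1 y t2] y t by auto
    then have "x \<noteq> t1" "x \<noteq> t2" using y by auto
    then show ?thesis using x gL[OF x(1,2)] by auto
  qed
  have g': "(g has_real_derivative inverse (deriv (half_deriv B) (g y) * g y)) (at y)"
    if y: "?L t1 < y" "y < ?L t2" for y
  proof (rule DERIV_inverse_function[where f="?L" and a="?L t1" and b="?L t2"])
    note x = gy[OF y]
    have x0: "g y > 0" using x t(1) by linarith
    show "(?L has_real_derivative deriv (half_deriv B) (g y) * g y) (at (g y))"
      by (rule legendre_deriv[OF B x0])
    show "deriv (half_deriv B) (g y) * g y \<noteq> 0" using standing_B_D(5)[OF B x0] x0 by simp
    have "isCont g (?L (g y))"
      by (rule isCont_inverse_function2[of t1 "g y" t2]) (use x gL cont t(1) in auto)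
    then show "isCont g y" using x by simp
  qed (use y gy in auto)
  define h where "h s = g (c - F s)" for s
  have "isCont (\<lambda>s. c - F s) s\<^sub>0" using DERIV_isCont[OF F] by (intro continuous_intros)
  then have "((\<lambda>s. c - F s) \<longlongrightarrow> c - F s\<^sub>0) (nhds s\<^sub>0)"
    unfolding isCont_def by (rule tendsto_at_iff_tendsto_nhds[where g="\<lambda>s. c - F s", THEN iffD1])
  moreover have "c - F s\<^sub>0 \<in> {?L t1<..<?L t2}" using t0(2) less[of t1 t\<^sub>0] less[of t\<^sub>0 t2] t t0(1) by auto
  ultimately have "\<forall>\<^sub>F s in nhds s\<^sub>0. c - F s \<in> {?L t1<..<?L t2}"
    by (intro topological_tendstoD) auto
  then obtain d where d: "d > 0" "\<And>s. \<bar>s - s\<^sub>0\<bar> < d \<Longrightarrow> c - F s \<in> {?L t1<..<?L t2}"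
    by (auto simp: eventually_nhds_metric dist_real_def)
  have "0 < h s \<and> legendre B (h s) = c - F s \<and>
    (h has_real_derivative - F' s / (deriv (half_deriv B) (h s) * h s)) (at s)" if "\<bar>s - s\<^sub>0\<bar> < d" for s
  proof -
    have y: "?L t1 < c - F s" "c - F s < ?L t2" using d(2)[OF that] by auto
    have "((\<lambda>s. c - F s) has_real_derivative 0 - F' s) (at s)" by (intro derivative_intros F)
    from DERIV_chain2[OF g'[OF y] this]
    have "(h has_real_derivative - F' s / (deriv (half_deriv B) (h s) * h s)) (at s)"
      by (simp add: h_def[abs_def] divide_inverse mult.commute)
    then show ?thesis using gy[OF y] t(1) by (auto simp: h_def)
  qed
  moreover have "h s\<^sub>0 = t\<^sub>0" using gL[of t\<^sub>0] t t0(2) by (simp add: h_def)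
  ultimately show ?thesis using d(1) by blast
qed

text \<open>The quotient in the conclusion is the gradient \<open>a\<close> of v = G(u); the length
  of the gradient of u may still vary with u. The proof consists in producing a
  \<open>local_solution\<close> around \<open>x\<^sub>0\<close>.\<close>

lemma direction_locally_constant:
  fixes B F :: "real \<Rightarrow> real" and H u :: "real ^ 'n::finite \<Rightarrow> real"
  assumes B: "standing_B \<beta> B" and H: "standing_H \<beta> H" and F: "C_k_Holder_loc 2 \<beta>' UNIV F"
    and u: "C_k 1 UNIV u" and ell: "assumption_A p B H \<or> assumption_B \<beta> B H"
    and weak: "weak_solution B H F u"
    and energy: "\<And>x. legendre B (H (grad u x)) = c - F (u x)"
    and x\<^sub>0: "grad u x\<^sub>0 \<noteq> 0"
  shows "\<exists>r>0. \<forall>x\<in>cube x\<^sub>0 r. grad u x \<noteq> 0 \<and> grad u x /\<^sub>R H (grad u x) = grad u x\<^sub>0 /\<^sub>R H (grad u x\<^sub>0)"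
proof -
  have F1: "F differentiable (at s)" "dir_deriv 1 F differentiable (at s)" for s
    using F by (auto simp: numeral_2_eq_2)
  have F': "(F has_real_derivative deriv F s) (at s)" for s
    using F1(1) by (simp add: DERIV_deriv_iff_real_differentiable)
  have "dir_deriv 1 F = deriv F"
    using dir_deriv_eq[OF F'[unfolded has_field_derivative_def], of 1] by (intro ext) simp
  then have F'c: "continuous_on UNIV (deriv F)"
    using F1(2) by (auto intro!: continuous_at_imp_continuous_on differentiable_imp_continuous_within)
  have u1: "C1_grad u (grad u)" using C1_grad_vgrad[of u] u by (simp add: vgrad_eq_grad)
  note uc = C1_grad_D(3)[OF u1] and guc = C1_grad_D(2)[OF u1]
  define s\<^sub>0 where "s\<^sub>0 = u x\<^sub>0"
  define t\<^sub>0 where "t\<^sub>0 = H (grad u x\<^sub>0)"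
  have t0: "0 < t\<^sub>0" using standing_H_D(4)[OF H x\<^sub>0] by (simp add: t\<^sub>0_def)
  obtain h d where h: "0 < d" "h s\<^sub>0 = t\<^sub>0" "\<And>s. \<bar>s - s\<^sub>0\<bar> < d \<Longrightarrow> 0 < h s"
    "\<And>s. \<bar>s - s\<^sub>0\<bar> < d \<Longrightarrow> legendre B (h s) = c - F s"
    "\<And>s. \<bar>s - s\<^sub>0\<bar> < d \<Longrightarrow> (h has_real_derivative - deriv F s / (deriv (half_deriv B) (h s) * h s)) (at s)"
    using level_function_exists[OF B F' t0, of c s\<^sub>0] energy[of x\<^sub>0] by (auto simp: t\<^sub>0_def s\<^sub>0_def)
  \<comment> \<open>Freezing h outside an interval around \<open>s\<^sub>0\<close> gives a function
    k that is continuous and positive on the whole line, so that G, and with it v, is defined for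
    all values of u. Near \<open>x\<^sub>0\<close> nothing changes.\<close>
  define cl where "cl = clamp (s\<^sub>0 - d/2) (s\<^sub>0 + d/2)"
  define k where "k s = h (cl s)" for s
  have cl: "\<bar>cl s - s\<^sub>0\<bar> < d" for s
  proof -
    have "cl s \<in> cbox (s\<^sub>0 - d/2) (s\<^sub>0 + d/2)" unfolding cl_def by (rule clamp_in_interval) (use h(1) in auto)
    then show ?thesis using h(1) by (auto simp: abs_le_iff)
  qed
  have k_pos: "0 < k s" for s using h(3)[OF cl] by (simp add: k_def)
  have k_eq: "k s = h s" if "\<bar>s - s\<^sub>0\<bar> \<le> d/2" for s
  proof -
    have "s \<in> cbox (s\<^sub>0 - d/2) (s\<^sub>0 + d/2)" using that unfolding cbox_interval atLeastAtMost_iff by linarith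
    then show ?thesis unfolding k_def cl_def by (simp only: clamp_cancel_cbox)
  qed
  have k_cont: "continuous_on UNIV k"
    unfolding k_def[abs_def] cl_def
  proof (rule clamp_continuous_on)
    show "continuous_on (cbox (s\<^sub>0 - d/2) (s\<^sub>0 + d/2)) h"
    proof (rule continuous_at_imp_continuous_on, rule ballI)
      fix s assume "s \<in> cbox (s\<^sub>0 - d/2) (s\<^sub>0 + d/2)"
      then have "\<bar>s - s\<^sub>0\<bar> < d" using h(1) unfolding cbox_interval atLeastAtMost_iff by linarith
      then show "isCont h s" by (rule DERIV_isCont[OF h(5)])
    qed
  qed
  have "\<exists>G. \<forall>s::real. - \<infinity> < ereal s \<longrightarrow> ereal s < \<infinity> \<longrightarrow> (G has_vector_derivative 1 / k s) (at s)"
    by (rule einterval_antiderivative)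
      (use k_cont k_pos in \<open>auto simp: continuous_on_eq_continuous_at less_imp_neq[symmetric] intro!: continuous_intros\<close>)
  then obtain G where G: "\<And>s. (G has_real_derivative 1 / k s) (at s)"
    by (auto simp: has_real_derivative_iff_has_vector_derivative)
  define v where "v x = G (u x)" for x
  define a where "a x = (1 / k (u x)) *\<^sub>R grad u x" for x
  have ku_cont: "continuous_on UNIV (\<lambda>x. k (u x))"
    by (rule continuous_on_compose2[OF k_cont uc]) simp
  have v: "C1_grad v a"
    unfolding C1_grad_def
  proof safe
    show "continuous_on UNIV a"
      unfolding a_def by (intro continuous_intros ku_cont guc) (use k_pos less_imp_neq in \<open>auto simp: less_imp_neq[symmetric]\<close>)
    show "(v has_derivative (\<bullet>) (a x)) (at x)" for x
      unfolding v_def[abs_def]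
      by (rule has_derivative_eq_rhs[OF has_derivative_compose[OF C1_grad_D(1)[OF u1] G[unfolded has_field_derivative_def]]])
        (auto simp: a_def)
  qed
  have a0: "a x\<^sub>0 \<noteq> 0" using x\<^sub>0 k_pos[of "u x\<^sub>0"] by (simp add: a_def)
  obtain s \<gamma> where s: "s > 0" "0 \<notin> cball (a x\<^sub>0) s"
    and pot: "elliptic_potential (B \<circ> H) (flux B H) (hess_BH B H) (cball (a x\<^sub>0) s) \<gamma>"
    using elliptic_potential_BH[OF B H ell a0] by blast
  define O' where "O' = {x. grad u x \<noteq> 0} \<inter> {x. \<bar>u x - s\<^sub>0\<bar> < d/2} \<inter> {x. dist (a x\<^sub>0) (a x) < s}"
  have "open O'"
    unfolding O'_def using C1_grad_D(2)[OF v]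
    by (intro open_Int open_Collect_less open_Collect_neq continuous_intros guc uc) auto
  moreover have "x\<^sub>0 \<in> O'" using x\<^sub>0 h(1) s(1) by (simp add: O'_def s\<^sub>0_def)
  ultimately obtain R where R: "R > 0" "cube x\<^sub>0 R \<subseteq> O'" using open_contains_cube by blast
  \<comment> \<open>\<open>weak_solution_C1\<close> requires test functions supported in a strictly
    smaller cube; half of the radius is given up for this.\<close>
  define Q where "Q = cube x\<^sub>0 (R/2)"
  have QR: "Q \<subseteq> cube x\<^sub>0 R" unfolding Q_def using R(1) by (intro cube_mono) simp
  have O1: "grad u x \<noteq> 0" "\<bar>u x - s\<^sub>0\<bar> < d/2" "a x \<in> cball (a x\<^sub>0) s" if "x \<in> cube x\<^sub>0 R" for x
    using subsetD[OF R(2) that] by (auto simp: O'_def)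
  have Hgu: "H (grad u x) = k (u x)" if "x \<in> cube x\<^sub>0 R" for x
  proof (rule legendre_inj[OF B])
    have "\<bar>u x - s\<^sub>0\<bar> < d" "k (u x) = h (u x)" using O1(2)[OF that] k_eq h(1) by auto
    then show "legendre B (H (grad u x)) = legendre B (k (u x))" using h(4) energy by simp
  qed (use standing_H_D(4)[OF H O1(1)[OF that]] k_pos[of "u x"] in auto)
  have Ha: "H (a x) = 1" if "x \<in> cube x\<^sub>0 R" for x
    using standing_H_D(5)[OF H, of "1 / k (u x)" "grad u x"] k_pos[of "u x"] Hgu[OF that] by (simp add: a_def)
  have a_nz: "a x \<noteq> 0" if "x \<in> cube x\<^sub>0 R" for x using O1(3)[OF that] s(2) by metis
  have flux_a: "flux B H (a x) = half_deriv B 1 *\<^sub>R grad H (grad u x)" if "x \<in> cube x\<^sub>0 R" for x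
    using a_nz[OF that] Ha[OF that] grad_H_homogeneous[OF H O1(1)[OF that], of "1 / k (u x)"] k_pos[of "u x"]
    by (simp add: flux_def a_def)
  have flux_u: "flux B H (grad u x) = half_deriv B (k (u x)) *\<^sub>R grad H (grad u x)" if "x \<in> cube x\<^sub>0 R" for x
    using O1(1)[OF that] Hgu[OF that] by (simp add: flux_def)
  have fluxc: "continuous_on (- {0}) (flux B H)"
    using BH_derivatives(2)[OF B H] by (auto intro!: continuous_at_imp_continuous_on has_derivative_continuous)
  \<comment> \<open>Outside the cube \<open>a\<close> may vanish, and continuity of the flux has
    been established off the origin only. Projecting x onto the cube first yields a continuous
    extension to all of space.\<close>
  define Y where "Y x = flux B H (a (clamp (x\<^sub>0 - (R/2) *\<^sub>R One) (x\<^sub>0 + (R/2) *\<^sub>R One) x))" for x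
  have YQ: "Y x = flux B H (a x)" if "x \<in> Q" for x
    using that unfolding Y_def Q_def cube_def by simp
  have Yc: "continuous_on UNIV Y"
    unfolding Y_def[abs_def]
  proof (rule clamp_continuous_on)
    show "continuous_on (cbox (x\<^sub>0 - (R/2) *\<^sub>R One) (x\<^sub>0 + (R/2) *\<^sub>R One)) (\<lambda>x. flux B H (a x))"
      using a_nz QR unfolding cube_def[symmetric] Q_def
      by (intro continuous_on_compose2[OF fluxc] continuous_on_subset[OF C1_grad_D(2)[OF v]]) auto
  qed
  interpret local_solution "B \<circ> H" "flux B H" "hess_BH B H" "cball (a x\<^sub>0) s" \<gamma> v a Y x\<^sub>0 "R/2" "B 1"
  proof (intro local_solution.intro pot local_solution_axioms.intro)
    show "C1_grad v a" "continuous_on UNIV Y" "0 < R/2" using v Yc R(1) by auto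
    fix x assume "x \<in> cube x\<^sub>0 (R/2)"
    then have "x \<in> Q" by (simp add: Q_def)
    then show "a x \<in> cball (a x\<^sub>0) s" "Y x = flux B H (a x)" "(B \<circ> H) (a x) = B 1"
      using O1(3) YQ Ha QR by auto
  next
    fix \<phi> \<phi>' assume \<phi>: "C1_grad \<phi> \<phi>'" and supp: "\<And>x. x \<notin> cube x\<^sub>0 (R/2) \<Longrightarrow> \<phi> x = 0"
    have \<phi>'0: "\<phi>' x = 0" if "x \<notin> cube x\<^sub>0 (R/2)" for x using C1_grad_eq_0_outside[OF \<phi> supp that] .
    text \<open>The test function \<open>\<phi> / B'(H(\<nabla>u))\<close> turns the equation for \<open>u\<close> into a divergence-free field.\<close>
    define m where "m x = half_deriv B (k (u x))" for x
    have m_pos: "0 < m x" for x unfolding m_def by (rule standing_B_D(4)[OF B k_pos])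
    have bc: "continuous_on {0<..} (half_deriv B)"
      using standing_B_D(2)[OF B] by (auto intro!: continuous_at_imp_continuous_on DERIV_isCont)
    have mc: "continuous_on UNIV m"
      unfolding m_def by (rule continuous_on_compose2[OF bc ku_cont]) (use k_pos in auto)
    define \<psi> where "\<psi> x = \<phi> x / m x" for x
    define \<psi>' where "\<psi>' x = (1 / m x) *\<^sub>R \<phi>' x + (\<phi> x * deriv F (u x) / (k (u x) * (m x)\<^sup>2)) *\<^sub>R grad u x" for x
    have \<psi>: "C1_grad \<psi> \<psi>'"
      unfolding C1_grad_def
    proof safe
      have F'u: "continuous_on UNIV (\<lambda>x. deriv F (u x))" by (rule continuous_on_compose2[OF F'c uc]) simp
      show "continuous_on UNIV \<psi>'"
        unfolding \<psi>'_def
        by (intro continuous_intros mc ku_cont guc F'u C1_grad_D(2,3)[OF \<phi>])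
          (use m_pos k_pos in \<open>auto simp: less_imp_neq[symmetric]\<close>)
      fix x
      show "(\<psi> has_derivative (\<bullet>) (\<psi>' x)) (at x)"
      \<comment> \<open>Outside the cube u may leave the interval on which k = h, so m need not be
        differentiable there; but \<psi> vanishes on this open set.\<close>
      proof (cases "x \<in> cube x\<^sub>0 (R/2)")
        case False
        have "((\<lambda>y. 0) has_derivative (\<lambda>h. \<psi>' x \<bullet> h)) (at x)"
          using supp[OF False] \<phi>'0[OF False] by (simp add: \<psi>'_def)
        then show ?thesis
          by (rule has_derivative_transform_within_open[of _ _ _ _ "- cube x\<^sub>0 (R/2)"])
            (use False supp closed_cube in \<open>auto simp: \<psi>_def\<close>)
      next
        case True
        define b where "b = deriv (half_deriv B) (h (u x))"
        have ux: "\<bar>u x - s\<^sub>0\<bar> < d/2" using O1(2) QR True by (auto simp: Q_def)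
        have hx: "0 < h (u x)" "k (u x) = h (u x)" using h(3)[of "u x"] k_eq ux h(1) by auto
        have b: "b > 0" unfolding b_def by (rule standing_B_D(5)[OF B hx(1)])
        have "((\<lambda>s. half_deriv B (h s)) has_real_derivative b * (- deriv F (u x) / (b * h (u x)))) (at (u x))"
          unfolding b_def by (rule DERIV_chain2[OF standing_B_D(2)[OF B hx(1)] h(5)]) (use ux in linarith)
        \<comment> \<open>B'' cancels against the denominator of h'.\<close>
        also have "b * (- deriv F (u x) / (b * h (u x))) = - deriv F (u x) / k (u x)"
          using b hx by simp
        finally have "((\<lambda>s. half_deriv B (h s)) has_derivative (*) (- deriv F (u x) / k (u x))) (at (u x))"
          unfolding has_field_derivative_def .
        from has_derivative_compose[OF C1_grad_D(1)[OF u1] this]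
        have "((\<lambda>y. half_deriv B (h (u y))) has_derivative (\<lambda>r. (- deriv F (u x) / k (u x)) * (grad u x \<bullet> r))) (at x)" .
        then have m': "(m has_derivative (\<lambda>r. (- deriv F (u x) / k (u x)) * (grad u x \<bullet> r))) (at x)"
        proof (rule has_derivative_transform_within_open[of _ _ _ _ "{y. \<bar>u y - s\<^sub>0\<bar> < d/2}"])
          show "open {y. \<bar>u y - s\<^sub>0\<bar> < d/2}" by (intro open_Collect_less continuous_intros uc)
        qed (use ux k_eq in \<open>auto simp: m_def\<close>)
        show ?thesis
          unfolding \<psi>_def[abs_def]
          by (rule has_derivative_eq_rhs[OF has_derivative_divide[OF C1_grad_D(1)[OF \<phi>] m']])
            (use m_pos[of x] k_pos[of "u x"] in \<open>auto simp: \<psi>'_def inner_add_left power2_eq_square field_simps\<close>)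
      qed
    qed
    have "integral (cube x\<^sub>0 R) (\<lambda>y. flux B H (grad u y) \<bullet> \<psi>' y - deriv F (u y) * \<psi> y) = 0"
    proof (rule weak_solution_C1[OF weak _ _ _ _ \<psi>])
      show "continuous_on (cube x\<^sub>0 R) (\<lambda>y. flux B H (grad u y))"
        using O1(1) by (intro continuous_on_compose2[OF fluxc] continuous_on_subset[OF guc]) auto
      show "continuous_on (cube x\<^sub>0 R) (\<lambda>y. deriv F (u y))"
        by (intro continuous_on_compose2[OF F'c] continuous_on_subset[OF uc]) auto
      show "\<psi> y = 0" if "y \<notin> cube x\<^sub>0 (R/2)" for y using supp[OF that] by (simp add: \<psi>_def)
    qed (use R(1) in auto)
    \<comment> \<open>The derivative of 1/m contributes \<phi> F'(u) / (k(u) m) times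
      \<open>grad H (grad u y) \<bullet> grad u y\<close>. By Euler's relation the latter is
      H(\<nabla>u) = k(u), so this contribution is F'(u) \<psi>.\<close>
    moreover have "flux B H (grad u y) \<bullet> \<psi>' y - deriv F (u y) * \<psi> y = grad H (grad u y) \<bullet> \<phi>' y" if y: "y \<in> cube x\<^sub>0 R" for y
    proof -
      have "grad H (grad u y) \<bullet> grad u y = k (u y)" using euler_H[OF H O1(1)[OF y]] Hgu[OF y] by simp
      then have "flux B H (grad u y) \<bullet> \<psi>' y = grad H (grad u y) \<bullet> \<phi>' y + \<phi> y * deriv F (u y) / m y"
        unfolding flux_u[OF y] m_def[symmetric] \<psi>'_def using m_pos[of y] k_pos[of "u y"]
        by (simp add: inner_add_right power2_eq_square field_simps)
      then show ?thesis by (simp add: \<psi>_def)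
    qed
    ultimately have "integral (cube x\<^sub>0 R) (\<lambda>y. grad H (grad u y) \<bullet> \<phi>' y) = 0" by (simp cong: integral_cong)
    \<comment> \<open>As H(a) = 1 and \<open>grad H\<close> is homogeneous of degree 0, the flux at
      a differs from \<open>grad H (grad u y)\<close> by the constant factor B'(1).\<close>
    then have "integral (cube x\<^sub>0 R) (\<lambda>y. half_deriv B 1 * (grad H (grad u y) \<bullet> \<phi>' y)) = 0" by simp
    moreover have "half_deriv B 1 * (grad H (grad u y) \<bullet> \<phi>' y) = Y y \<bullet> \<phi>' y" if "y \<in> cube x\<^sub>0 R" for y
      using flux_a[OF that] YQ \<phi>'0 by (cases "y \<in> Q") (auto simp: Q_def)
    ultimately have "integral (cube x\<^sub>0 R) (\<lambda>y. Y y \<bullet> \<phi>' y) = 0" by (simp cong: integral_cong)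
    moreover have "Y x \<bullet> \<phi>' x = 0" if "x \<notin> cube x\<^sub>0 R" for x
    proof -
      have "x \<notin> cube x\<^sub>0 (R/2)" using QR that unfolding Q_def by blast
      then show ?thesis using \<phi>'0 by simp
    qed
    ultimately show "integral UNIV (\<lambda>x. Y x \<bullet> \<phi>' x) = 0"
      using integral_UNIV_eq[of "cube x\<^sub>0 R" "\<lambda>x. Y x \<bullet> \<phi>' x"] by simp
  qed
  have "grad u x \<noteq> 0 \<and> grad u x /\<^sub>R H (grad u x) = grad u x\<^sub>0 /\<^sub>R H (grad u x\<^sub>0)" if x: "x \<in> cube x\<^sub>0 (R/2/16)" for x
  proof -
    have "x \<in> cube x\<^sub>0 R" "x\<^sub>0 \<in> cube x\<^sub>0 R"
      using x cube_mono[of "R/2/16" R x\<^sub>0] R(1) by (auto simp: center_in_cube)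
    then show ?thesis using gradient_locally_constant[OF x] O1(1) Hgu by (simp add: a_def divide_inverse)
  qed
  then show ?thesis using R(1) by (intro exI[of _ "R/2/16"]) auto
qed

section \<open>One-dimensional symmetry\<close>

lemma constant_along_segment:
  fixes u :: "'a::euclidean_space \<Rightarrow> real"
  assumes u: "C1_grad u g" and S: "convex S" "s \<in> S" "t \<in> S"
    and z: "\<And>r. r \<in> S \<Longrightarrow> g (x + r *\<^sub>R w) \<bullet> w = 0"
  shows "u (x + s *\<^sub>R w) = u (x + t *\<^sub>R w)"
proof -
  have "((\<lambda>r. u (x + r *\<^sub>R w)) has_derivative (\<lambda>h. 0)) (at r within S)" if "r \<in> S" for r
  proof -
    have "((\<lambda>r. u (x + r *\<^sub>R w)) has_derivative (\<lambda>h. g (x + r *\<^sub>R w) \<bullet> (h *\<^sub>R w))) (at r)"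
      by (rule has_derivative_compose[where g=u and f="\<lambda>r. x + r *\<^sub>R w"])
        (auto intro!: derivative_eq_intros C1_grad_D(1)[OF u])
    then show ?thesis using z[OF that] by (auto intro: has_derivative_at_withinI)
  qed
  then obtain k where "\<And>r. r \<in> S \<Longrightarrow> u (x + r *\<^sub>R w) = k"
    using has_derivative_zero_constant[OF S(1)] by metis
  then show ?thesis using S by simp
qed

text \<open>All that is kept of the equation is \<open>level\<close>, by which criticality of a
  point depends on the value of u alone, and \<open>loc\<close>, the local constancy of the
  normalized gradient.\<close>

lemma one_dimensional:
  fixes u :: "'a::euclidean_space \<Rightarrow> real"
  assumes u: "C1_grad u g" and pos: "\<And>\<xi>. \<xi> \<noteq> 0 \<Longrightarrow> 0 < H \<xi>"
    and level: "\<And>x y. u x = u y \<Longrightarrow> g x = 0 \<Longrightarrow> g y = 0"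
    and loc: "\<And>x. g x \<noteq> 0 \<Longrightarrow> \<exists>r>0. \<forall>y\<in>cube x r. g y \<noteq> 0 \<and> g y /\<^sub>R H (g y) = g x /\<^sub>R H (g x)"
  shows "\<exists>u\<^sub>0 \<omega>. norm \<omega> = 1 \<and> (\<forall>x. u x = u\<^sub>0 (\<omega> \<bullet> x))"
proof -
  define q where "q x = g x /\<^sub>R H (g x)" for x
  have gq: "g x = H (g x) *\<^sub>R q x" "q x \<noteq> 0" if "g x \<noteq> 0" for x
    using pos[OF that] that by (auto simp: q_def)
  have hyperplane: "g (x + w) \<noteq> 0 \<and> q (x + w) = q x" if x: "g x \<noteq> 0" and w: "q x \<bullet> w = 0" for x w
  proof -
    define p where "p s = x + s *\<^sub>R w" for s
    have p_cont: "continuous_on UNIV p" unfolding p_def by (intro continuous_intros)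
    \<comment> \<open>The clause on \<open>u\<close> is what makes the set closed: equality of
      values passes to limits, \<open>level\<close> then keeps the gradient nonzero there, and
      \<open>loc\<close> carries the value of q over to the limit point.\<close>
    define X where "X = {s. g (p s) \<noteq> 0 \<and> q (p s) = q x \<and> u (p s) = u x}"
    have near: "\<exists>e>0. \<forall>t\<in>ball s e. g (p t) \<noteq> 0 \<and> q (p t) = q (p s)" if nz: "g (p s) \<noteq> 0" for s
    proof -
      obtain r where r: "r > 0" "\<And>y. y \<in> cube (p s) r \<Longrightarrow> g y \<noteq> 0 \<and> q y = q (p s)"
        using loc[OF nz] by (auto simp: q_def)
      have "open (p -` ball (p s) r)" by (intro open_vimage open_ball p_cont)
      moreover have "s \<in> p -` ball (p s) r" using r(1) by simp
      ultimately obtain e where "e > 0" "ball s e \<subseteq> p -` ball (p s) r"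
        using open_contains_ball by blast
      moreover have "ball (p s) r \<subseteq> cube (p s) r"
        using cball_subset_cube[of "p s" r] by auto
      ultimately show ?thesis using r(2) by (intro exI[of _ e]) blast
    qed
    have "open X"
      unfolding open_contains_ball
    proof
      fix s assume s: "s \<in> X"
      then obtain e where e: "e > 0" "\<And>t. t \<in> ball s e \<Longrightarrow> g (p t) \<noteq> 0 \<and> q (p t) = q x"
        using near[of s] by (auto simp: X_def)
      have "u (p t) = u x" if t: "t \<in> ball s e" for t
      proof -
        have "u (x + t *\<^sub>R w) = u (x + s *\<^sub>R w)"
        proof (rule constant_along_segment[OF u convex_ball[of s e] t])
          fix r assume "r \<in> ball s e"
          then have "g (p r) \<noteq> 0" "q (p r) = q x" using e(2) by auto
          then show "g (x + r *\<^sub>R w) \<bullet> w = 0"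
            using gq(1)[of "p r"] w unfolding p_def by (metis inner_scaleR_left mult_zero_right)
        qed (use e(1) in auto)
        then show ?thesis using s by (simp add: X_def p_def)
      qed
      then have "ball s e \<subseteq> X" using e(2) by (auto simp: X_def)
      then show "\<exists>e>0. ball s e \<subseteq> X" using e(1) by blast
    qed
    moreover have "closed X"
      unfolding closed_def open_contains_ball
    proof
      fix s assume s: "s \<in> - X"
      show "\<exists>e>0. ball s e \<subseteq> - X"
      proof (cases "u (p s) = u x")
        case True
        then have "g (p s) \<noteq> 0" using level x by metis
        moreover from this have "q (p s) \<noteq> q x" using s True by (auto simp: X_def)
        ultimately obtain e where "e > 0" "\<And>t. t \<in> ball s e \<Longrightarrow> q (p t) \<noteq> q x" using near by metis
        then show ?thesis by (intro exI[of _ e]) (auto simp: X_def)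
      next
        case False
        have "open {t. u (p t) \<noteq> u x}"
          by (intro open_Collect_neq continuous_on_compose2[OF C1_grad_D(3)[OF u] p_cont] continuous_intros) auto
        moreover have "s \<in> {t. u (p t) \<noteq> u x}" using False by simp
        ultimately obtain e where "e > 0" "ball s e \<subseteq> {t. u (p t) \<noteq> u x}"
          using open_contains_ball by blast
        then show ?thesis by (intro exI[of _ e]) (auto simp: X_def)
      qed
    qed
    moreover have "0 \<in> X" using x by (simp add: X_def p_def)
    ultimately have "X = UNIV" using clopen[of X] by blast
    then have "1 \<in> X" by simp
    then show ?thesis by (simp add: X_def p_def)
  qed
  have parallel: "q y = ((q y \<bullet> q x) / (q x \<bullet> q x)) *\<^sub>R q x" if x: "g x \<noteq> 0" and y: "g y \<noteq> 0" for x y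
  proof (rule ccontr)
    assume ne: "\<not> ?thesis"
    \<comment> \<open>The component of q y orthogonal to q x.\<close>
    define e where "e = q y - ((q y \<bullet> q x) / (q x \<bullet> q x)) *\<^sub>R q x"
    have e: "e \<noteq> 0" using ne by (simp add: e_def)
    have qx: "q x \<bullet> q x \<noteq> 0" using gq(2)[OF x] by simp
    have ex: "q x \<bullet> e = 0" using qx by (simp add: e_def inner_diff_right inner_commute)
    then have ey: "q y \<bullet> e = e \<bullet> e"
      unfolding e_def by (simp add: inner_diff_left)
    \<comment> \<open>This multiple of e, which stays in the hyperplane through x orthogonal to q x,
      is chosen so that x + w also lies in the hyperplane through y orthogonal to q y; recall
      \<open>q y \<bullet> e = e \<bullet> e\<close>. At the common point q takes both
      values.\<close>
    define w where "w = ((q y \<bullet> (y - x)) / (e \<bullet> e)) *\<^sub>R e"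
    have "q x \<bullet> w = 0" using ex by (simp add: w_def)
    then have 1: "q (x + w) = q x" using hyperplane[OF x] by blast
    have "q y \<bullet> (x + w - y) = 0"
      using e ey by (simp add: w_def inner_add_right inner_diff_right)
    then have "q (y + (x + w - y)) = q y" using hyperplane[OF y] by blast
    then have "q y = q x" using 1 by simp
    then show False using e qx by (simp add: e_def)
  qed
  have "\<exists>p. p \<noteq> 0 \<and> (\<forall>x. \<exists>m. g x = m *\<^sub>R p)"
  proof (cases "\<exists>x. g x \<noteq> 0")
    case True
    then obtain x where x: "g x \<noteq> 0" by blast
    have "\<exists>m. g y = m *\<^sub>R q x" for y
    proof (cases "g y = 0")
      case True
      then show ?thesis by (intro exI[of _ 0]) simp
    next
      case False
      then have "g y = H (g y) *\<^sub>R (((q y \<bullet> q x) / (q x \<bullet> q x)) *\<^sub>R q x)"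
        using gq(1)[OF False] parallel[OF x False] by metis
      then show ?thesis by (metis scaleR_scaleR)
    qed
    then show ?thesis using gq(2)[OF x] by blast
  next
    case False
    \<comment> \<open>The gradient vanishes identically, so any direction will do.\<close>
    obtain b :: 'a where "b \<in> Basis" using nonempty_Basis by blast
    then show ?thesis using False by (intro exI[of _ b]) (auto intro: exI[of _ 0])
  qed
  then obtain p where p: "p \<noteq> 0" "\<And>x. \<exists>m. g x = m *\<^sub>R p" by blast
  define \<omega> where "\<omega> = p /\<^sub>R norm p"
  have \<omega>: "norm \<omega> = 1" "\<omega> \<bullet> \<omega> = 1" using p(1) by (simp_all add: \<omega>_def dot_square_norm power2_eq_square)
  have "u x = u ((\<omega> \<bullet> x) *\<^sub>R \<omega>)" for x
  proof -
    define w where "w = (\<omega> \<bullet> x) *\<^sub>R \<omega> - x"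
    have "\<omega> \<bullet> w = 0" using \<omega>(2) by (simp add: w_def inner_diff_right)
    then have "p \<bullet> w = 0" using p(1) by (simp add: \<omega>_def)
    then have "g (x + r *\<^sub>R w) \<bullet> w = 0" for r using p(2)[of "x + r *\<^sub>R w"] by auto
    then have "u (x + 0 *\<^sub>R w) = u (x + 1 *\<^sub>R w)"
      by (intro constant_along_segment[OF u, of UNIV]) auto
    then show ?thesis by (simp add: w_def)
  qed
  then show ?thesis using \<omega>(1) by (intro exI[of _ "\<lambda>s. u (s *\<^sub>R \<omega>)"] exI[of _ \<omega>]) auto
qed

theorem theorem1p4:
  fixes B F :: "real \<Rightarrow> real"
    and H u :: "real ^ 'n::finite \<Rightarrow> real"
    and \<beta> :: real
  assumes "CARD('n) \<ge> 2"
    and "0 < \<beta>" "\<beta> < 1"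
    and "standing_B \<beta> B"
    and "standing_H \<beta> H"
    and "C_k_Holder_loc 2 \<beta> UNIV F"
    and "C_k 1 UNIV u"
    and "(\<exists>p. assumption_A p B H \<and> L_inf u \<and> W1p_loc p u \<and> weak_solution B H F u) \<or>
         (assumption_B \<beta> B H \<and> W1_inf u \<and> weak_solution B H F u)"
    and "\<forall>x. half_deriv B (H (grad u x)) * H (grad u x) - B (H (grad u x)) = c_const F u - F (u x)"
  shows "\<exists>(u\<^sub>0 :: real \<Rightarrow> real) \<omega>. \<omega> \<in> sphere 0 1 \<and> (\<forall>x. u x = u\<^sub>0 (\<omega> \<bullet> x))"
proof -
  \<comment> \<open>In case (ii) \<open>p\<close> is an arbitrary real number.\<close>
  obtain p where ell: "assumption_A p B H \<or> assumption_B \<beta> B H" and weak: "weak_solution B H F u"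
    using assms(8) by blast
  have energy: "legendre B (H (grad u x)) = c_const F u - F (u x)" for x
    using assms(9) by (simp add: legendre_def)
  have u: "C1_grad u (grad u)" using C1_grad_vgrad[of u] assms(7) by (simp add: vgrad_eq_grad)
  have "\<exists>u\<^sub>0 \<omega>. norm \<omega> = 1 \<and> (\<forall>x. u x = u\<^sub>0 (\<omega> \<bullet> x))"
  proof (rule one_dimensional[OF u standing_H_D(4)[OF assms(5)]])
    show "grad u y = 0" if "u x = u y" "grad u x = 0" for x y
    proof (rule ccontr)
      assume nz: "grad u y \<noteq> 0"
      \<comment> \<open>The right-hand side of the energy identity depends on u alone, hence agrees
        at x and y; at the critical point x the left-hand side is
        \<open>legendre B 0\<close>.\<close>
      have "legendre B (H (grad u y)) = legendre B 0"
        using energy[of x] energy[of y] that standing_H_D(6)[OF assms(5)] by simp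
      then show False
        using legendre_less[OF assms(4), of 0 "H (grad u y)"] standing_H_D(4)[OF assms(5) nz] by simp
    qed
    show "\<exists>r>0. \<forall>y\<in>cube x r. grad u y \<noteq> 0 \<and> grad u y /\<^sub>R H (grad u y) = grad u x /\<^sub>R H (grad u x)"
      if "grad u x \<noteq> 0" for x
      by (rule direction_locally_constant[OF assms(4-7) ell weak energy that])
  qed
  then show ?thesis by simp
qed

end
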